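(* Let $p=p(n)$ with $0<p(n)<1$ be such that $\liminf_{n\to\infty} p\log\log n>2\lambda$, where $\lambda=\pi^2/18$, and $1-p=n^{-o(1)}$ (that is, $\log\frac{1}{1-p}\ll\log n$). Let $T$ be the percolation time of a $p$-random subset $A$ of $[n]^2$ under 2-neighbour bootstrap percolation. Then \[ T=\frac{(1+o(1))\log n}{2\log\frac{1}{1-p}} \] with high probability as $n\to\infty$.
   Context: $[n]^2=\{1,\dots,n\}^2$ is viewed as a graph in which two vertices are adjacent when they differ by exactly $1$ in exactly one coordinate. In 2-neighbour bootstrap percolation on $[n]^2$ with initial set $A$, one sets $A_0=A$ and, for $t\ge 1$, $A_t=A_{t-1}\cup\{v\in[n]^2:|N(v)\cap A_{t-1}|\ge 2\}$, where $N(v)$ is the set of neighbours of $v$. The percolation time is $T=\min\{t:A_t=[n]^2\}$ (with $T=\infty$ if no such $t$ exists). A $p$-random subset $A\sim\mathrm{Bin}([n]^2,p)$ contains each vertex independently with probability $p$. The notation $f(n)\ll g(n)$ means $g(n)/f(n)\to\infty$ as $n\to\infty$. "With high probability" means with probability tending to $1$ as $n\to\infty$; the conclusion means that for every $\varepsilon>0$, with probability tending to $1$, $T$ lies between $(1-\varepsilon)$ and $(1+\varepsilon)$ times $\frac{\log n}{2\log(1/(1-p))}$. *)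

theory Defs
  imports "HOL-Probability.Probability"
begin

definition grid :: "nat \<Rightarrow> (nat \<times> nat) set" where
  "grid n = {1..n} \<times> {1..n}"

definition grid_adj :: "nat \<times> nat \<Rightarrow> nat \<times> nat \<Rightarrow> bool" where
  "grid_adj u v \<longleftrightarrow>
     (\<bar>int (fst u) - int (fst v)\<bar> = 1 \<and> snd u = snd v) \<or>
     (fst u = fst v \<and> \<bar>int (snd u) - int (snd v)\<bar> = 1)"

definition nbhd :: "nat \<Rightarrow> nat \<times> nat \<Rightarrow> (nat \<times> nat) set" where
  "nbhd n v = {w \<in> grid n. grid_adj v w}"

primrec infected :: "nat \<Rightarrow> (nat \<times> nat) set \<Rightarrow> nat \<Rightarrow> (nat \<times> nat) set" where
  "infected n A 0 = A"
| "infected n A (Suc t) =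
     infected n A t \<union> {v \<in> grid n. card (nbhd n v \<inter> infected n A t) \<ge> 2}"

text \<open>In \<^typ>\<open>enat\<close> the infimum of a nonempty set is its minimum, and the infimum
  of the empty set is \<open>\<infinity>\<close>.\<close>

definition percolation_time :: "nat \<Rightarrow> (nat \<times> nat) set \<Rightarrow> enat" where
  "percolation_time n A = (INF t \<in> {t. infected n A t = grid n}. enat t)"

text \<open>One independent \<open>q\<close>-coin per vertex of the grid; the random set consists of the
  vertices whose coin shows \<^const>\<open>True\<close>. (\<^const>\<open>bernoulli_pmf\<close> clamps its parameter to
  the unit interval.)\<close>

definition random_subset :: "nat \<Rightarrow> real \<Rightarrow> (nat \<times> nat) set pmf" where
  "random_subset n q =
     map_pmf (\<lambda>f. {v \<in> grid n. f v}) (Pi_pmf (grid n) False (\<lambda>_. bernoulli_pmf q))"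

text \<open>The relation \<open>f(n) \<lless> g(n)\<close>, meaning that \<open>g(n) / f(n)\<close> tends to \<open>\<infinity>\<close>.\<close>

definition much_less :: "(nat \<Rightarrow> real) \<Rightarrow> (nat \<Rightarrow> real) \<Rightarrow> bool" where
  "much_less f g \<longleftrightarrow> filterlim (\<lambda>n. g n / f n) at_top sequentially"

end

theory Submission
  imports Defs "HOL-Real_Asymp.Real_Asymp"
begin

text \<open>
  Let \<open>q = 1 - p\<close> and \<open>\<ell> = ln n / (2 ln (1 / q))\<close>, so that \<open>q\<close> to the power \<open>2 \<ell>\<close> is \<open>1 / n\<close>.
  A vacant interval of length \<open>2 t + 1\<close> in the bottom row is only invaded from its ends and is not
  full at time \<open>t\<close>; for \<open>t \<le> (1 - \<epsilon>) \<ell>\<close> one of the disjoint intervals of this row is vacant.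

  Conversely, if a cell is uninfected at time \<open>t\<^sub>0 + r\<close>, then in each of the four quadrants there is a monotone
  path of \<open>r\<close> steps from it whose cells are uninfected at time \<open>t\<^sub>0\<close>. Every long thin tile (of width \<open>L\<close>
  and length \<open>m L\<close>) met by the path is then not full at time \<open>t\<^sub>0 = o(\<ell>)\<close>, hence either contains no
  internally spanned \<open>L\<close>-square or is crossed by two adjacent vacant lines. The first alternative is negligible
  when an \<open>L\<close>-square is internally spanned with probability at least \<open>(ln n) powr (\<delta> - 1)\<close>, and the second one
  costs \<open>2 L\<close> vacant cells per band of width \<open>L\<close>. So such an arm has probability \<open>q\<close> to the power
  \<open>(2 - o(1)) r\<close>. Interior cells have two independent arms and cells close to one side have at least one,
  which beats the union bound as soon as \<open>r \<ge> (1 + \<epsilon>) \<ell>\<close>.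

  The lower bound \<open>exp (- (\<pi>\<^sup>2 / 9 + \<delta>) / p)\<close> for internal spanning is Holroyd's: a square of side \<open>k\<close> grows to
  side \<open>k + h\<close> if no two adjacent lines among the next \<open>h\<close> ones are vacant on its right and on its top. The
  exponent is twice the integral of the resulting cost; it equals \<open>\<pi>\<^sup>2 / 9\<close> because of an explicit primitive in
  terms of the dilogarithm.
\<close>

section \<open>Random subsets\<close>

text \<open>Write \<open>\<beta> = ln (1 / q)\<close>. The threshold \<pi>^2/9 comes from a balance
  of scales: a tile fills in time about \<open>m * L\<^sup>2\<close>, which has to be o(\<ell>), so
  it offers fewer than \<ell> places for a seed; it must nevertheless contain one, except with
  probability \<open>q ^ (4 * L * M)\<close>. A seed may therefore be as rare as a power of \<ell>
  with exponent slightly above -1, which is what \<open>p * ln (ln n)\<close> above \<pi>^2/9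
  provides.

  The main obstacle is entropy. There are about 2^r monotone paths, and for small \<beta> this
  outweighs the factor \<open>q powr (2 * r)\<close>. Paths are therefore recorded only at scale
  \<open>L\<close>: one label per band, hence about \<open>N powr (r / L)\<close> cases, whose
  logarithm is of smaller order than \<ell> / ln \<ell>, whereas \<beta> \<ell> is at least of that
  order.

  A second obstacle is that \<open>p\<close> is only bounded from below and may tend to 1. All
  scales are therefore powers of \<ell>, not of \<open>ln n\<close>.

  An arm needs a free line behind its first cell. Cells on the sides of the grid do not have it;
  they are handled by walks along the side, and the corner regions by a weaker bound, since they
  contain few cells.\<close>

definition bern_set :: "'a set \<Rightarrow> real \<Rightarrow> 'a set pmf" where
  "bern_set S q = map_pmf (\<lambda>f. {v \<in> S. f v}) (Pi_pmf S False (\<lambda>_. bernoulli_pmf q))"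

definition pr :: "'a set \<Rightarrow> real \<Rightarrow> ('a set \<Rightarrow> bool) \<Rightarrow> real" where
  "pr S q E = measure_pmf.prob (bern_set S q) {A. E A}"

lemma random_subset_eq: "random_subset n q = bern_set (grid n) q"
  by (simp add: random_subset_def bern_set_def)

lemma pr_nonneg: "0 \<le> pr S q E"
  by (simp add: pr_def)

lemma pr_le_1: "pr S q E \<le> 1"
  by (simp add: pr_def)

lemma set_bern_set: "finite S \<Longrightarrow> A \<in> set_pmf (bern_set S q) \<Longrightarrow> A \<subseteq> S"
  by (auto simp: bern_set_def)

lemma pr_mono:
  assumes "finite S" "\<And>A. A \<subseteq> S \<Longrightarrow> E A \<Longrightarrow> F A"
  shows "pr S q E \<le> pr S q F"
  unfolding pr_def
  by (rule measure_pmf.finite_measure_mono_AE)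
     (auto intro!: AE_pmfI dest: set_bern_set[OF assms(1)] assms(2))

lemma pr_cong:
  assumes "finite S" "\<And>A. A \<subseteq> S \<Longrightarrow> E A \<longleftrightarrow> F A"
  shows "pr S q E = pr S q F"
  by (intro antisym pr_mono assms) (auto simp: assms(2))

lemma pr_union:
  assumes "finite S" "finite I" "\<And>A. A \<subseteq> S \<Longrightarrow> E A \<Longrightarrow> \<exists>i\<in>I. F i A"
  shows "pr S q E \<le> (\<Sum>i\<in>I. pr S q (F i))"
proof -
  have "pr S q E \<le> pr S q (\<lambda>A. \<exists>i\<in>I. F i A)"
    using assms by (intro pr_mono) auto
  also have "\<dots> = measure_pmf.prob (bern_set S q) (\<Union>i\<in>I. {A. F i A})"
    unfolding pr_def by (rule arg_cong[where f="measure_pmf.prob _"]) auto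
  also have "\<dots> \<le> (\<Sum>i\<in>I. measure_pmf.prob (bern_set S q) {A. F i A})"
    using assms(2) by (intro measure_pmf.finite_measure_subadditive_finite) auto
  finally show ?thesis by (simp add: pr_def)
qed

lemma pr_or: "pr S q (\<lambda>A. E A \<or> F A) \<le> pr S q E + pr S q F"
proof -
  have "{A. E A \<or> F A} = {A. E A} \<union> {A. F A}" by auto
  thus ?thesis unfolding pr_def
    by (auto intro!: measure_Un_le)
qed

lemma pr_disj:
  assumes "\<And>A. \<not> (E A \<and> F A)"
  shows "pr S q (\<lambda>A. E A \<or> F A) = pr S q E + pr S q F"
proof -
  have "{A. E A \<or> F A} = {A. E A} \<union> {A. F A}" by auto
  thus ?thesis unfolding pr_def
    using measure_pmf.finite_measure_Union[of "{A. E A}" "bern_set S q" "{A. F A}"] assms by auto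
qed

lemma pr_not: "pr S q (\<lambda>A. \<not> E A) = 1 - pr S q E"
proof -
  have "{A. \<not> E A} = UNIV - {A. E A}" by auto
  thus ?thesis unfolding pr_def
    using measure_pmf.prob_compl[of "{A. E A}" "bern_set S q"] by simp
qed

text \<open>The coins outside the image \<open>B\<close> of \<open>T\<close> are forgotten, and the
  remaining ones are renamed by the bijection \<open>e\<close>. Every move of an event between a
  square, a patch and the grid rests on this.\<close>

lemma bern_set_transfer:
  assumes "finite S" "inj_on e T" "e ` T \<subseteq> S"
  shows "map_pmf (\<lambda>A. {c \<in> T. e c \<in> A}) (bern_set S q) = bern_set T q"
proof -
  have fT: "finite T" using assms by (meson finite_imageD finite_subset)
  define B where "B = e ` T"
  have fB: "finite B" using fT B_def by simp
  define U where "U = Pi_pmf S False (\<lambda>_. bernoulli_pmf q)"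
  \<comment> \<open>The renaming has to be a map on the whole type that sends points outside
    \<open>T\<close> to points outside \<open>B\<close>. If \<open>B = UNIV\<close> there is no such
    value, and the inverse bijection is used instead.\<close>
  define h where "h = (\<lambda>x. if x \<in> T then e x else (SOME y. y \<notin> B))"
  have 1: "bern_set B q = map_pmf (\<lambda>A. A \<inter> B) (bern_set S q)"
    unfolding bern_set_def
    by (subst Pi_pmf_subset[OF assms(1), of B]) 
       (use assms(3) B_def in \<open>auto simp: pmf.map_comp o_def intro!: map_pmf_cong\<close>)
  have 2: "bern_set T q = map_pmf (\<lambda>A. {c \<in> T. e c \<in> A}) (bern_set B q)"
  proof (cases "B = UNIV")
    case True
    have *: "Pi_pmf T False (\<lambda>_. bernoulli_pmf q) = 
      map_pmf (\<lambda>g x. if x \<in> T then g (e x) else False) (Pi_pmf B False (\<lambda>_. bernoulli_pmf q))"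
    proof -
      define g where "g = inv_into T e"
      have bij: "bij_betw g B T" unfolding g_def B_def
        using assms(2) by (simp add: bij_betw_inv_into inj_on_imp_bij_betw)
      have "Pi_pmf B False (\<lambda>_. bernoulli_pmf q) = map_pmf (\<lambda>f. f \<circ> g) (Pi_pmf T False (\<lambda>_. bernoulli_pmf q))"
        by (rule Pi_pmf_bij_betw[OF fB bij]) (use True in auto)
      hence "map_pmf (\<lambda>g x. if x \<in> T then g (e x) else False) (Pi_pmf B False (\<lambda>_. bernoulli_pmf q))
        = map_pmf (\<lambda>f x. if x \<in> T then f (g (e x)) else False) (Pi_pmf T False (\<lambda>_. bernoulli_pmf q))"
        by (simp add: pmf.map_comp o_def)
      also have "\<dots> = map_pmf (\<lambda>f x. if x \<in> T then f x else False) (Pi_pmf T False (\<lambda>_. bernoulli_pmf q))"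
        using assms(2) by (intro map_pmf_cong) (auto simp: g_def fun_eq_iff)
      also have "\<dots> = Pi_pmf T False (\<lambda>_. bernoulli_pmf q)"
        by (rule Pi_pmf_default_swap[OF fT])
      finally show ?thesis ..
    qed
    show ?thesis unfolding bern_set_def *
      by (auto simp: pmf.map_comp o_def B_def intro!: map_pmf_cong)
  next
    case False
    hence ne: "(SOME y. y \<notin> B) \<notin> B" by (metis UNIV_eq_I someI_ex)
    have "Pi_pmf T False (\<lambda>_. bernoulli_pmf q) = map_pmf (\<lambda>g. g \<circ> h) (Pi_pmf B False (\<lambda>_. bernoulli_pmf q))"
    proof (rule Pi_pmf_bij_betw[OF fT])
      show "bij_betw h T B" unfolding bij_betw_def h_def B_def using assms(2)
        by (auto simp: inj_on_def)
      show "h x \<notin> B" if "x \<notin> T" for x using that ne by (simp add: h_def)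
    qed
    thus ?thesis unfolding bern_set_def
      by (auto simp: pmf.map_comp o_def h_def B_def intro!: map_pmf_cong)
  qed
  show ?thesis unfolding 2 1 by (auto simp: pmf.map_comp o_def B_def intro!: map_pmf_cong)
qed

lemma pr_transfer:
  assumes "finite S" "inj_on e T" "e ` T \<subseteq> S"
  shows "pr S q (\<lambda>A. P {c \<in> T. e c \<in> A}) = pr T q P"
proof -
  have "pr T q P = measure_pmf.prob (map_pmf (\<lambda>A. {c \<in> T. e c \<in> A}) (bern_set S q)) {A. P A}"
    unfolding pr_def bern_set_transfer[OF assms] ..
  also have "\<dots> = pr S q (\<lambda>A. P {c \<in> T. e c \<in> A})"
    by (simp add: pr_def vimage_def)
  finally show ?thesis ..
qed

lemma pr_restrict:
  assumes "finite S" "T \<subseteq> S"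
  shows "pr S q (\<lambda>A. P (A \<inter> T)) = pr T q P"
proof -
  have "{c \<in> T. id c \<in> A} = A \<inter> T" for A by auto
  thus ?thesis using pr_transfer[of S id T q P] assms by simp
qed

lemma pr_cong_restrict:
  assumes "finite S" "T \<subseteq> S" "\<And>A. A \<subseteq> S \<Longrightarrow> E A \<longleftrightarrow> F (A \<inter> T)"
  shows "pr S q E = pr T q F"
proof -
  have "pr S q E = pr S q (\<lambda>A. F (A \<inter> T))" by (rule pr_cong[OF assms(1,3)])
  thus ?thesis using pr_restrict[OF assms(1,2)] by simp
qed

lemma bern_set_Un:
  assumes "finite S" "finite T" "S \<inter> T = {}"
  shows "bern_set (S \<union> T) q = map_pmf (\<lambda>(A,B). A \<union> B) (pair_pmf (bern_set S q) (bern_set T q))"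
proof -
  let ?P = "\<lambda>S. Pi_pmf S False (\<lambda>_. bernoulli_pmf q)"
  have "bern_set (S \<union> T) q = map_pmf (\<lambda>(f,g). {v \<in> S. f v} \<union> {v \<in> T. g v}) (pair_pmf (?P S) (?P T))"
    unfolding bern_set_def Pi_pmf_union[OF assms] pmf.map_comp o_def
    using assms(3) by (intro map_pmf_cong) auto
  also have "\<dots> = map_pmf (\<lambda>(A,B). A \<union> B) (map_pmf (\<lambda>(f,g). ({v \<in> S. f v}, {v \<in> T. g v})) (pair_pmf (?P S) (?P T)))"
    by (simp add: pmf.map_comp o_def case_prod_unfold)
  also have "map_pmf (\<lambda>(f,g). ({v \<in> S. f v}, {v \<in> T. g v})) (pair_pmf (?P S) (?P T))
     = pair_pmf (bern_set S q) (bern_set T q)"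
    unfolding bern_set_def by (simp add: map_pair)
  finally show ?thesis .
qed

text \<open>That an event depends only on \<open>S\<close> is encoded as invariance under
  intersection with \<open>S\<close>. The coins outside \<open>S \<union> T\<close> are dropped, and
  the law on \<open>S \<union> T\<close> is a product.\<close>

lemma pr_indep:
  assumes fin: "finite U" and sub: "S \<subseteq> U" "T \<subseteq> U" and disj: "S \<inter> T = {}"
    and E: "\<And>A. A \<subseteq> U \<Longrightarrow> E A \<longleftrightarrow> E (A \<inter> S)" and F: "\<And>A. A \<subseteq> U \<Longrightarrow> F A \<longleftrightarrow> F (A \<inter> T)"
  shows "pr U q (\<lambda>A. E A \<and> F A) = pr U q E * pr U q F"
proof -
  have fS: "finite S" "finite T" using fin sub finite_subset by auto
  have "pr U q (\<lambda>A. E A \<and> F A) = pr (S \<union> T) q (\<lambda>A. E (A \<inter> S) \<and> F (A \<inter> T))"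
    using E F sub by (intro pr_cong_restrict fin) (auto simp: Int_assoc Int_absorb1 Un_Int_distrib)
  also have "\<dots> = measure_pmf.prob (pair_pmf (bern_set S q) (bern_set T q))
      {(A,B). E ((A \<union> B) \<inter> S) \<and> F ((A \<union> B) \<inter> T)}"
    by (simp add: pr_def bern_set_Un[OF fS disj] vimage_def case_prod_unfold)
  also have "\<dots> = measure_pmf.prob (pair_pmf (bern_set S q) (bern_set T q)) 
      ({A. A \<subseteq> S \<and> E A} \<times> {B. B \<subseteq> T \<and> F B})"
  proof (intro measure_pmf.finite_measure_eq_AE AE_pmfI)
    fix x assume "x \<in> set_pmf (pair_pmf (bern_set S q) (bern_set T q))"
    hence "fst x \<in> set_pmf (bern_set S q)" "snd x \<in> set_pmf (bern_set T q)" by auto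
    hence sub: "fst x \<subseteq> S" "snd x \<subseteq> T" using fS by (auto dest: set_bern_set)
    hence "(fst x \<union> snd x) \<inter> S = fst x" "(fst x \<union> snd x) \<inter> T = snd x" using disj by auto
    thus "x \<in> {(A, B). E ((A \<union> B) \<inter> S) \<and> F ((A \<union> B) \<inter> T)} \<longleftrightarrow> 
          x \<in> {A. A \<subseteq> S \<and> E A} \<times> {B. B \<subseteq> T \<and> F B}"
      using sub by (cases x) auto
  qed auto
  also have "\<dots> = pr S q (\<lambda>A. A \<subseteq> S \<and> E A) * pr T q (\<lambda>A. A \<subseteq> T \<and> F A)"
    unfolding pr_def using fS by (subst measure_pmf_prob_product) (auto intro!: countable_finite)
  also have "pr S q (\<lambda>A. A \<subseteq> S \<and> E A) = pr S q E" using fS by (intro pr_cong) auto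
  also have "pr T q (\<lambda>A. A \<subseteq> T \<and> F A) = pr T q F" using fS by (intro pr_cong) auto
  also have "pr S q E = pr U q E" using E sub by (intro pr_cong_restrict[symmetric] fin) auto
  also have "pr T q F = pr U q F" using F sub by (intro pr_cong_restrict[symmetric] fin) auto
  finally show ?thesis .
qed

lemma pr_True: "pr U q (\<lambda>A. True) = 1"
  by (simp add: pr_def)

lemma pr_indep_family:
  assumes fin: "finite U" and I: "finite I" and sub: "\<And>i. i \<in> I \<Longrightarrow> S i \<subseteq> U"
    and disj: "\<And>i j. i \<in> I \<Longrightarrow> j \<in> I \<Longrightarrow> i \<noteq> j \<Longrightarrow> S i \<inter> S j = {}"
    and E: "\<And>i A. i \<in> I \<Longrightarrow> A \<subseteq> U \<Longrightarrow> E i A \<longleftrightarrow> E i (A \<inter> S i)"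
  shows "pr U q (\<lambda>A. \<forall>i\<in>I. E i A) = (\<Prod>i\<in>I. pr U q (E i))"
  using I sub disj E
proof (induction I)
  case empty
  show ?case by (simp add: pr_True)
next
  case (insert x I)
  have "pr U q (\<lambda>A. \<forall>i\<in>insert x I. E i A) = pr U q (\<lambda>A. E x A \<and> (\<forall>i\<in>I. E i A))"
    by simp
  also have "\<dots> = pr U q (E x) * pr U q (\<lambda>A. \<forall>i\<in>I. E i A)"
  proof (rule pr_indep[where S="S x" and T="\<Union>i\<in>I. S i"])
    show "S x \<inter> (\<Union>i\<in>I. S i) = {}" using insert by blast
    show "(\<forall>i\<in>I. E i A) \<longleftrightarrow> (\<forall>i\<in>I. E i (A \<inter> (\<Union>i\<in>I. S i)))" if A: "A \<subseteq> U" for A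
    proof (intro ball_cong refl)
      fix i assume i: "i \<in> I"
      hence eq: "A \<inter> (\<Union>i\<in>I. S i) \<inter> S i = A \<inter> S i" by blast
      have "E i (A \<inter> (\<Union>i\<in>I. S i)) \<longleftrightarrow> E i (A \<inter> (\<Union>i\<in>I. S i) \<inter> S i)"
        using A i by (intro insert.prems(3)) auto
      thus "E i A \<longleftrightarrow> E i (A \<inter> (\<Union>i\<in>I. S i))" using eq i A insert.prems(3)[of i A] by simp
    qed
  qed (use insert fin in auto)
  finally show ?case using insert by simp
qed

lemma pr_empty:
  assumes "finite U" "Z \<subseteq> U" "0 \<le> q" "q \<le> 1"
  shows "pr U q (\<lambda>A. A \<inter> Z = {}) = (1 - q) ^ card Z"
proof -
  have fZ: "finite Z" using assms finite_subset by auto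
  have 1: "pr U q (\<lambda>A. i \<notin> A) = 1 - q" if "i \<in> U" for i
  proof -
    have "pr U q (\<lambda>A. i \<notin> A) = measure_pmf.prob (map_pmf (\<lambda>f. f i) (Pi_pmf U False (\<lambda>_. bernoulli_pmf q))) {False}"
      using that by (simp add: pr_def bern_set_def vimage_def)
    also have "\<dots> = 1 - q" using that assms
      by (simp add: Pi_pmf_component[OF assms(1)] measure_pmf_single)
    finally show ?thesis .
  qed
  have "pr U q (\<lambda>A. A \<inter> Z = {}) = pr U q (\<lambda>A. \<forall>i\<in>Z. i \<notin> A)"
    by (rule arg_cong[where f="pr U q"]) auto
  also have "\<dots> = (\<Prod>i\<in>Z. pr U q (\<lambda>A. i \<notin> A))"
    by (rule pr_indep_family[where S="\<lambda>i. {i}"]) (use assms fZ in auto)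
  also have "\<dots> = (\<Prod>i\<in>Z. 1 - q)"
    by (intro prod.cong refl 1) (use assms in auto)
  finally show ?thesis by simp
qed

section \<open>The spreading process on an arbitrary set of cells\<close>

primrec spread :: "(nat \<times> nat) set \<Rightarrow> (nat \<times> nat) set \<Rightarrow> nat \<Rightarrow> (nat \<times> nat) set" where
  "spread S A 0 = A"
| "spread S A (Suc t) =
     spread S A t \<union> {v \<in> S. card ({w \<in> S. grid_adj v w} \<inter> spread S A t) \<ge> 2}"

lemma infected_eq_spread: "infected n A t = spread (grid n) A t"
  by (induction t) (auto simp: nbhd_def)

lemma finite_adj: "finite {w. grid_adj v w}"
proof (rule finite_subset)
  show "{w. grid_adj v w} \<subseteq> {0..fst v + 1} \<times> {0..snd v + 1}"
    by (auto simp: grid_adj_def)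
qed auto

lemma spread_mono_time: "t \<le> t' \<Longrightarrow> spread S A t \<subseteq> spread S A t'"
  by (rule lift_Suc_mono_le) auto

lemma spread_subset: "A \<subseteq> S \<Longrightarrow> spread S A t \<subseteq> S"
  by (induction t) auto

lemma spread_two:
  assumes "v \<in> S" "a \<in> S" "b \<in> S" "a \<noteq> b" "grid_adj v a" "grid_adj v b"
    "a \<in> spread S A t" "b \<in> spread S A t"
  shows "v \<in> spread S A (Suc t)"
proof -
  have "card {a,b} \<le> card ({w \<in> S. grid_adj v w} \<inter> spread S A t)"
    using assms by (intro card_mono) (auto intro: finite_subset[OF _ finite_adj])
  thus ?thesis using assms by simp
qed

text \<open>An injection that preserves adjacency cannot decrease the number of infected neighbours,
  and further neighbours in \<open>S'\<close> only help. This single inclusion serves subregions,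
  translated seeds, reflections and arms.\<close>

lemma spread_embed:
  assumes inj: "inj_on e S" and sub: "e ` S \<subseteq> S'" and A: "e ` A \<subseteq> A'" "A \<subseteq> S"
    and adj: "\<And>a b. a \<in> S \<Longrightarrow> b \<in> S \<Longrightarrow> grid_adj a b \<Longrightarrow> grid_adj (e a) (e b)"
  shows "e ` spread S A t \<subseteq> spread S' A' t"
proof (induction t)
  case 0
  show ?case using A by simp
next
  case (Suc t)
  have "e v \<in> spread S' A' (Suc t)" if v: "v \<in> S" 
    and c: "card ({w \<in> S. grid_adj v w} \<inter> spread S A t) \<ge> 2" for v
  proof -
    let ?X = "{w \<in> S. grid_adj v w} \<inter> spread S A t"
    have "card ?X = card (e ` ?X)"
      using inj by (intro card_image[symmetric]) (auto simp: inj_on_def)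
    also have "\<dots> \<le> card ({w \<in> S'. grid_adj (e v) w} \<inter> spread S' A' t)"
    proof (rule card_mono)
      show "finite ({w \<in> S'. grid_adj (e v) w} \<inter> spread S' A' t)"
        by (rule finite_subset[OF _ finite_adj[of "e v"]]) auto
      show "e ` ?X \<subseteq> {w \<in> S'. grid_adj (e v) w} \<inter> spread S' A' t"
        using adj[OF v] sub Suc by blast
    qed
    finally show ?thesis using c v sub by auto
  qed
  hence "e ` {v \<in> S. card ({w \<in> S. grid_adj v w} \<inter> spread S A t) \<ge> 2} \<subseteq> spread S' A' (Suc t)"
    by blast
  moreover have "spread S' A' t \<subseteq> spread S' A' (Suc t)" by auto
  ultimately show ?case using Suc unfolding spread.simps(2)[of S A] image_Un by blast
qed

lemma spread_mono: "S \<subseteq> S' \<Longrightarrow> A \<subseteq> A' \<Longrightarrow> A \<subseteq> S \<Longrightarrow> spread S A t \<subseteq> spread S' A' t"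
  using spread_embed[of id S S' A A'] by simp

lemma spread_uninfected_step:
  assumes "v \<notin> spread S A (Suc t)" "v \<in> S" "a \<in> S" "b \<in> S" "a \<noteq> b" "grid_adj v a" "grid_adj v b"
  shows "a \<notin> spread S A t \<or> b \<notin> spread S A t"
  using spread_two[OF assms(2-7)] assms(1) by blast

lemma grid_adj_swap: "grid_adj (prod.swap a) (prod.swap b) \<longleftrightarrow> grid_adj a b"
  by (auto simp: grid_adj_def)

lemma spread_swap:
  assumes "A \<subseteq> S"
  shows "spread (prod.swap ` S) (prod.swap ` A) t = prod.swap ` spread S A t"
proof
  have *: "prod.swap ` spread S A t \<subseteq> spread (prod.swap ` S) (prod.swap ` A) t" if "A \<subseteq> S" for S A
    by (rule spread_embed[OF _ _ _ that]) (simp_all only: grid_adj_swap inj_swap inj_on_subset[OF inj_swap] subset_UNIV order_refl)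
  show "prod.swap ` spread S A t \<subseteq> spread (prod.swap ` S) (prod.swap ` A) t"
    by (rule *[OF assms])
  have inv: "prod.swap ` prod.swap ` X = X" for X :: "('a \<times> 'b) set"
    by (simp only: image_image swap_swap image_ident)
  have "prod.swap ` spread (prod.swap ` S) (prod.swap ` A) t \<subseteq> spread S A t"
    using *[OF image_mono[OF assms, of prod.swap]] by (simp only: inv)
  hence "prod.swap ` prod.swap ` spread (prod.swap ` S) (prod.swap ` A) t \<subseteq> prod.swap ` spread S A t"
    by (rule image_mono)
  thus "spread (prod.swap ` S) (prod.swap ` A) t \<subseteq> prod.swap ` spread S A t"
    by (simp only: inv)
qed

section \<open>Growth of rectangles\<close>

text \<open>Every cell of column \<open>c\<close> has one infected neighbour in the full column
  \<open>c'\<close>, so a single infected cell starts a wave in both directions. The absolute values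
  make the lemma usable for growth to the left and to the right.\<close>

lemma fill_column:
  assumes AS: "A \<subseteq> S" and c: "\<bar>int c - int c'\<bar> = 1" "\<bar>int c - int c''\<bar> = 1" "c' \<noteq> c''"
    and S: "{c} \<times> {s<..d} \<subseteq> S" and full: "{c'} \<times> {s<..d} \<subseteq> spread S A \<tau>"
    and z: "z \<in> {s<..d}" "(c, z) \<in> spread S A \<tau> \<or> (c'', z) \<in> spread S A \<tau>"
  shows "{c} \<times> {s<..d} \<subseteq> spread S A (\<tau> + (d - s))"
proof -
  have inS: "x \<in> S" if "x \<in> spread S A t" for x t
    using spread_subset[OF AS] that by blast
  have later: "x \<in> spread S A t'" if "x \<in> spread S A t" "t \<le> t'" for x t t'
    using spread_mono_time[OF that(2)] that(1) by blast
  have base: "(c, z) \<in> spread S A (Suc \<tau>)"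
  proof (cases "(c, z) \<in> spread S A \<tau>")
    case False
    hence 1: "(c'', z) \<in> spread S A \<tau>" using z by blast
    have 2: "(c', z) \<in> spread S A \<tau>" using full z by blast
    show ?thesis
      by (rule spread_two[where a="(c',z)" and b="(c'',z)"])
         (use 1 2 inS S z c in \<open>auto simp: grid_adj_def\<close>)
  qed auto
  \<comment> \<open>The wave covers distance \<open>k\<close> from \<open>z\<close> after
    \<open>Suc k\<close> steps; the extra step is the one in \<open>base\<close>, needed when the
    cell comes from \<open>c''\<close>.\<close>
  have step: "\<forall>y\<in>{s<..d}. \<bar>int y - int z\<bar> \<le> int k \<longrightarrow> (c, y) \<in> spread S A (\<tau> + Suc k)" for k
  proof (induction k)
    case 0
    have "y = z" if "\<bar>int y - int z\<bar> \<le> int 0" for y using that by simp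
    thus ?case using base by auto
  next
    case (Suc k)
    show ?case
    proof (intro ballI impI)
      fix y assume y: "y \<in> {s<..d}" "\<bar>int y - int z\<bar> \<le> int (Suc k)"
      show "(c, y) \<in> spread S A (\<tau> + Suc (Suc k))"
      proof (cases "\<bar>int y - int z\<bar> \<le> int k")
        case True
        thus ?thesis using Suc y later[of "(c,y)" "\<tau> + Suc k"] by auto
      next
        case False
        define y' where "y' = (if y < z then y + 1 else y - 1)"
        have y': "y' \<in> {s<..d}" "\<bar>int y' - int z\<bar> \<le> int k" "\<bar>int y - int y'\<bar> = 1"
          using y False z unfolding y'_def by (auto split: if_splits)
        have 1: "(c, y') \<in> spread S A (\<tau> + Suc k)" using Suc y' by blast
        have "(c', y) \<in> spread S A \<tau>" using full y by blast
        hence 2: "(c', y) \<in> spread S A (\<tau> + Suc k)" by (rule later) simp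
        have "(c, y) \<in> spread S A (Suc (\<tau> + Suc k))"
          by (rule spread_two[where a="(c,y')" and b="(c',y)"])
             (use 1 2 inS S y c y' in \<open>auto simp: grid_adj_def\<close>)
        thus ?thesis by simp
      qed
    qed
  qed
  show ?thesis
  proof safe
    fix y assume y: "y \<in> {s<..d}"
    hence "\<bar>int y - int z\<bar> \<le> int (d - s - 1)" using z by auto
    hence "(c, y) \<in> spread S A (\<tau> + Suc (d - s - 1))" using step y by blast
    moreover have "\<tau> + Suc (d - s - 1) = \<tau> + (d - s)" using y by auto
    ultimately show "(c, y) \<in> spread S A (\<tau> + (d - s))" by (simp only:)
  qed
qed

text \<open>\<open>bridged w b h\<close>: among the \<open>h\<close> lines after line \<open>b\<close>, no two consecutive ones violate \<open>w\<close>,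
  and the last one satisfies it.\<close>

fun bridged :: "(nat \<Rightarrow> bool) \<Rightarrow> nat \<Rightarrow> nat \<Rightarrow> bool" where
  "bridged w b 0 = True"
| "bridged w b (Suc 0) = w (b + 1)"
| "bridged w b (Suc (Suc h)) =
     (if w (b + 1) then bridged w (b + 1) (Suc h) else w (b + 2) \<and> bridged w (b + 2) h)"

lemma bridged_Suc: "w (b + 1) \<Longrightarrow> bridged w (b + 1) h \<Longrightarrow> bridged w b (Suc h)"
  by (cases h) auto

lemma bridged_mono:
  assumes "bridged w b h" "\<And>c. b < c \<Longrightarrow> c \<le> b + h \<Longrightarrow> w c \<Longrightarrow> w' c"
  shows "bridged w' b h"
  using assms
proof (induction w b h rule: bridged.induct)
  case (3 w b h)
  show ?case
  proof (cases "w (b + 1)")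
    case True
    hence "bridged w' (b + 1) (Suc h)" using 3 by auto
    thus ?thesis using bridged_Suc[of w' b "Suc h"] True 3(4)[of "b+1"] by simp
  next
    \<comment> \<open>\<open>w'\<close> may hold at \<open>b + 1\<close> although \<open>w\<close>
      fails there, so the recursion for \<open>w'\<close> can take either branch; both are
      supplied.\<close>
    case False
    hence w: "w (b + 2)" "bridged w' (b + 2) h" using 3 by auto
    have "w' (b + 2)" using 3(4)[of "b+2"] w by simp
    moreover have "bridged w' (b + 1) (Suc h)"
      using bridged_Suc[of w' "b+1" h] w \<open>w' (b + 2)\<close> by simp
    ultimately show ?thesis using w by simp
  qed
qed auto

text \<open>\<open>bridged\<close> provides just what \<open>fill_column\<close> needs: the line
  next to the full block, or the one behind it, contains a cell of \<open>A\<close>. Each line costs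
  one wave of \<open>d - s\<close> steps.\<close>

lemma grow_columns:
  assumes AS: "A \<subseteq> S" and "{a<..b} \<times> {s<..d} \<subseteq> spread S A \<tau>" "a < b"
    and "{a<..b + h} \<times> {s<..d} \<subseteq> S"
    and "bridged (\<lambda>c. \<exists>y\<in>{s<..d}. (c, y) \<in> A) b h"
  shows "{a<..b + h} \<times> {s<..d} \<subseteq> spread S A (\<tau> + h * (d - s))"
  using assms(2-)
proof (induction "\<lambda>c. \<exists>y\<in>{s<..d}. (c, y) \<in> A" b h arbitrary: \<tau> rule: bridged.induct)
  case (1 b)
  thus ?case by simp
next
  have later: "X \<subseteq> spread S A t'" if "X \<subseteq> spread S A t" "t \<le> t'" for X t t'
    using spread_mono_time[OF that(2)] that(1) by blast
  have A0: "x \<in> spread S A t" if "x \<in> A" for x t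
    using spread_mono_time[of 0 t S A] that by auto
  have one: "{a<..b + 1} \<times> {s<..d} \<subseteq> spread S A (\<tau> + (d - s))"
    if "{a<..b} \<times> {s<..d} \<subseteq> spread S A \<tau>" "a < b" "{a<..b + 1} \<times> {s<..d} \<subseteq> S"
       "(\<exists>y\<in>{s<..d}. (b + 1, y) \<in> A) \<or> (\<exists>y\<in>{s<..d}. (b + 2, y) \<in> A)" for b \<tau>
  proof -
    note h = that
    obtain y where y: "y \<in> {s<..d}" "(b + 1, y) \<in> A \<or> (b + 2, y) \<in> A" using h(4) by blast
    have "{b+1} \<times> {s<..d} \<subseteq> spread S A (\<tau> + (d - s))"
      by (rule fill_column[OF AS, where c'=b and c''="b+2" and z=y])
         (use h y A0 in auto)
    moreover have "{a<..b} \<times> {s<..d} \<subseteq> spread S A (\<tau> + (d - s))"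
      by (rule later[OF that(1)]) simp
    moreover have "{a<..b + 1} = {a<..b} \<union> {b + 1}" using that(2) by auto
    ultimately show ?thesis by blast
  qed
  {
    case (2 b)
    thus ?case using one[of b \<tau>] by simp
  next
    case (3 b h)
    let ?w = "\<lambda>c. \<exists>y\<in>{s<..d}. (c, y) \<in> A"
    show ?case
    proof (cases "?w (b + 1)")
      case True
      have "{a<..b + 1} \<times> {s<..d} \<subseteq> S" using 3(5) by auto
      hence "{a<..b + 1} \<times> {s<..d} \<subseteq> spread S A (\<tau> + (d - s))"
        using one[of b \<tau>] 3 True by blast
      hence "{a<..b + 1 + Suc h} \<times> {s<..d} \<subseteq> spread S A (\<tau> + (d - s) + Suc h * (d - s))"
        using 3 True by (intro 3(1)) auto
      thus ?thesis by (simp add: algebra_simps)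
    next
      case False
      hence w: "?w (b + 2)" "bridged ?w (b + 2) h" using 3(6) by auto
      have "{a<..b + 1} \<times> {s<..d} \<subseteq> S" "{a<..b + 2} \<times> {s<..d} \<subseteq> S" using 3(5) by auto
      hence "{a<..b + 1} \<times> {s<..d} \<subseteq> spread S A (\<tau> + (d - s))"
        using one[of b \<tau>] 3 w by blast
      hence "{a<..b + 2} \<times> {s<..d} \<subseteq> spread S A (\<tau> + (d - s) + (d - s))"
        using one[of "b+1" "\<tau> + (d - s)"] 3 w \<open>{a<..b + 2} \<times> {s<..d} \<subseteq> S\<close> by simp
      hence "{a<..b + 2 + h} \<times> {s<..d} \<subseteq> spread S A (\<tau> + (d - s) + (d - s) + h * (d - s))"
        using 3 w False by (intro 3(2)) auto
      moreover have "b + 2 + h = b + Suc (Suc h)"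
        "\<tau> + (d - s) + (d - s) + h * (d - s) = \<tau> + Suc (Suc h) * (d - s)" by simp_all
      ultimately show ?thesis by (simp only:)
    qed
  }
qed

lemma times_subset_swap: "X \<times> Y \<subseteq> prod.swap ` Z \<longleftrightarrow> Y \<times> X \<subseteq> Z"
  by force

lemma swap_mem: "(a, b) \<in> prod.swap ` X \<longleftrightarrow> (b, a) \<in> X"
  by force

lemma grow_rows:
  assumes AS: "A \<subseteq> S" and "{s<..d} \<times> {a<..b} \<subseteq> spread S A \<tau>" "a < b"
    and "{s<..d} \<times> {a<..b + h} \<subseteq> S"
    and "bridged (\<lambda>c. \<exists>x\<in>{s<..d}. (x, c) \<in> A) b h"
  shows "{s<..d} \<times> {a<..b + h} \<subseteq> spread S A (\<tau> + h * (d - s))"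
proof -
  have "{a<..b + h} \<times> {s<..d} \<subseteq> spread (prod.swap ` S) (prod.swap ` A) (\<tau> + h * (d - s))"
  proof (rule grow_columns)
    show "{a<..b} \<times> {s<..d} \<subseteq> spread (prod.swap ` S) (prod.swap ` A) \<tau>"
      using assms(2) by (simp only: spread_swap[OF AS] times_subset_swap)
    show "{a<..b + h} \<times> {s<..d} \<subseteq> prod.swap ` S"
      using assms(4) by (simp only: times_subset_swap)
    show "prod.swap ` A \<subseteq> prod.swap ` S" using AS by (rule image_mono)
  qed (use assms in \<open>simp_all only: swap_mem\<close>)
  thus ?thesis by (simp only: spread_swap[OF AS] times_subset_swap)
qed

section \<open>Internally spanned squares, seeded tiles and backward paths\<close>

definition sq :: "nat \<Rightarrow> (nat \<times> nat) set" where
  "sq k = {0<..k} \<times> {0<..k}"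

text \<open>The time bound is part of the notion. It is inductive: growing from \<open>k\<close> to
  \<open>k + h\<close> takes \<open>h * k + h * (k + h)\<close> steps, at most
  \<open>2 * (k + h)\<^sup>2 - 2 * k\<^sup>2\<close>.\<close>

definition spanned :: "nat \<Rightarrow> (nat \<times> nat) set \<Rightarrow> bool" where
  "spanned k A \<longleftrightarrow> sq k \<subseteq> spread (sq k) (A \<inter> sq k) (2 * k\<^sup>2)"

lemma sq_mono: "k \<le> l \<Longrightarrow> sq k \<subseteq> sq l"
  by (auto simp: sq_def)

lemma finite_sq [simp]: "finite (sq k)"
  by (simp add: sq_def)

lemma card_sq: "card (sq k) = k\<^sup>2"
  by (simp add: sq_def power2_eq_square)

lemma spanned_local: "spanned k A \<longleftrightarrow> spanned k (A \<inter> sq k)"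
  by (simp add: spanned_def)

lemma spanned_1: "spanned 1 A \<longleftrightarrow> (1, 1) \<in> A"
proof -
  have sq: "sq 1 = {(1,1)}" by (auto simp: sq_def)
  have "spread (sq 1) B t = B" if "B \<subseteq> sq 1" for B t
  proof (induction t)
    case (Suc t)
    have "card ({w \<in> sq 1. grid_adj v w} \<inter> B) \<le> 1" for v
      using card_mono[of "{(1,1)}" "{w \<in> sq 1. grid_adj v w} \<inter> B"] sq by auto
    hence "\<not> 2 \<le> card ({w \<in> sq 1. grid_adj v w} \<inter> B)" for v
      by (metis One_nat_def Suc_1 not_less_eq_eq)
    thus ?case using Suc by simp
  qed simp
  thus ?thesis unfolding spanned_def sq by auto
qed

text \<open>Columns are added at height \<open>k\<close>, then rows at width \<open>k + h\<close>.
  Both hypotheses nevertheless inspect only segments of length \<open>k\<close>: the column event,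
  the row event and \<open>spanned k\<close> then live on disjoint sets.\<close>

lemma spanned_grow:
  assumes "spanned k A" "k \<ge> 1"
    and C: "bridged (\<lambda>c. \<exists>y\<in>{0<..k}. (c, y) \<in> A) k h"
    and R: "bridged (\<lambda>c. \<exists>x\<in>{0<..k}. (x, c) \<in> A) k h"
  shows "spanned (k + h) A"
proof -
  let ?S = "sq (k + h)" and ?A = "A \<inter> sq (k + h)"
  have AS: "?A \<subseteq> ?S" by simp
  have "sq k \<subseteq> spread (sq k) (A \<inter> sq k) (2 * k\<^sup>2)" using assms(1) by (simp add: spanned_def)
  also have "\<dots> \<subseteq> spread ?S ?A (2 * k\<^sup>2)"
    by (rule spread_mono) (use sq_mono[of k "k+h"] in auto)
  finally have 1: "{0<..k} \<times> {0<..k} \<subseteq> spread ?S ?A (2 * k\<^sup>2)" by (simp add: sq_def)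
  have 2: "{0<..k+h} \<times> {0<..k} \<subseteq> spread ?S ?A (2 * k\<^sup>2 + h * (k - 0))"
  proof (rule grow_columns[OF AS 1])
    show "bridged (\<lambda>c. \<exists>y\<in>{0<..k}. (c, y) \<in> ?A) k h"
      by (rule bridged_mono[OF C]) (auto simp: sq_def)
  qed (use assms in \<open>auto simp: sq_def\<close>)
  have R': "bridged (\<lambda>c. \<exists>x\<in>{0<..k+h}. (x, c) \<in> ?A) k h"
  proof -
    show ?thesis by (rule bridged_mono[OF R]) (auto simp: sq_def)
  qed
  have "{0<..k+h} \<times> {0<..k+h} \<subseteq> spread ?S ?A (2 * k\<^sup>2 + h * (k - 0) + h * (k + h - 0))"
    by (rule grow_rows[OF AS 2 _ _ R']) (use assms in \<open>auto simp: sq_def\<close>)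
  also have "\<dots> \<subseteq> spread ?S ?A (2 * (k + h)\<^sup>2)"
    by (rule spread_mono_time) (simp add: power2_eq_square algebra_simps)
  finally show ?thesis by (simp add: spanned_def sq_def)
qed

lemma spread_later: "X \<subseteq> spread S A t \<Longrightarrow> t \<le> t' \<Longrightarrow> X \<subseteq> spread S A t'"
  using spread_mono_time by blast

text \<open>The seed grows in both directions simultaneously, one column per \<open>L\<close> steps.
  Columns \<open>X\<close> and \<open>X + D + 1\<close> are not claimed to be full; they only serve
  as the line behind the next one at the two ends.\<close>

lemma seeded_tile_full:
  assumes AS: "A \<subseteq> S" and S: "{X..X + D + 1} \<times> {s<..s + L} \<subseteq> S" and L: "L \<ge> 1"
    and x: "X \<le> x" "x + L \<le> X + D"
    and seed: "spanned L {c \<in> sq L. (x + fst c, s + snd c) \<in> A}"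
    and ne: "\<And>c. c \<in> {X..X + D} \<Longrightarrow> \<exists>y\<in>{s<..s + L}. (c, y) \<in> A \<or> (c + 1, y) \<in> A"
  shows "{X<..X + D} \<times> {s<..s + L} \<subseteq> spread S A (2 * L\<^sup>2 + D * L)"
proof -
  let ?R = "{s<..s + L}" and ?T = "2 * L\<^sup>2"
  have A0: "z \<in> spread S A t" if "z \<in> A" for z t
    using spread_mono_time[of 0 t S A] that by auto
  have seed_full: "{x<..x + L} \<times> ?R \<subseteq> spread S A ?T"
  proof -
    let ?e = "\<lambda>c. (x + fst c, s + snd c)"
    let ?B = "{c \<in> sq L. ?e c \<in> A}"
    have "{x<..x + L} \<times> ?R \<subseteq> ?e ` sq L"
    proof
      fix z assume "z \<in> {x<..x + L} \<times> ?R"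
      hence "z = ?e (fst z - x, snd z - s)" "(fst z - x, snd z - s) \<in> sq L"
        by (auto simp: sq_def)
      thus "z \<in> ?e ` sq L" by blast
    qed
    also have "\<dots> \<subseteq> ?e ` spread (sq L) (?B \<inter> sq L) ?T"
      using seed unfolding spanned_def by (rule image_mono)
    also have "\<dots> \<subseteq> spread S A ?T"
    proof (rule spread_embed)
      show "?e ` sq L \<subseteq> S" using S x by (force simp: sq_def)
    qed (auto simp: inj_on_def grid_adj_def)
    finally show ?thesis .
  qed
  have right: "{x<..x + L + k} \<times> ?R \<subseteq> spread S A (?T + k * L)" if "x + L + k \<le> X + D" for k
    using that
  proof (induction k)
    case 0
    thus ?case using seed_full by simp
  next
    case (Suc k)
    let ?c = "x + L + k"
    obtain y where y: "y \<in> ?R" "(?c + 1, y) \<in> A \<or> (?c + 1 + 1, y) \<in> A"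
      using ne[of "?c + 1"] Suc x L by auto
    have IH: "{x<..?c} \<times> ?R \<subseteq> spread S A (?T + k * L)" using Suc by simp
    have "{?c + 1} \<times> ?R \<subseteq> spread S A (?T + k * L + (s + L - s))"
    proof (rule fill_column[OF AS, where c'="?c" and c''="?c+2" and z=y])
      show "{?c + 1} \<times> ?R \<subseteq> S" using S x Suc by auto
      show "{?c} \<times> ?R \<subseteq> spread S A (?T + k * L)" using IH L by auto
      show "(?c + 1, y) \<in> spread S A (?T + k * L) \<or> (?c + 2, y) \<in> spread S A (?T + k * L)"
        using y A0 by auto
    qed (use y in auto)
    moreover have "{x<..?c} \<times> ?R \<subseteq> spread S A (?T + k * L + (s + L - s))"
      by (rule spread_later[OF IH]) simp
    moreover have "{x<..x + L + Suc k} = {x<..?c} \<union> {?c + 1}" using L by auto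
    moreover have "?T + k * L + (s + L - s) = ?T + Suc k * L" by simp
    ultimately show ?case by (simp only: Sigma_Un_distrib1 Un_subset_iff conj_absorb simp_thms)
  qed
  \<comment> \<open>Mirror image of \<open>right\<close>: the new column is
    \<open>?c + 1 = x - k\<close>, its full neighbour is \<open>?c + 2\<close>, and the helping line
    is \<open>?c\<close>.\<close>
  have left: "{x - k<..x + L} \<times> ?R \<subseteq> spread S A (?T + k * L)" if "k \<le> x - X" for k
    using that
  proof (induction k)
    case 0
    thus ?case using seed_full by simp
  next
    case (Suc k)
    let ?c = "x - Suc k"
    have c1: "?c + 1 = x - k" using Suc by simp
    have cX: "X \<le> ?c" using Suc x by simp
    obtain y where y: "y \<in> ?R" "(?c, y) \<in> A \<or> (?c + 1, y) \<in> A"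
    proof -
      have "?c \<in> {X..X + D}" using x(2) cX by (simp add: le_diff_conv)
      from ne[OF this] show ?thesis using that by blast
    qed
    have IH: "{x - k<..x + L} \<times> ?R \<subseteq> spread S A (?T + k * L)" using Suc by simp
    have "{?c + 1} \<times> ?R \<subseteq> spread S A (?T + k * L + (s + L - s))"
    proof (rule fill_column[OF AS, where c'="?c + 2" and c''="?c" and z=y])
      show "{?c + 1} \<times> ?R \<subseteq> S" using S x cX Suc by auto
      show "{?c + 2} \<times> ?R \<subseteq> spread S A (?T + k * L)" proof -
        have "?c + 2 \<in> {x - k<..x + L}" using c1 L diff_le_self[of x k] by simp
        thus ?thesis using IH by blast
      qed
      show "(?c + 1, y) \<in> spread S A (?T + k * L) \<or> (?c, y) \<in> spread S A (?T + k * L)"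
        using y A0 by auto
    qed (use y in auto)
    moreover have "{x - k<..x + L} \<times> ?R \<subseteq> spread S A (?T + k * L + (s + L - s))"
      by (rule spread_later[OF IH]) simp
    moreover have "{x - Suc k<..x + L} = {x - k<..x + L} \<union> {?c + 1}" using L c1 by auto
    moreover have "?T + k * L + (s + L - s) = ?T + Suc k * L" by simp
    ultimately show ?case by (simp only: Sigma_Un_distrib1 Un_subset_iff conj_absorb simp_thms)
  qed
  let ?k1 = "X + D - (x + L)" and ?k2 = "x - X"
  have r: "{x<..X + D} \<times> ?R \<subseteq> spread S A (?T + ?k1 * L)" using right[of ?k1] x by simp
  have l: "{X<..x + L} \<times> ?R \<subseteq> spread S A (?T + ?k2 * L)" using left[of ?k2] x by simp
  have "{x<..X + D} \<times> ?R \<subseteq> spread S A (?T + D * L)"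
    by (rule spread_later[OF r]) (use x in \<open>auto intro!: mult_right_mono\<close>)
  moreover have "{X<..x + L} \<times> ?R \<subseteq> spread S A (?T + D * L)"
    by (rule spread_later[OF l]) (use x in \<open>auto intro!: mult_right_mono\<close>)
  moreover have "{X<..X + D} = {x<..X + D} \<union> {X<..x + L}" using x by auto
  ultimately show ?thesis by (simp only: Sigma_Un_distrib1 Un_subset_iff conj_absorb simp_thms)
qed

text \<open>An uninfected cell forces a monotone path of cells uninfected at earlier times; only the
  rows and columns met by the path are recorded.\<close>

lemma backward_path:
  assumes S: "\<And>i j. i \<le> N \<Longrightarrow> j \<le> N \<Longrightarrow> (i, j) \<in> S"
  shows "(x, y) \<notin> spread S A (\<tau> + r) \<Longrightarrow> x + r \<le> N \<Longrightarrow> y + r \<le> N \<Longrightarrow>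
    \<exists>X Y. X + Y = x + y + r \<and> x \<le> X \<and> y \<le> Y \<and>
      (\<forall>i\<in>{x..X}. \<exists>j\<in>{y..Y}. (i, j) \<notin> spread S A \<tau>) \<and>
      (\<forall>j\<in>{y..Y}. \<exists>i\<in>{x..X}. (i, j) \<notin> spread S A \<tau>)"
proof (induction r arbitrary: x y)
  case 0
  thus ?case by (intro exI[of _ x] exI[of _ y]) auto
next
  case (Suc r)
  have xy: "(x, y) \<notin> spread S A \<tau>"
    using Suc.prems(1) spread_mono_time[of \<tau> "\<tau> + Suc r" S A] by auto
  have "(x + 1, y) \<notin> spread S A (\<tau> + r) \<or> (x, y + 1) \<notin> spread S A (\<tau> + r)"
    by (rule spread_uninfected_step[where v="(x,y)"])
       (use Suc.prems S in \<open>auto simp: grid_adj_def\<close>)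
  thus ?case
  proof
    assume "(x + 1, y) \<notin> spread S A (\<tau> + r)"
    from Suc.IH[OF this] Suc.prems obtain X Y where
      XY: "X + Y = x + 1 + y + r" "x + 1 \<le> X" "y \<le> Y"
      and c: "\<And>i. i \<in> {x+1..X} \<Longrightarrow> \<exists>j\<in>{y..Y}. (i, j) \<notin> spread S A \<tau>"
      and d: "\<And>j. j \<in> {y..Y} \<Longrightarrow> \<exists>i\<in>{x+1..X}. (i, j) \<notin> spread S A \<tau>" by auto
    show ?thesis
    proof (intro exI conjI ballI)
      show "\<exists>j\<in>{y..Y}. (i, j) \<notin> spread S A \<tau>" if "i \<in> {x..X}" for i
        using c[of i] that xy XY by (cases "i = x") auto
      show "\<exists>i\<in>{x..X}. (i, j) \<notin> spread S A \<tau>" if "j \<in> {y..Y}" for j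
        using d[OF that] by force
    qed (use XY in auto)
  next
    assume "(x, y + 1) \<notin> spread S A (\<tau> + r)"
    from Suc.IH[OF this] Suc.prems obtain X Y where
      XY: "X + Y = x + (y + 1) + r" "x \<le> X" "y + 1 \<le> Y"
      and c: "\<And>i. i \<in> {x..X} \<Longrightarrow> \<exists>j\<in>{y+1..Y}. (i, j) \<notin> spread S A \<tau>"
      and d: "\<And>j. j \<in> {y+1..Y} \<Longrightarrow> \<exists>i\<in>{x..X}. (i, j) \<notin> spread S A \<tau>" by auto
    show ?thesis
    proof (intro exI conjI ballI)
      show "\<exists>i\<in>{x..X}. (i, j) \<notin> spread S A \<tau>" if "j \<in> {y..Y}" for j
        using d[of j] that xy XY by (cases "j = y") auto
      show "\<exists>j\<in>{y..Y}. (i, j) \<notin> spread S A \<tau>" if "i \<in> {x..X}" for i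
        using c[OF that] by force
    qed (use XY in auto)
  qed
qed

section \<open>The probability that a square is internally spanned\<close>

lemma bridged_cong:
  assumes "\<And>c. b < c \<Longrightarrow> c \<le> b + h \<Longrightarrow> w c \<longleftrightarrow> w' c"
  shows "bridged w b h \<longleftrightarrow> bridged w' b h"
  using assms by (auto elim!: bridged_mono)

fun bridge_prob :: "real \<Rightarrow> nat \<Rightarrow> real" where
  "bridge_prob u 0 = 1"
| "bridge_prob u (Suc 0) = u"
| "bridge_prob u (Suc (Suc h)) = u * bridge_prob u (Suc h) + (1 - u) * u * bridge_prob u h"

text \<open>Line \<open>c\<close> is an abstract set \<open>G c\<close>, so columns and rows need
  only one proof.\<close>

lemma pr_bridged:
  assumes fin: "finite U" and p: "0 \<le> p" "p \<le> 1"
    and disj: "\<And>c c'. c \<noteq> c' \<Longrightarrow> G c \<inter> G c' = {}" and card: "\<And>c. card (G c) = k"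
    and sub: "\<And>c. b < c \<Longrightarrow> c \<le> b + h \<Longrightarrow> G c \<subseteq> U"
  shows "pr U p (\<lambda>A. bridged (\<lambda>c. A \<inter> G c \<noteq> {}) b h) = bridge_prob (1 - (1 - p) ^ k) h"
  using sub
proof (induction "1 - (1 - p) ^ k" h arbitrary: b rule: bridge_prob.induct)
  case 1
  show ?case by (simp add: pr_True)
next
  have empty: "pr U p (\<lambda>A. A \<inter> G c = {}) = (1 - p) ^ k" if "G c \<subseteq> U" for c
    using pr_empty[OF fin that p] card by simp
  have nonempty: "pr U p (\<lambda>A. A \<inter> G c \<noteq> {}) = 1 - (1 - p) ^ k" if "G c \<subseteq> U" for c
    using pr_not[of U p "\<lambda>A. A \<inter> G c = {}"] empty[OF that] by simp
  have cut: "(A \<inter> V) \<inter> G c = A \<inter> G c" if "G c \<subseteq> V" for A V c using that by blast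
  have local: "bridged (\<lambda>c. A \<inter> G c \<noteq> {}) b h \<longleftrightarrow> bridged (\<lambda>c. (A \<inter> V) \<inter> G c \<noteq> {}) b h"
    if "\<And>c. c \<in> {b<..b+h} \<Longrightarrow> G c \<subseteq> V" for A V b h
    by (rule bridged_cong) (simp add: cut that)
  have dj: "G a \<inter> (\<Union>c\<in>{i<..j}. G c) = {}" if "a \<le> i" for a i j
  proof -
    have "G a \<inter> G c = {}" if "c \<in> {i<..j}" for c
      by (rule disj) (use that \<open>a \<le> i\<close> in auto)
    thus ?thesis by blast
  qed
  {
    case 2
    show ?case using nonempty[of "b+1"] 2 by simp
  next
    case (3 h)
    have sub: "G c \<subseteq> U" if "c \<in> {b<..b + Suc (Suc h)}" for c using 3(3)[of c] that by simp
    have subU: "(\<Union>c\<in>{i<..j}. G c) \<subseteq> U" if "b \<le> i" "j \<le> b + Suc (Suc h)" for i j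
      by (rule UN_least, rule sub) (use that in auto)
    let ?B = "\<lambda>b h A. bridged (\<lambda>c. A \<inter> G c \<noteq> {}) b h"
    \<comment> \<open>Either line \<open>b + 1\<close> is occupied, or it is vacant and line
      \<open>b + 2\<close> is occupied; the rest of the event concerns later lines only.\<close>
    have "pr U p (?B b (Suc (Suc h))) = pr U p (\<lambda>A. (A \<inter> G (b+1) \<noteq> {} \<and> ?B (b+1) (Suc h) A) \<or>
        (A \<inter> G (b+1) = {} \<and> A \<inter> G (b+2) \<noteq> {} \<and> ?B (b+2) h A))"
      by (intro pr_cong fin) auto
    also have "\<dots> = pr U p (\<lambda>A. A \<inter> G (b+1) \<noteq> {} \<and> ?B (b+1) (Suc h) A)
       + pr U p (\<lambda>A. A \<inter> G (b+1) = {} \<and> A \<inter> G (b+2) \<noteq> {} \<and> ?B (b+2) h A)"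
      by (rule pr_disj) auto
    also have "pr U p (\<lambda>A. A \<inter> G (b+1) \<noteq> {} \<and> ?B (b+1) (Suc h) A)
      = pr U p (\<lambda>A. A \<inter> G (b+1) \<noteq> {}) * pr U p (?B (b+1) (Suc h))"
    proof (rule pr_indep[OF fin, where S="G (b+1)" and T="\<Union>c\<in>{b+1<..b+1+Suc h}. G c"])
      show "G (b+1) \<inter> (\<Union>c\<in>{b+1<..b+1+Suc h}. G c) = {}" by (rule dj) simp
      show "?B (b+1) (Suc h) A \<longleftrightarrow> ?B (b+1) (Suc h) (A \<inter> (\<Union>c\<in>{b+1<..b+1+Suc h}. G c))" for A
        by (rule local) blast
      show "A \<inter> G (b+1) \<noteq> {} \<longleftrightarrow> (A \<inter> G (b+1)) \<inter> G (b+1) \<noteq> {}" for A by (simp add: Int_assoc)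
    qed ((rule subU sub; simp)+)
    also have "pr U p (\<lambda>A. A \<inter> G (b+1) = {} \<and> A \<inter> G (b+2) \<noteq> {} \<and> ?B (b+2) h A)
      = pr U p (\<lambda>A. A \<inter> G (b+1) = {}) * pr U p (\<lambda>A. A \<inter> G (b+2) \<noteq> {} \<and> ?B (b+2) h A)"
    proof (rule pr_indep[OF fin, where S="G (b+1)" and T="\<Union>c\<in>{b+1<..b+2+h}. G c"])
      show "G (b+1) \<inter> (\<Union>c\<in>{b+1<..b+2+h}. G c) = {}" by (rule dj) simp
      show "(A \<inter> G (b+2) \<noteq> {} \<and> ?B (b+2) h A) \<longleftrightarrow> (A \<inter> (\<Union>c\<in>{b+1<..b+2+h}. G c)) \<inter> G (b+2) \<noteq> {} \<and> ?B (b+2) h (A \<inter> (\<Union>c\<in>{b+1<..b+2+h}. G c))" for A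
      proof (intro conj_cong local)
        have "G (b+2) \<subseteq> (\<Union>c\<in>{b+1<..b+2+h}. G c)" by (rule UN_upper) simp
        from cut[OF this] show "A \<inter> G (b+2) \<noteq> {} \<longleftrightarrow> (A \<inter> (\<Union>c\<in>{b+1<..b+2+h}. G c)) \<inter> G (b+2) \<noteq> {}" by simp
        show "G c \<subseteq> (\<Union>c\<in>{b+1<..b+2+h}. G c)" if "c \<in> {b+2<..b+2+h}" for c
          by (rule UN_upper) (use that in simp)
      qed
      show "A \<inter> G (b+1) = {} \<longleftrightarrow> (A \<inter> G (b+1)) \<inter> G (b+1) = {}" for A by (simp add: Int_assoc)
    qed ((rule subU sub; simp)+)
    also have "pr U p (\<lambda>A. A \<inter> G (b+2) \<noteq> {} \<and> ?B (b+2) h A)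
      = pr U p (\<lambda>A. A \<inter> G (b+2) \<noteq> {}) * pr U p (?B (b+2) h)"
    proof (rule pr_indep[OF fin, where S="G (b+2)" and T="\<Union>c\<in>{b+2<..b+2+h}. G c"])
      show "G (b+2) \<inter> (\<Union>c\<in>{b+2<..b+2+h}. G c) = {}" by (rule dj) simp
      show "?B (b+2) h A \<longleftrightarrow> ?B (b+2) h (A \<inter> (\<Union>c\<in>{b+2<..b+2+h}. G c))" for A
        by (rule local) blast
      show "A \<inter> G (b+2) \<noteq> {} \<longleftrightarrow> (A \<inter> G (b+2)) \<inter> G (b+2) \<noteq> {}" for A by (simp add: Int_assoc)
    qed ((rule subU sub; simp)+)
    also have "pr U p (\<lambda>A. A \<inter> G (b+1) \<noteq> {}) = 1 - (1 - p) ^ k" using 3(3) by (intro nonempty) auto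
    also have "pr U p (\<lambda>A. A \<inter> G (b+2) \<noteq> {}) = 1 - (1 - p) ^ k" using 3(3) by (intro nonempty) auto
    also have "pr U p (\<lambda>A. A \<inter> G (b+1) = {}) = (1 - p) ^ k" using 3(3) by (intro empty) auto
    also have "pr U p (?B (b+1) (Suc h)) = bridge_prob (1 - (1 - p) ^ k) (Suc h)"
      using 3(3) by (intro 3(1)) auto
    also have "pr U p (?B (b+2) h) = bridge_prob (1 - (1 - p) ^ k) h"
      using 3(3) by (intro 3(2)) auto
    finally show ?case by simp
  }
qed

definition span_prob :: "real \<Rightarrow> nat \<Rightarrow> real" where
  "span_prob p k = pr (sq k) p (spanned k)"

lemma span_prob_nonneg: "0 \<le> span_prob p k" and span_prob_le_1: "span_prob p k \<le> 1"
  by (simp_all add: span_prob_def pr_nonneg pr_le_1)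

lemma span_prob_1:
  assumes "0 \<le> p" "p \<le> 1"
  shows "span_prob p 1 = p"
proof -
  have sq1: "sq (Suc 0) = {(Suc 0, Suc 0)}" by (auto simp: sq_def)
  have "span_prob p 1 = pr (sq 1) p (\<lambda>A. \<not> A \<inter> sq 1 = {})"
    unfolding span_prob_def by (rule pr_cong) (auto simp: spanned_1[unfolded One_nat_def] sq1)
  also have "\<dots> = p"
    using pr_empty[of "sq 1" "sq 1" p] assms pr_not[of "sq 1" p "\<lambda>A. A \<inter> sq 1 = {}"] by (simp add: card_sq)
  finally show ?thesis .
qed

text \<open>The three events of \<open>spanned_grow\<close> are independent; the square comes from
  the two directions.\<close>

lemma span_prob_grow:
  assumes p: "0 \<le> p" "p \<le> 1" and k: "k \<ge> 1"
  shows "span_prob p (k + h) \<ge> span_prob p k * (bridge_prob (1 - (1 - p) ^ k) h)\<^sup>2"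
proof -
  let ?U = "sq (k + h)"
  let ?C = "\<lambda>c. {c} \<times> {0<..k}" and ?R = "\<lambda>c. {0<..k} \<times> {c}"
  let ?c = "\<lambda>A. bridged (\<lambda>c. A \<inter> ?C c \<noteq> {}) k h" and ?r = "\<lambda>A. bridged (\<lambda>c. A \<inter> ?R c \<noteq> {}) k h"
  have C: "pr ?U p ?c = bridge_prob (1 - (1 - p) ^ k) h"
    by (rule pr_bridged) (use p in \<open>auto simp: sq_def\<close>)
  have R: "pr ?U p ?r = bridge_prob (1 - (1 - p) ^ k) h"
    by (rule pr_bridged) (use p in \<open>auto simp: sq_def\<close>)
  have Cl: "?c A \<longleftrightarrow> ?c (A \<inter> V)" if "{k<..k+h} \<times> {0<..k} \<subseteq> V" for A V 
  proof (rule bridged_cong)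
    fix c assume "k < c" "c \<le> k + h"
    hence "?C c \<subseteq> V" using that by auto
    thus "A \<inter> ?C c \<noteq> {} \<longleftrightarrow> A \<inter> V \<inter> ?C c \<noteq> {}" by blast
  qed
  have Rl: "?r A \<longleftrightarrow> ?r (A \<inter> V)" if "{0<..k} \<times> {k<..k+h} \<subseteq> V" for A V 
  proof (rule bridged_cong)
    fix c assume "k < c" "c \<le> k + h"
    hence "?R c \<subseteq> V" using that by auto
    thus "A \<inter> ?R c \<noteq> {} \<longleftrightarrow> A \<inter> V \<inter> ?R c \<noteq> {}" by blast
  qed
  have "span_prob p k * (bridge_prob (1 - (1 - p) ^ k) h)\<^sup>2 
     = pr ?U p (spanned k) * (pr ?U p ?c * pr ?U p ?r)"
  proof -
    have "pr ?U p (spanned k) = span_prob p k" unfolding span_prob_def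
      by (rule pr_cong_restrict, simp, simp add: sq_mono, rule spanned_local)
    thus ?thesis unfolding C R by (simp add: power2_eq_square)
  qed
  also have "pr ?U p ?c * pr ?U p ?r = pr ?U p (\<lambda>A. ?c A \<and> ?r A)"
  proof (rule pr_indep[symmetric, where S="{k<..k+h} \<times> {0<..k}" and T="{0<..k} \<times> {k<..k+h}"])
    show "?c A \<longleftrightarrow> ?c (A \<inter> {k<..k+h} \<times> {0<..k})" for A by (rule Cl) simp
    show "?r A \<longleftrightarrow> ?r (A \<inter> {0<..k} \<times> {k<..k+h})" for A by (rule Rl) simp
  qed (auto simp: sq_def)
  also have "pr ?U p (spanned k) * \<dots> = pr ?U p (\<lambda>A. spanned k A \<and> ?c A \<and> ?r A)"
  proof (rule pr_indep[symmetric, where S="sq k" and T="{k<..k+h} \<times> {0<..k} \<union> {0<..k} \<times> {k<..k+h}"])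
    let ?T = "{k<..k+h} \<times> {0<..k} \<union> {0<..k} \<times> {k<..k+h}"
    show "(?c A \<and> ?r A) \<longleftrightarrow> (?c (A \<inter> ?T) \<and> ?r (A \<inter> ?T))" for A
      by (intro conj_cong Cl Rl) auto
    show "spanned k A \<longleftrightarrow> spanned k (A \<inter> sq k)" for A by (rule spanned_local)
  qed (use sq_mono[of k "k+h"] in \<open>auto simp: sq_def\<close>)
  also have "\<dots> \<le> span_prob p (k + h)" unfolding span_prob_def
  proof (rule pr_mono)
    fix A assume A: "spanned k A \<and> ?c A \<and> ?r A"
    have "bridged (\<lambda>c. \<exists>y\<in>{0<..k}. (c, y) \<in> A) k h" by (rule bridged_mono[of "\<lambda>c. A \<inter> ?C c \<noteq> {}"]) (use A in auto)
    moreover have "bridged (\<lambda>c. \<exists>x\<in>{0<..k}. (x, c) \<in> A) k h" by (rule bridged_mono[of "\<lambda>c. A \<inter> ?R c \<noteq> {}"]) (use A in auto)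
    ultimately show "spanned (k + h) A" using A spanned_grow k by blast
  qed auto
  finally show ?thesis .
qed

text \<open>The exponential growth rate of \<^const>\<open>bridge_prob\<close>: the positive root of
  \<open>\<beta>\<^sup>2 = u \<beta> + u (1 - u)\<close>.\<close>

definition bridge_rate :: "real \<Rightarrow> real" where
  "bridge_rate u = (u + sqrt (u * (4 - 3 * u))) / 2"

context
  fixes u :: real
  assumes u: "0 \<le> u" "u \<le> 1"
begin

lemma bridge_rate_root: "(bridge_rate u)\<^sup>2 = u * bridge_rate u + u * (1 - u)"
proof -
  define s where "s = sqrt (u * (4 - 3 * u))"
  have "s\<^sup>2 = u * (4 - 3 * u)" unfolding s_def using u by (intro real_sqrt_pow2) auto
  thus ?thesis unfolding bridge_rate_def s_def[symmetric] by (simp add: power2_eq_square field_simps)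
qed

lemma bridge_rate_nonneg: "0 \<le> bridge_rate u"
  unfolding bridge_rate_def using u by (auto intro!: add_nonneg_nonneg mult_nonneg_nonneg)

lemma bridge_rate_le_1: "bridge_rate u \<le> 1"
proof -
  have "u * (4 - 3 * u) \<le> (2 - u)\<^sup>2"
    using zero_le_power2[of "1 - u"] by (simp add: power2_eq_square algebra_simps)
  hence "sqrt (u * (4 - 3 * u)) \<le> 2 - u" using u by (intro real_le_lsqrt) auto
  thus ?thesis unfolding bridge_rate_def by simp
qed

lemma bridge_rate_ge: "u \<le> bridge_rate u"
proof -
  have "u\<^sup>2 \<le> u * (4 - 3 * u)" using u by (simp add: power2_eq_square mult_left_mono)
  hence "u \<le> sqrt (u * (4 - 3 * u))" by (rule real_le_rsqrt)
  thus ?thesis unfolding bridge_rate_def by simp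
qed

text \<open>The powers of \<open>bridge_rate u\<close> satisfy the recursion of
  \<open>bridge_prob\<close>. The factor \<open>u\<close> makes the inequality true at
  \<open>h = 0\<close> and \<open>h = 1\<close>, as the rate is at most 1.\<close>

lemma bridge_prob_ge: "bridge_prob u h \<ge> u * bridge_rate u ^ h"
proof (induction h rule: less_induct)
  case (less h)
  consider "h = 0" | "h = 1" | h' where "h = Suc (Suc h')" by (metis One_nat_def not0_implies_Suc)
  thus ?case
  proof cases
    case 3
    have "u * bridge_rate u ^ h = u * bridge_rate u ^ h' * (bridge_rate u)\<^sup>2"
      by (simp add: 3 power2_eq_square)
    also have "\<dots> = u * (u * bridge_rate u ^ Suc h') + (1 - u) * u * (u * bridge_rate u ^ h')"
      unfolding bridge_rate_root by (simp add: algebra_simps)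
    also have "\<dots> \<le> u * bridge_prob u (Suc h') + (1 - u) * u * bridge_prob u h'"
      using less[of "Suc h'"] less[of h'] 3 u by (intro add_mono mult_left_mono) auto
    finally show ?thesis by (simp add: 3)
  qed (use u bridge_rate_le_1 in \<open>auto intro: mult_left_le\<close>)
qed

end

text \<open>One factor \<open>1 - (1 - p) ^ k\<close> per direction is lost for each block, whatever
  its length \<open>h\<close>. The number of blocks must therefore stay bounded as \<open>p\<close>
  tends to 0.\<close>

lemma span_prob_grow_blocks:
  assumes p: "0 \<le> p" "p \<le> 1" and k: "k \<ge> 1"
  shows "span_prob p (k + h) \<ge> span_prob p k * ((1 - (1 - p) ^ k) * bridge_rate (1 - (1 - p) ^ k) ^ h)\<^sup>2"
proof -
  let ?u = "1 - (1 - p) ^ k"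
  have u: "0 \<le> ?u" "?u \<le> 1" using p by (auto simp: power_le_one)
  have "(?u * bridge_rate ?u ^ h)\<^sup>2 \<le> (bridge_prob ?u h)\<^sup>2"
    using bridge_prob_ge[OF u] u bridge_rate_nonneg[OF u] by (intro power_mono) auto
  hence "span_prob p k * (?u * bridge_rate ?u ^ h)\<^sup>2 \<le> span_prob p k * (bridge_prob ?u h)\<^sup>2"
    by (intro mult_left_mono span_prob_nonneg)
  thus ?thesis using span_prob_grow[OF assms, of h] by linarith
qed

lemma span_prob_grow_unit:
  assumes p: "0 \<le> p" "p \<le> 1" and k: "k \<ge> 1"
  shows "span_prob p (Suc k) \<ge> span_prob p k * (1 - (1 - p) ^ k)\<^sup>2"
  using span_prob_grow[OF assms, of 1] by simp

text \<open>A square contained in \<open>A\<close> is full from the start. This crude bound is meant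
  for \<open>p\<close> near 1.\<close>

lemma span_prob_compl_le:
  assumes "0 \<le> p" "p \<le> 1"
  shows "1 - span_prob p L \<le> real (L\<^sup>2) * (1 - p)"
proof -
  have "1 - span_prob p L = pr (sq L) p (\<lambda>A. \<not> spanned L A)" unfolding span_prob_def by (rule pr_not[symmetric])
  also have "\<dots> \<le> (\<Sum>c\<in>sq L. pr (sq L) p (\<lambda>A. A \<inter> {c} = {}))"
  proof (rule pr_union)
    fix A assume "A \<subseteq> sq L" "\<not> spanned L A"
    moreover have "A \<inter> sq L \<subseteq> spread (sq L) (A \<inter> sq L) (2 * L\<^sup>2)"
      using spread_mono_time[of 0 "2 * L\<^sup>2" "sq L" "A \<inter> sq L"] by simp
    ultimately show "\<exists>i\<in>sq L. A \<inter> {i} = {}" unfolding spanned_def by blast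
  qed auto
  also have "\<dots> = (\<Sum>c\<in>sq L. 1 - p)"
    using assms by (intro sum.cong refl, subst pr_empty) auto
  finally show ?thesis by (simp add: card_sq)
qed

section \<open>The constant \<open>\<pi>\<^sup>2 / 18\<close>\<close>

text \<open>The dilogarithm at \<open>exp (- z)\<close>. Its negative is a primitive of
  \<open>- ln (1 - exp (- z))\<close>, the cost of a line when lines are added one at a
  time.\<close>

definition dilog_exp :: "real \<Rightarrow> real" where
  "dilog_exp z = (\<Sum>n. 1 / (real n + 1)\<^sup>2 * exp (- z) ^ Suc n)"

lemma summable_inverse_squares: "summable (\<lambda>n. 1 / (real n + 1)\<^sup>2)"
  using inverse_squares_sums by (auto simp: sums_iff add_ac)

lemma suminf_inverse_squares: "(\<Sum>n. 1 / (real n + 1)\<^sup>2) = pi\<^sup>2 / 6"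
  using inverse_squares_sums by (auto simp: sums_iff add_ac)

lemma dilog_exp_term_le:
  assumes "0 \<le> z"
  shows "1 / (real n + 1)\<^sup>2 * exp (- z) ^ Suc n \<le> 1 / (real n + 1)\<^sup>2 * exp (- z)"
proof -
  have "exp (- z) ^ Suc n \<le> exp (- z)"
    using assms power_decreasing[of 1 "Suc n" "exp (- z)"] by simp
  thus ?thesis by (intro mult_left_mono) auto
qed

lemma summable_dilog_exp:
  assumes "0 \<le> z"
  shows "summable (\<lambda>n. 1 / (real n + 1)\<^sup>2 * exp (- z) ^ Suc n)"
  by (rule summable_comparison_test'[OF summable_mult2[OF summable_inverse_squares, of "exp (- z)"]])
     (use dilog_exp_term_le[OF assms] in auto)

lemma dilog_exp_0: "dilog_exp 0 = pi\<^sup>2 / 6"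
  using suminf_inverse_squares by (simp add: dilog_exp_def)

lemma dilog_exp_nonneg: "0 \<le> z \<Longrightarrow> 0 \<le> dilog_exp z"
  unfolding dilog_exp_def by (intro suminf_nonneg summable_dilog_exp) auto

lemma dilog_exp_antimono:
  assumes "0 \<le> z" "z \<le> z'"
  shows "dilog_exp z' \<le> dilog_exp z"
  unfolding dilog_exp_def
  using assms by (intro suminf_le summable_dilog_exp mult_left_mono power_mono) auto

lemma dilog_exp_le: "0 \<le> z \<Longrightarrow> dilog_exp z \<le> pi\<^sup>2 / 6 * exp (- z)"
proof -
  assume z: "0 \<le> z"
  have "dilog_exp z \<le> (\<Sum>n. 1 / (real n + 1)\<^sup>2 * exp (- z))"
    unfolding dilog_exp_def
    by (intro suminf_le dilog_exp_term_le summable_dilog_exp summable_mult2 summable_inverse_squares z)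
  also have "\<dots> = pi\<^sup>2 / 6 * exp (- z)"
    using suminf_mult2[OF summable_inverse_squares, of "exp (- z)"] suminf_inverse_squares by simp
  finally show ?thesis .
qed

lemma continuous_on_dilog_exp: "continuous_on {0..} dilog_exp"
proof -
  have "uniform_limit {0..} (\<lambda>n z. \<Sum>i<n. 1 / (real i + 1)\<^sup>2 * exp (- z) ^ Suc i)
     (\<lambda>z. \<Sum>i. 1 / (real i + 1)\<^sup>2 * exp (- z) ^ Suc i) sequentially"
  proof (rule Weierstrass_m_test)
    show "norm (1 / (real n + 1)\<^sup>2 * exp (- z) ^ Suc n) \<le> 1 / (real n + 1)\<^sup>2" if "z \<in> {0..}" for n z
    proof -
      have "exp (- z) ^ Suc n \<le> 1" using that by (intro power_le_one) auto
      hence "1 / (real n + 1)\<^sup>2 * exp (- z) ^ Suc n \<le> 1 / (real n + 1)\<^sup>2 * 1"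
        by (intro mult_left_mono) auto
      thus ?thesis by simp
    qed
  qed (rule summable_inverse_squares)
  hence "continuous_on {0..} (\<lambda>z. \<Sum>i. 1 / (real i + 1)\<^sup>2 * exp (- z) ^ Suc i)"
    by (rule uniform_limit_theorem[rotated])
       (auto intro!: always_eventually continuous_intros)
  thus ?thesis unfolding dilog_exp_def[abs_def] .
qed

text \<open>With \<open>x = exp (- z)\<close>, termwise differentiation gives
  \<open>- ln (1 - x) / x\<close>, and the inner derivative \<open>- x\<close> cancels the
  denominator. The logarithm is recognised from its alternating series at \<open>1 - x\<close>,
  hence the sign rule \<open>alt\<close>.\<close>

lemma DERIV_dilog_exp:
  assumes z: "0 < z"
  shows "(dilog_exp has_real_derivative ln (1 - exp (- z))) (at z)"
proof -
  let ?f = "\<lambda>n. 1 / (real n + 1)\<^sup>2" and ?x = "exp (- z)"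
  have x: "0 < ?x" "?x < 1" using z by auto
  have alt: "(-1) ^ n * (- y) ^ Suc n = - (y ^ Suc n)" for n and y :: real
    by (induction n) auto
  have eq: "?f n * real (Suc n) * y ^ n = 1 / (real n + 1) * y ^ n" for n y
    by (simp add: power2_eq_square add_ac)
  have sm: "summable (\<lambda>n. ?f n * real (Suc n) * y ^ n)" if y: "y \<in> {-1<..<1}" for y :: real
  proof (rule summable_comparison_test')
    show "summable (\<lambda>n. \<bar>y\<bar> ^ n)" using y by (intro summable_geometric) auto
    show "norm (?f n * real (Suc n) * y ^ n) \<le> \<bar>y\<bar> ^ n" for n
    proof -
      have "1 / (real n + 1) * \<bar>y\<bar> ^ n \<le> 1 * \<bar>y\<bar> ^ n" by (intro mult_right_mono) auto
      thus ?thesis unfolding eq by (simp add: abs_mult power_abs)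
    qed
  qed
  have D: "DERIV (\<lambda>y. \<Sum>n. ?f n * y ^ Suc n) ?x :> (\<Sum>n. ?f n * real (Suc n) * ?x ^ n)"
  proof (rule DERIV_power_series'[where R=1])
    show "?x \<in> {-1<..<1}" using x(2) by (auto intro: less_trans[of "-1" 0])
  qed (use sm in auto)
  have "?x * (\<Sum>n. ?f n * real (Suc n) * ?x ^ n) = (\<Sum>n. ?x * (?f n * real (Suc n) * ?x ^ n))"
  proof (rule suminf_mult[symmetric], rule sm)
    show "?x \<in> {-1<..<1}" using x(2) by (auto intro: less_trans[of "-1" 0])
  qed
  also have "\<dots> = (\<Sum>n. - ((-1) ^ n * (1 / real (n + 1)) * ((1 - ?x) - 1) ^ Suc n))"
  proof (rule suminf_cong)
    fix n
    have "(-1) ^ n * (- ?x) ^ Suc n = - (?x ^ Suc n)" by (rule alt)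
    hence "- ((-1) ^ n * (1 / real (n + 1)) * (- ?x) ^ Suc n) = 1 / real (n + 1) * ?x ^ Suc n"
      by (simp add: algebra_simps)
    thus "?x * (?f n * real (Suc n) * ?x ^ n) = - ((-1) ^ n * (1 / real (n + 1)) * ((1 - ?x) - 1) ^ Suc n)"
      unfolding eq by (simp add: add_ac)
  qed
  also have "\<dots> = - (\<Sum>n. (-1) ^ n * (1 / real (n + 1)) * ((1 - ?x) - 1) ^ Suc n)"
  proof (rule suminf_minus)
    have "summable (\<lambda>n. - (?x * (?f n * real (Suc n) * ?x ^ n)))"
      by (intro summable_minus summable_mult sm) (use x(2) in \<open>auto intro: less_trans[of "-1" 0]\<close>)
    also have "(\<lambda>n. - (?x * (?f n * real (Suc n) * ?x ^ n))) = (\<lambda>n. (-1) ^ n * (1 / real (n + 1)) * ((1 - ?x) - 1) ^ Suc n)"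
    proof
      fix n
      have "(-1) ^ n * (- ?x) ^ Suc n = - (?x ^ Suc n)" by (rule alt)
      hence "((-1) ^ n * (1 / real (n + 1)) * (- ?x) ^ Suc n) = - (1 / real (n + 1) * ?x ^ Suc n)"
        by (simp add: algebra_simps)
      thus "- (?x * (?f n * real (Suc n) * ?x ^ n)) = (-1) ^ n * (1 / real (n + 1)) * ((1 - ?x) - 1) ^ Suc n"
        unfolding eq by (simp add: add_ac)
    qed
    finally show "summable (\<lambda>n. (-1) ^ n * (1 / real (n + 1)) * ((1 - ?x) - 1) ^ Suc n)" .
  qed
  also have "\<dots> = - ln (1 - ?x)" using ln_series[of "1 - ?x"] x by simp
  finally have val: "?x * (\<Sum>n. ?f n * real (Suc n) * ?x ^ n) = - ln (1 - ?x)" .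
  have E: "DERIV (\<lambda>z. exp (- z)) z :> - ?x"
    by (auto intro!: derivative_eq_intros)
  have "DERIV (\<lambda>z. \<Sum>n. ?f n * exp (- z) ^ Suc n) z :> (\<Sum>n. ?f n * real (Suc n) * ?x ^ n) * (- ?x)"
    by (rule DERIV_chain2[OF D E])
  moreover have "(\<Sum>n. ?f n * real (Suc n) * ?x ^ n) * (- ?x) = ln (1 - ?x)" using val by (simp add: mult.commute)
  ultimately show ?thesis unfolding dilog_exp_def[abs_def] by simp
qed

text \<open>Integral comparison in mean value form: the integrand decreases, so its value at the
  right end is the smallest.\<close>

lemma dilog_exp_diff:
  assumes "0 \<le> a" "a < b"
  shows "(b - a) * (- ln (1 - exp (- b))) \<le> dilog_exp a - dilog_exp b"
proof -
  have "\<exists>l z. a < z \<and> z < b \<and> DERIV dilog_exp z :> l \<and> dilog_exp b - dilog_exp a = (b - a) * l"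
  proof (rule MVT[OF assms(2)])
    show "continuous_on {a..b} dilog_exp"
      by (rule continuous_on_subset[OF continuous_on_dilog_exp]) (use assms in auto)
    show "dilog_exp differentiable at x" if "a < x" "x < b" for x
      using DERIV_dilog_exp[of x] that assms by (auto simp: real_differentiable_def)
  qed
  then obtain l z where z: "a < z" "z < b" "DERIV dilog_exp z :> l" "dilog_exp b - dilog_exp a = (b - a) * l"
    by blast
  have "l = ln (1 - exp (- z))" using DERIV_unique[OF z(3) DERIV_dilog_exp] z assms by auto
  moreover have "ln (1 - exp (- z)) \<le> ln (1 - exp (- b))" using z assms by (subst ln_le_cancel_iff) auto
  ultimately have "(b - a) * l \<le> (b - a) * ln (1 - exp (- b))" using assms by (intro mult_left_mono) auto
  thus ?thesis using z(4) by simp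
qed

text \<open>Cost per line for a square of side \<open>z / p\<close>: a line of this length is vacant
  with probability about \<open>exp (- z)\<close>.\<close>

definition growth_cost :: "real \<Rightarrow> real" where
  "growth_cost z = - ln (bridge_rate (1 - exp (- z)))"

text \<open>Subtracting the two quadratic equations and factoring gives
  \<open>(b - c) * (b + c - u) = (v - u) * (u + v - 1 - c)\<close>. If \<open>c < b\<close>, the
  left side is positive and the right side is not.\<close>

lemma bridge_rate_mono:
  assumes "0 \<le> u" "u \<le> v" "v \<le> 1"
  shows "bridge_rate u \<le> bridge_rate v"
proof (rule ccontr)
  assume n: "\<not> ?thesis"
  define b c where "b = bridge_rate u" and "c = bridge_rate v"
  have bc: "c < b" using n by (simp add: b_def c_def)
  have b1: "b \<le> 1" "b \<ge> 0" "c \<ge> v" "b \<ge> u"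
    using bridge_rate_le_1[of u] bridge_rate_nonneg[of u] bridge_rate_ge[of v] bridge_rate_ge[of u] assms by (auto simp: b_def c_def)
  have B: "b\<^sup>2 = u * b + u * (1 - u)" and C: "c\<^sup>2 = v * c + v * (1 - v)"
    using bridge_rate_root[of u] bridge_rate_root[of v] assms by (auto simp: b_def c_def)
  have "(b - c) * (b + c - u) = (v - u) * (u + v - 1 - c)"
    using B C by (simp add: power2_eq_square algebra_simps)
  moreover have "(b - c) * (b + c - u) > 0" 
    using bc b1 assms by (intro mult_pos_pos) auto
  moreover have "(v - u) * (u + v - 1 - c) \<le> 0"
    using b1 assms by (intro mult_nonneg_nonpos) auto
  ultimately show False by linarith
qed

lemma bridge_rate_pos: "0 < u \<Longrightarrow> u \<le> 1 \<Longrightarrow> 0 < bridge_rate u"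
  using bridge_rate_ge[of u] by linarith

text \<open>The quadratic equation of \<open>bridge_rate (1 - x)\<close> is the cofactor of
  \<open>f - x\<close> in this cubic relation. The relation is symmetric in \<open>f\<close> and
  \<open>x\<close>, which is the source of the involution property of
  \<open>growth_cost\<close>.\<close>

lemma bridge_rate_cubic:
  assumes "0 \<le> x" "x \<le> 1"
  defines "f \<equiv> bridge_rate (1 - x)"
  shows "f\<^sup>2 - f^3 = x\<^sup>2 - x^3"
proof -
  have r: "f\<^sup>2 - f + x * f - x + x\<^sup>2 = 0"
    using bridge_rate_root[of "1 - x"] assms by (simp add: algebra_simps power2_eq_square)
  have "f^3 - x^3 - f\<^sup>2 + x\<^sup>2 = (f - x) * (f\<^sup>2 - f + x * f - x + x\<^sup>2)"
    by (simp add: power2_eq_square power3_eq_cube algebra_simps)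
  thus ?thesis using r by simp
qed

lemma growth_cost_nonneg: "0 < z \<Longrightarrow> 0 \<le> growth_cost z"
  using bridge_rate_le_1[of "1 - exp (- z)"] bridge_rate_pos[of "1 - exp (- z)"]
  by (simp add: growth_cost_def)

lemma exp_growth_cost: "0 < z \<Longrightarrow> exp (- growth_cost z) = bridge_rate (1 - exp (- z))"
  using bridge_rate_pos[of "1 - exp (- z)"] by (simp add: growth_cost_def)

lemma growth_cost_antimono:
  assumes "0 < z" "z \<le> z'"
  shows "growth_cost z' \<le> growth_cost z"
proof -
  have "bridge_rate (1 - exp (- z)) \<le> bridge_rate (1 - exp (- z'))"
    using assms by (intro bridge_rate_mono) auto
  thus ?thesis using bridge_rate_pos[of "1 - exp (- z)"] assms by (simp add: growth_cost_def)
qed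

lemma growth_cost_le: "0 < z \<Longrightarrow> growth_cost z \<le> - ln (1 - exp (- z))"
  using bridge_rate_ge[of "1 - exp (- z)"] bridge_rate_pos[of "1 - exp (- z)"]
  by (simp add: growth_cost_def ln_le_cancel_iff)

lemma growth_cost_differentiable:
  assumes "0 < z"
  shows "\<exists>D. (growth_cost has_real_derivative D) (at z)"
proof -
  have e: "0 < exp (- z)" "exp (- z) < 1" using assms by auto
  have "0 < 4 - 3 * (1 - exp (- z))" by (simp add: add_pos_pos)
  moreover have "0 < 1 - exp (- z)" using e by simp
  ultimately have p: "0 < (1 - exp (- z)) * (4 - 3 * (1 - exp (- z)))" by (intro mult_pos_pos)
  have 1: "((\<lambda>z. 1 - exp (- z)) has_real_derivative exp (- z)) (at z)"
    by (auto intro!: derivative_eq_intros)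
  let ?D = "exp (- z) * (4 - 3 * (1 - exp (- z))) + (1 - exp (- z)) * (- (3 * exp (- z)))"
  have 2: "((\<lambda>z. (1 - exp (- z)) * (4 - 3 * (1 - exp (- z)))) has_real_derivative ?D) (at z)"
    by (auto intro!: derivative_eq_intros)
  have 3: "((\<lambda>z. bridge_rate (1 - exp (- z))) has_real_derivative
      (exp (- z) + inverse (sqrt ((1 - exp (- z)) * (4 - 3 * (1 - exp (- z))))) / 2 * ?D) / 2) (at z)"
    unfolding bridge_rate_def
    by (rule DERIV_cdivide[OF DERIV_add[OF 1 DERIV_chain2[OF DERIV_real_sqrt[OF p] 2]]])
  have "0 < bridge_rate (1 - exp (- z))" using e by (intro bridge_rate_pos) auto
  from DERIV_minus[OF DERIV_chain2[OF DERIV_ln[OF this] 3]]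
  show ?thesis unfolding growth_cost_def[abs_def] by (rule exI)
qed

text \<open>For positive \<open>t\<close> the maximum of \<open>t\<^sup>2 - t^3\<close> is at
  \<open>2 / 3\<close>; there the two solutions \<open>f\<close> and \<open>x\<close> of the cubic
  relation coincide.\<close>

lemma growth_cost_fixpoint: "growth_cost (ln (3 / 2)) = ln (3 / 2)"
proof -
  have 1: "1 - exp (- ln (3/2::real)) = 1/3" by (simp add: exp_minus)
  have 2: "bridge_rate (1/3) = 2/3" by (simp add: bridge_rate_def)
  have "growth_cost (ln (3/2)) = - ln (2/3)" unfolding growth_cost_def 1 2 ..
  also have "\<dots> = ln (3/2)" by (simp add: ln_div)
  finally show ?thesis .
qed

lemma growth_cost_compare:
  assumes "0 < z"
  shows "ln (3/2) < z \<Longrightarrow> growth_cost z < z" and "z < ln (3/2) \<Longrightarrow> z < growth_cost z"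
  using growth_cost_antimono[of "ln (3/2)" z] growth_cost_antimono[of z "ln (3/2)"] assms growth_cost_fixpoint by auto

text \<open>For \<open>x = exp (- z)\<close> and \<open>f = exp (- growth_cost z)\<close> the relation
  \<open>f\<^sup>2 - f\<^sup>3 = x\<^sup>2 - x\<^sup>3\<close> expresses \<open>f\<close> and \<open>x\<close> rationally in terms of \<open>x / f\<close>.\<close>

lemma cubic_ratio:
  fixes x f :: real
  assumes "0 < x" "x < f" "f\<^sup>2 - f^3 = x\<^sup>2 - x^3"
  shows "ln (1 - (x / f)^3) - ln (1 - (x / f)\<^sup>2) = - ln f"
proof -
  have r: "0 < x / f" "x / f < 1" using assms by auto
  have p2: "(x / f)\<^sup>2 < 1" "(x / f)^3 < 1" using r by (auto simp: power_less_one_iff)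
  have "f\<^sup>2 * (f * (1 - (x / f)^3)) = f^3 - x^3" "f\<^sup>2 * (1 - (x / f)\<^sup>2) = f\<^sup>2 - x\<^sup>2"
    using assms by (simp_all add: field_simps power2_eq_square power3_eq_cube)
  hence "f\<^sup>2 * (f * (1 - (x / f)^3)) = f\<^sup>2 * (1 - (x / f)\<^sup>2)" using assms(3) by linarith
  hence "f * (1 - (x / f)^3) = 1 - (x / f)\<^sup>2" using assms by simp
  hence "ln (1 - (x / f)\<^sup>2) = ln f + ln (1 - (x / f)^3)"
    using assms p2 by (metis diff_gt_0_iff_gt ln_mult_pos order.strict_trans)
  thus ?thesis by simp
qed

text \<open>A primitive of \<^const>\<open>growth_cost\<close>, of total increment \<open>\<pi>\<^sup>2 / 18\<close>, written with \<^const>\<open>dilog_exp\<close>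
  of the multiples of \<open>\<bar>z - growth_cost z\<bar>\<close>. Since \<^const>\<open>growth_cost\<close> is an involution,
  the two branches are exchanged by reflection at its fixed point \<open>ln (3 / 2)\<close>.\<close>

definition cost_primitive :: "real \<Rightarrow> real" where
  "cost_primitive z = (if z \<le> ln (3/2)
     then z * growth_cost z - z\<^sup>2 / 2
       - dilog_exp (3 * (growth_cost z - z)) / 3 + dilog_exp (2 * (growth_cost z - z)) / 2
     else pi\<^sup>2 / 18 + (growth_cost z)\<^sup>2 / 2
       + dilog_exp (3 * (z - growth_cost z)) / 3 - dilog_exp (2 * (z - growth_cost z)) / 2)"

text \<open>The constant \<open>pi\<^sup>2 / 18\<close> of the second branch is chosen so that the
  branches agree here: both equal \<open>(ln (3/2))\<^sup>2 / 2 + pi\<^sup>2 / 36\<close>.\<close>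

lemma cost_primitive_at: "cost_primitive (ln (3/2)) = pi\<^sup>2 / 18 + (growth_cost (ln (3/2)))\<^sup>2 / 2
       + dilog_exp (3 * (ln (3/2) - growth_cost (ln (3/2)))) / 3 - dilog_exp (2 * (ln (3/2) - growth_cost (ln (3/2)))) / 2"
  by (simp add: cost_primitive_def growth_cost_fixpoint dilog_exp_0 power2_eq_square)

lemma MVT_growth_cost:
  fixes F :: "real \<Rightarrow> real"
  assumes "0 < a" "a < b" "continuous_on {a..b} F"
    "\<And>z. a < z \<Longrightarrow> z < b \<Longrightarrow> (F has_real_derivative growth_cost z) (at z)"
  shows "(b - a) * growth_cost b \<le> F b - F a"
proof -
  have "\<exists>l z. a < z \<and> z < b \<and> DERIV F z :> l \<and> F b - F a = (b - a) * l"
    by (rule MVT[OF assms(2,3)]) (use assms(4) in \<open>auto simp: real_differentiable_def\<close>)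
  then obtain l z where z: "a < z" "z < b" "DERIV F z :> l" "F b - F a = (b - a) * l" by blast
  have "l = growth_cost z" using DERIV_unique[OF z(3) assms(4)] z by auto
  moreover have "growth_cost b \<le> growth_cost z" using z assms by (intro growth_cost_antimono) auto
  ultimately have "(b - a) * growth_cost b \<le> (b - a) * l" using assms by (intro mult_left_mono) auto
  thus ?thesis using z by simp
qed

lemma continuous_on_growth_cost:
  assumes "0 < a"
  shows "continuous_on {a..b} growth_cost"
proof (intro continuous_at_imp_continuous_on ballI)
  fix z assume "z \<in> {a..b}"
  hence "0 < z" using assms by simp
  then obtain D where "(growth_cost has_real_derivative D) (at z)" using growth_cost_differentiable by blast
  thus "isCont growth_cost z" by (rule DERIV_isCont)
qed

lemma cost_primitive_left:
  assumes "0 < a" "a < b" "b \<le> ln (3/2)"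
  shows "(b - a) * growth_cost b \<le> cost_primitive b - cost_primitive a"
proof -
  let ?F = "\<lambda>z. z * growth_cost z - z\<^sup>2 / 2
       - dilog_exp (3 * (growth_cost z - z)) / 3 + dilog_exp (2 * (growth_cost z - z)) / 2"
  have ge: "growth_cost z \<ge> z" if "0 < z" "z \<le> ln (3/2)" for z
    using growth_cost_compare(2)[of z] that growth_cost_fixpoint by (cases "z = ln (3/2)") auto
  have cont: "continuous_on {a..b} ?F"
    using assms ge
    by (intro continuous_intros continuous_on_growth_cost
         continuous_on_compose2[OF continuous_on_dilog_exp]) auto
  have deriv: "(?F has_real_derivative growth_cost z) (at z)" if z: "a < z" "z < b" for z
  proof -
    have z0: "0 < z" "z < ln (3/2)" using z assms by auto
    define e where "e = growth_cost z - z"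
    have e: "0 < e" using growth_cost_compare(2) z0 by (simp add: e_def)
    obtain g' where g': "(growth_cost has_real_derivative g') (at z)" using growth_cost_differentiable z0 by blast
    define f x where "f = exp (- growth_cost z)" and "x = exp (- z)"
    have fx: "0 < f" "f < x" using e by (auto simp: f_def x_def e_def)
    have "f\<^sup>2 - f^3 = x\<^sup>2 - x^3"
      using bridge_rate_cubic[of x] z0 exp_growth_cost[of z] by (simp add: f_def x_def)
    \<comment> \<open>Here \<open>f < x\<close>, so \<open>cubic_ratio\<close> is applied with
      exchanged roles. The resulting identity makes the unknown derivative \<open>g'\<close> cancel,
      leaving \<open>growth_cost z\<close>.\<close>
    hence "ln (1 - (f / x)^3) - ln (1 - (f / x)\<^sup>2) = - ln x" using fx by (intro cubic_ratio) auto
    moreover have "f / x = exp (- e)" by (simp add: f_def x_def e_def exp_diff[symmetric])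
    ultimately have id: "ln (1 - exp (- (3 * e))) - ln (1 - exp (- (2 * e))) = z"
      by (simp add: x_def exp_of_nat_mult[symmetric])
    have D: "((\<lambda>z. dilog_exp (c * (growth_cost z - z)) / c) has_real_derivative ln (1 - exp (- (c * e))) * (g' - 1)) (at z)"
      if "c > 0" for c
    proof -
      have "((\<lambda>z. dilog_exp (c * (growth_cost z - z))) has_real_derivative ln (1 - exp (- (c * e))) * (c * (g' - 1))) (at z)"
        unfolding e_def
        by (rule DERIV_chain2[OF DERIV_dilog_exp]) 
           (use that e in \<open>auto simp: e_def intro!: derivative_eq_intros g'\<close>)
      from DERIV_cdivide[OF this, of c] that show ?thesis by simp
    qed
    have "((\<lambda>z. z * growth_cost z - z\<^sup>2 / 2) has_real_derivative growth_cost z + z * g' - z) (at z)"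
      by (auto intro!: derivative_eq_intros g')
    from DERIV_add[OF DERIV_diff[OF this D[of 3]] D[of 2]]
    have "(?F has_real_derivative (growth_cost z + z * g' - z 
        - ln (1 - exp (- (3 * e))) * (g' - 1) + ln (1 - exp (- (2 * e))) * (g' - 1))) (at z)"
      by simp
    also have "growth_cost z + z * g' - z 
        - ln (1 - exp (- (3 * e))) * (g' - 1) + ln (1 - exp (- (2 * e))) * (g' - 1)
      = growth_cost z + z * g' - z - (g' - 1) * (ln (1 - exp (- (3 * e))) - ln (1 - exp (- (2 * e))))"
      by (simp add: algebra_simps)
    also have "\<dots> = growth_cost z" unfolding id by (simp add: algebra_simps)
    finally show ?thesis .
  qed
  have "(b - a) * growth_cost b \<le> ?F b - ?F a"
    by (rule MVT_growth_cost[OF assms(1,2) cont deriv])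
  thus ?thesis using assms by (simp add: cost_primitive_def)
qed

lemma cost_primitive_right:
  assumes "ln (3/2) \<le> a" "a < b"
  shows "(b - a) * growth_cost b \<le> cost_primitive b - cost_primitive a"
proof -
  let ?F = "\<lambda>z. pi\<^sup>2 / 18 + (growth_cost z)\<^sup>2 / 2
       + dilog_exp (3 * (z - growth_cost z)) / 3 - dilog_exp (2 * (z - growth_cost z)) / 2"
  have l0: "0 < ln (3/2::real)" by simp
  have a0: "0 < a" using assms l0 by linarith
  have le: "growth_cost z \<le> z" if "z \<ge> ln (3/2)" for z
    using growth_cost_compare(1)[of z] that growth_cost_fixpoint l0 by (cases "z = ln (3/2)") auto
  have cont: "continuous_on {a..b} ?F"
    using assms le a0
    by (intro continuous_intros continuous_on_growth_cost
         continuous_on_compose2[OF continuous_on_dilog_exp]) auto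
  have deriv: "(?F has_real_derivative growth_cost z) (at z)" if z: "a < z" "z < b" for z
  proof -
    have z0: "0 < z" "ln (3/2) < z" using z assms a0 by auto
    define d where "d = z - growth_cost z"
    have d: "0 < d" using growth_cost_compare(1) z0 by (simp add: d_def)
    obtain g' where g': "(growth_cost has_real_derivative g') (at z)" using growth_cost_differentiable z0 by blast
    define f x where "f = exp (- growth_cost z)" and "x = exp (- z)"
    have fx: "0 < x" "x < f" using d by (auto simp: f_def x_def d_def)
    have "f\<^sup>2 - f^3 = x\<^sup>2 - x^3"
      using bridge_rate_cubic[of x] z0 exp_growth_cost[of z] by (simp add: f_def x_def)
    hence "ln (1 - (x / f)^3) - ln (1 - (x / f)\<^sup>2) = - ln f" using fx by (intro cubic_ratio) auto
    moreover have "x / f = exp (- d)" by (simp add: f_def x_def d_def exp_diff[symmetric])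
    ultimately have id: "ln (1 - exp (- (3 * d))) - ln (1 - exp (- (2 * d))) = growth_cost z"
      by (simp add: f_def exp_of_nat_mult[symmetric])
    have D: "((\<lambda>z. dilog_exp (c * (z - growth_cost z)) / c) has_real_derivative ln (1 - exp (- (c * d))) * (1 - g')) (at z)"
      if "c > 0" for c
    proof -
      have "((\<lambda>z. dilog_exp (c * (z - growth_cost z))) has_real_derivative ln (1 - exp (- (c * d))) * (c * (1 - g'))) (at z)"
        unfolding d_def
        by (rule DERIV_chain2[OF DERIV_dilog_exp]) 
           (use that d in \<open>auto simp: d_def intro!: derivative_eq_intros g'\<close>)
      from DERIV_cdivide[OF this, of c] that show ?thesis by simp
    qed
    have "((\<lambda>z. pi\<^sup>2 / 18 + (growth_cost z)\<^sup>2 / 2) has_real_derivative growth_cost z * g') (at z)"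
      by (auto intro!: derivative_eq_intros g')
    from DERIV_diff[OF DERIV_add[OF this D[of 3]] D[of 2]]
    have "(?F has_real_derivative (growth_cost z * g'
        + ln (1 - exp (- (3 * d))) * (1 - g') - ln (1 - exp (- (2 * d))) * (1 - g'))) (at z)"
      by simp
    also have "growth_cost z * g'
        + ln (1 - exp (- (3 * d))) * (1 - g') - ln (1 - exp (- (2 * d))) * (1 - g')
      = growth_cost z * g' + (1 - g') * (ln (1 - exp (- (3 * d))) - ln (1 - exp (- (2 * d))))"
      by (simp add: algebra_simps)
    also have "\<dots> = growth_cost z" unfolding id by (simp add: algebra_simps)
    finally show ?thesis .
  qed
  have "(b - a) * growth_cost b \<le> ?F b - ?F a"
    by (rule MVT_growth_cost[OF a0 assms(2) cont deriv])
  \<comment> \<open>The definition takes the first branch at \<open>ln (3/2)\<close> itself;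
    \<open>cost_primitive_at\<close> covers this point.\<close>
  moreover have "cost_primitive z = ?F z" if "z \<ge> ln (3/2)" for z
    using that cost_primitive_at by (cases "z = ln (3/2)") (auto simp: cost_primitive_def)
  ultimately show ?thesis using assms by simp
qed

lemma cost_primitive_diff:
  assumes "0 < a" "a < b"
  shows "(b - a) * growth_cost b \<le> cost_primitive b - cost_primitive a"
proof -
  let ?c = "ln (3/2::real)"
  consider "b \<le> ?c" | "?c \<le> a" | "a < ?c" "?c < b" by linarith
  thus ?thesis
  proof cases
    case 3
    have "(?c - a) * growth_cost b \<le> (?c - a) * growth_cost ?c"
      using 3 by (intro mult_left_mono growth_cost_antimono) auto
    moreover have "(b - a) * growth_cost b = (?c - a) * growth_cost b + (b - ?c) * growth_cost b"
      by (simp add: algebra_simps)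
    ultimately show ?thesis
      using cost_primitive_left[of a ?c] cost_primitive_right[of ?c b] 3 assms by linarith
  qed (use cost_primitive_left cost_primitive_right assms in auto)
qed

text \<open>All that is needed at the lower end. With \<open>cost_primitive_le\<close> at the upper
  end, the total cost is at most \<open>pi\<^sup>2 / 18\<close> plus half the square of a small
  \<open>growth_cost\<close>.\<close>

lemma cost_primitive_nonneg:
  assumes "0 < z" "z \<le> ln (3/2)"
  shows "0 \<le> cost_primitive z"
proof -
  have g: "z \<le> growth_cost z"
    using growth_cost_compare(2)[of z] assms growth_cost_fixpoint by (cases "z = ln (3/2)") auto
  have "z * z \<le> z * growth_cost z" using g assms by (intro mult_left_mono) auto
  moreover have "dilog_exp (3 * (growth_cost z - z)) \<le> dilog_exp (2 * (growth_cost z - z))"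
    using g by (intro dilog_exp_antimono) auto
  moreover have "0 \<le> dilog_exp (2 * (growth_cost z - z))" using g by (intro dilog_exp_nonneg) auto
  moreover have "0 \<le> z * z" by simp
  moreover have "cost_primitive z = z * growth_cost z - z * z / 2
       - dilog_exp (3 * (growth_cost z - z)) / 3 + dilog_exp (2 * (growth_cost z - z)) / 2"
    using assms by (simp add: cost_primitive_def power2_eq_square)
  ultimately show ?thesis by linarith
qed

lemma cost_primitive_le:
  assumes "ln (3/2) < z"
  shows "cost_primitive z \<le> pi\<^sup>2 / 18 + (growth_cost z)\<^sup>2 / 2"
proof -
  have "0 < ln (3/2::real)" by simp
  hence g: "growth_cost z \<le> z" using growth_cost_compare(1)[of z] assms by linarith
  have "dilog_exp (3 * (z - growth_cost z)) \<le> dilog_exp (2 * (z - growth_cost z))"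
    using g by (intro dilog_exp_antimono) auto
  moreover have "0 \<le> dilog_exp (2 * (z - growth_cost z))" using g by (intro dilog_exp_nonneg) auto
  ultimately show ?thesis using assms by (simp add: cost_primitive_def)
qed


section \<open>Lower bound for the nucleation probability\<close>

lemma one_minus_power_ge:
  assumes "0 \<le> p" "p < 1"
  shows "1 - (1 - p) ^ k \<ge> 1 - exp (- (p * real k))"
proof -
  have "(1 - p) ^ k \<le> exp (- p) ^ k"
    using assms exp_ge_add_one_self[of "- p"] by (intro power_mono) auto
  thus ?thesis by (simp add: exp_of_nat_mult[symmetric] mult.commute)
qed

text \<open>One row and one column at a time: nothing is lost per block, but the cost is the larger
  \<open>- ln (1 - exp (- z))\<close>. This is harmless for very small and very large squares, where
  the dilogarithm hardly varies.\<close>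

lemma span_prob_unit_phase:
  assumes p: "0 < p" "p < 1" and k: "1 \<le> k" "k \<le> L"
  shows "span_prob p L \<ge> span_prob p k *
    exp (- (2 / p) * (dilog_exp (p * (real k - 1)) - dilog_exp (p * (real L - 1))))"
  using k(2)
proof (induction L rule: dec_induct)
  case base
  show ?case by simp
next
  case (step n)
  have n: "n \<ge> 1" using step k by simp
  let ?D = "\<lambda>i. dilog_exp (p * (real i - 1))"
  have "(p * real n - p * (real n - 1)) * (- ln (1 - exp (- (p * real n)))) \<le> ?D n - dilog_exp (p * real n)"
    by (rule dilog_exp_diff) (use p n in \<open>auto intro!: mult_strict_left_mono\<close>)
  hence "p * (- ln (1 - exp (- (p * real n)))) \<le> ?D n - ?D (Suc n)" by (simp add: algebra_simps)
  hence "- ((?D n - ?D (Suc n)) / p) \<le> ln (1 - exp (- (p * real n)))"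
    using p by (simp add: field_simps)
  hence "exp (- ((?D n - ?D (Suc n)) / p)) \<le> exp (ln (1 - exp (- (p * real n))))" by simp
  also have "\<dots> = 1 - exp (- (p * real n))" using p n by (intro exp_ln) auto
  also have "\<dots> \<le> 1 - (1 - p) ^ n" using p by (intro one_minus_power_ge) auto
  finally have "(exp (- ((?D n - ?D (Suc n)) / p)))\<^sup>2 \<le> (1 - (1 - p) ^ n)\<^sup>2" by (intro power_mono) auto
  hence u: "exp (- (2 / p) * (?D n - ?D (Suc n))) \<le> (1 - (1 - p) ^ n)\<^sup>2"
    by (simp add: exp_of_nat_mult[symmetric] field_simps)
  have "span_prob p k * exp (- (2 / p) * (?D k - ?D (Suc n)))
     = span_prob p k * exp (- (2 / p) * (?D k - ?D n)) * exp (- (2 / p) * (?D n - ?D (Suc n)))"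
    by (simp add: mult.assoc exp_add[symmetric] algebra_simps)
  also have "\<dots> \<le> span_prob p n * (1 - (1 - p) ^ n)\<^sup>2"
    by (intro mult_mono step.IH u span_prob_nonneg) auto
  also have "\<dots> \<le> span_prob p (Suc n)" using p n by (intro span_prob_grow_unit) auto
  finally show ?case .
qed

text \<open>As \<open>growth_cost\<close> decreases, the growth from \<open>i * h\<close> to
  \<open>(i + 1) * h\<close> is charged to the preceding interval, from
  \<open>p * h * (i - 1)\<close> to \<open>p * h * i\<close>. Starting at \<open>2 * h\<close> keeps
  the arguments of \<open>cost_primitive\<close> positive. The power of
  \<open>1 - exp (- (p * h))\<close> collects the losses per block.\<close>

lemma span_prob_block_phase:
  assumes p: "0 < p" "p < 1" and h: "h \<ge> 1" and I: "2 \<le> I"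
  shows "span_prob p (I * h) \<ge> span_prob p (2 * h) * (1 - exp (- (p * real h))) ^ (2 * (I - 2)) *
    exp (- (2 / p) * (cost_primitive (p * real h * (real I - 1)) - cost_primitive (p * real h)))"
  using I
proof (induction I rule: dec_induct)
  case base
  show ?case by simp
next
  case (step i)
  let ?s = "p * real h"
  let ?c = "1 - exp (- ?s)" and ?u = "1 - (1 - p) ^ (i * h)"
  let ?F = "\<lambda>i. cost_primitive (?s * (real i - 1))"
  have s: "0 < ?s" using p h by auto
  have i: "2 \<le> i" using step by simp
  have c: "0 < ?c" "?c \<le> 1" using s by auto
  have "?s * 1 \<le> ?s * real i" using s i by (intro mult_left_mono) auto
  hence si: "?s \<le> ?s * real i" by simp
  have u1: "1 - exp (- (?s * real i)) \<le> ?u"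
    using one_minus_power_ge[of p "i * h"] p by (simp add: mult_ac)
  have u2: "?u \<le> 1" using p by simp
  have cu: "?c \<le> ?u" using u1 si by (smt (verit) exp_le_cancel_iff)
  have u0: "0 \<le> ?u" using cu c by linarith
  have "(?s * real i - ?s * (real i - 1)) * growth_cost (?s * real i) \<le> cost_primitive (?s * real i) - ?F i"
  proof (rule cost_primitive_diff)
    show "0 < ?s * (real i - 1)" using s i p h by (intro mult_pos_pos) auto
    show "?s * (real i - 1) < ?s * real i" by (rule mult_strict_left_mono[OF _ s]) simp
  qed
  hence "?s * growth_cost (?s * real i) \<le> ?F (Suc i) - ?F i" by (simp add: algebra_simps)
  hence "- ((?F (Suc i) - ?F i) / p) \<le> real h * (- growth_cost (?s * real i))"
    using p by (simp add: field_simps)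
  hence "exp (- ((?F (Suc i) - ?F i) / p)) \<le> exp (real h * (- growth_cost (?s * real i)))" by simp
  also have "\<dots> = bridge_rate (1 - exp (- (?s * real i))) ^ h"
  proof -
    have "exp (- growth_cost (?s * real i)) = bridge_rate (1 - exp (- (?s * real i)))"
      using p h i by (intro exp_growth_cost mult_pos_pos) auto
    thus ?thesis by (simp only: exp_of_nat_mult)
  qed
  also have "\<dots> \<le> bridge_rate ?u ^ h"
    using u1 u2 s i by (intro power_mono bridge_rate_mono bridge_rate_nonneg) auto
  finally have "?c * exp (- ((?F (Suc i) - ?F i) / p)) \<le> ?u * bridge_rate ?u ^ h"
    using cu c u0 by (intro mult_mono) auto
  hence "(?c * exp (- ((?F (Suc i) - ?F i) / p)))\<^sup>2 \<le> (?u * bridge_rate ?u ^ h)\<^sup>2"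
    using c by (intro power_mono) auto
  moreover have "(exp (- ((?F (Suc i) - ?F i) / p)))\<^sup>2 = exp (- (2 / p) * (?F (Suc i) - ?F i))"
    by (simp add: exp_double[symmetric])
  ultimately have u: "?c\<^sup>2 * exp (- (2 / p) * (?F (Suc i) - ?F i)) \<le> (?u * bridge_rate ?u ^ h)\<^sup>2"
    by (simp only: power_mult_distrib[of ?c])
  have e: "2 * (Suc i - 2) = 2 * (i - 2) + 2" using i by simp
  have "span_prob p (2 * h) * ?c ^ (2 * (Suc i - 2)) * exp (- (2 / p) * (?F (Suc i) - cost_primitive ?s))
    = (span_prob p (2 * h) * ?c ^ (2 * (i - 2)) * exp (- (2 / p) * (?F i - cost_primitive ?s))) *
      (?c\<^sup>2 * exp (- (2 / p) * (?F (Suc i) - ?F i)))"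
  proof -
    have "exp (- (2 / p) * (?F (Suc i) - cost_primitive ?s)) = 
      exp (- (2 / p) * (?F i - cost_primitive ?s)) * exp (- (2 / p) * (?F (Suc i) - ?F i))"
      by (simp add: exp_add[symmetric] algebra_simps)
    thus ?thesis unfolding e power_add by (simp only: mult_ac)
  qed
  also have "\<dots> \<le> span_prob p (i * h) * (?u * bridge_rate ?u ^ h)\<^sup>2"
    by (intro mult_mono step.IH u span_prob_nonneg) auto
  also have "\<dots> \<le> span_prob p (i * h + h)" using p i h by (intro span_prob_grow_blocks) auto
  finally show ?case by (simp add: add.commute)
qed

text \<open>The unit phase from a single cell, of total cost \<open>2 / p\<close> times
  \<open>dilog_exp 0\<close>. The constant is weak, but the bound is uniform in \<open>L\<close> and
  suffices for \<open>p\<close> bounded away from 0.\<close>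

lemma span_prob_ge_const:
  assumes "0 < p" "p < 1" "L \<ge> 1"
  shows "span_prob p L \<ge> p * exp (- (pi\<^sup>2 / (3 * p)))"
proof -
  have d: "0 \<le> dilog_exp (p * (real L - 1))" using assms by (intro dilog_exp_nonneg) auto
  have "p * exp (- (pi\<^sup>2 / (3 * p))) = p * exp (- (2 / p) * dilog_exp 0)"
    by (simp add: dilog_exp_0 field_simps)
  also have "\<dots> \<le> p * exp (- (2 / p) * (dilog_exp 0 - dilog_exp (p * (real L - 1))))"
    using assms d by (simp add: divide_right_mono)
  also have "\<dots> \<le> span_prob p L"
    using span_prob_unit_phase[of p 1 L] span_prob_1[of p] assms by simp
  finally show ?thesis .
qed

lemma growth_cost_tendsto: "(growth_cost \<longlongrightarrow> 0) at_top"
proof (rule tendsto_sandwich)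
  show "\<forall>\<^sub>F z in at_top. 0 \<le> growth_cost z"
    using eventually_gt_at_top[of 0] by eventually_elim (rule growth_cost_nonneg)
  show "\<forall>\<^sub>F z in at_top. growth_cost z \<le> - ln (1 - exp (- z))"
    using eventually_gt_at_top[of 0] by eventually_elim (rule growth_cost_le)
  have "((\<lambda>z::real. exp (- z)) \<longlongrightarrow> 0) at_top"
    by (rule filterlim_compose[OF exp_at_bot filterlim_uminus_at_bot_at_top])
  hence "((\<lambda>z::real. - ln (1 - exp (- z))) \<longlongrightarrow> - ln (1 - 0)) at_top"
    by (intro tendsto_intros) auto
  thus "((\<lambda>z::real. - ln (1 - exp (- z))) \<longlongrightarrow> 0) at_top" by simp
qed auto

lemma dilog_exp_tendsto: "(dilog_exp \<longlongrightarrow> 0) at_top"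
proof (rule tendsto_sandwich)
  show "\<forall>\<^sub>F z in at_top. 0 \<le> dilog_exp z"
    using eventually_ge_at_top[of 0] by eventually_elim (rule dilog_exp_nonneg)
  show "\<forall>\<^sub>F z in at_top. dilog_exp z \<le> pi\<^sup>2 / 6 * exp (- z)"
    using eventually_ge_at_top[of 0] by eventually_elim (rule dilog_exp_le)
  have "((\<lambda>z::real. exp (- z)) \<longlongrightarrow> 0) at_top"
    by (rule filterlim_compose[OF exp_at_bot filterlim_uminus_at_bot_at_top])
  from tendsto_mult_left[OF this, of "pi\<^sup>2 / 6"]
  show "((\<lambda>z::real. pi\<^sup>2 / 6 * exp (- z)) \<longlongrightarrow> 0) at_top" by simp
qed auto

text \<open>Hence the probability \<open>p\<close> of the first cell is
  \<open>exp (- o(1) / p)\<close> and does not affect the exponent.\<close>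

lemma neg_mult_ln_le:
  assumes "0 < p" "p \<le> 1"
  shows "- (p * ln p) \<le> 2 * sqrt p"
proof -
  have "ln (1 / sqrt p) \<le> 1 / sqrt p - 1" using assms by (intro ln_le_minus_one) auto
  hence "- ln p \<le> 2 * (1 / sqrt p)" using assms by (simp add: ln_div ln_sqrt)
  hence "p * (- ln p) \<le> p * (2 * (1 / sqrt p))" using assms by (intro mult_left_mono) auto
  also have "\<dots> = 2 * (p / sqrt p)" by simp
  also have "p / sqrt p = sqrt p" using assms by (intro real_div_sqrt) auto
  finally show ?thesis by simp
qed

text \<open>The exponent is twice \<open>pi\<^sup>2 / 18\<close>, for columns and for rows. The five
  errors \<open>\<delta> / 5\<close> are due to the first cell, the growth to side
  \<open>2 * h\<close>, the losses per block, the block cost, and the growth from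
  \<open>I * h\<close> to \<open>L\<close>.\<close>

theorem span_prob_ge:
  assumes \<delta>: "0 < \<delta>"
  obtains p\<^sub>0 C where "0 < p\<^sub>0" "p\<^sub>0 \<le> 1 / 2"
    "\<And>p L. 0 < p \<Longrightarrow> p \<le> p\<^sub>0 \<Longrightarrow> C / p \<le> real L \<Longrightarrow> span_prob p L \<ge> exp (- (pi\<^sup>2 / 9 + \<delta>) / p)"
proof -
  let ?e = "\<delta> / 5"
  have e: "0 < ?e" using \<delta> by simp
  have "\<exists>r>0. \<forall>z\<in>{0..}. dist z 0 < r \<longrightarrow> dist (dilog_exp z) (dilog_exp 0) < ?e / 2"
    using continuous_on_dilog_exp e unfolding continuous_on_iff by (metis atLeast_iff half_gt_zero order_refl)
  then obtain r where r: "r > 0" "\<And>z. 0 \<le> z \<Longrightarrow> z < r \<Longrightarrow> \<bar>dilog_exp z - dilog_exp 0\<bar> < ?e / 2"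
    by (auto simp: dist_real_def)
  \<comment> \<open>\<open>s\<^sub>0 / p\<close> is the block length up to a factor 2. The first
    bound makes the growth to \<open>2 * h\<close> cheap, since
    \<open>p * 2 * h \<le> 4 * s\<^sub>0 < r\<close>; the second is for
    \<open>cost_primitive_nonneg\<close>.\<close>
  define s\<^sub>0 where "s\<^sub>0 = min (r / 8) (ln (3/2) / 2)"
  have s0: "0 < s\<^sub>0" "4 * s\<^sub>0 < r" "2 * s\<^sub>0 \<le> ln (3/2)" using r(1) by (auto simp: s\<^sub>0_def)
  have "\<forall>\<^sub>F z in at_top. growth_cost z < min 1 ?e"
    using order_tendstoD(2)[OF growth_cost_tendsto, of "min 1 ?e"] e by auto
  moreover have "\<forall>\<^sub>F z in at_top. dilog_exp z < ?e / 2"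
    using order_tendstoD(2)[OF dilog_exp_tendsto, of "?e / 2"] e by auto
  ultimately have "\<forall>\<^sub>F z in at_top. growth_cost z < min 1 ?e \<and> dilog_exp z < ?e / 2 \<and> ln (3/2) < z"
    using eventually_gt_at_top by (intro eventually_conj) auto
  hence "\<exists>z. growth_cost z < min 1 ?e \<and> dilog_exp z < ?e / 2 \<and> ln (3/2) < z"
    by (rule eventually_happens'[rotated]) simp
  then obtain Z where Z: "growth_cost Z < min 1 ?e" "dilog_exp Z < ?e / 2" "ln (3/2) < Z" by blast
  have "0 < ln (3/2::real)" by simp
  hence Z0: "0 < Z" using Z(3) by linarith
  have dbl: "2 * (a - b) \<le> x" if "a \<le> d" "0 \<le> b" "d \<le> x / 2" for a b d x :: real
    using that by argo
  have gZ: "(growth_cost Z)\<^sup>2 \<le> ?e"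
  proof -
    have "(growth_cost Z)\<^sup>2 \<le> growth_cost Z * 1"
      unfolding power2_eq_square using Z growth_cost_nonneg[OF Z0] by (intro mult_left_mono) auto
    thus ?thesis using Z by simp
  qed
  \<comment> \<open>The number of blocks depends on \<delta> but not on \<open>p\<close>, so the
    losses per block amount to a constant factor, absorbed for small \<open>p\<close>.\<close>
  define I where "I = nat \<lceil>Z / s\<^sub>0\<rceil> + 3"
  have "Z / s\<^sub>0 \<le> real I - 1" unfolding I_def by (simp add: le_nat_iff) linarith
  hence I: "Z \<le> s\<^sub>0 * (real I - 1)" "I \<ge> 3" using s0 by (auto simp: field_simps I_def)
  define c where "c = 1 - exp (- s\<^sub>0)"
  have c: "0 < c" "c < 1" using s0 by (auto simp: c_def)
  \<comment> \<open>In this order, the bounds on \<open>p\<close> give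
    \<open>h \<le> 2 * s\<^sub>0 / p\<close>, \<open>p < 1\<close>, a cheap first cell, and
    negligible losses per block.\<close>
  define p\<^sub>0 where "p\<^sub>0 = Min {s\<^sub>0, 1/2, (?e / 2)\<^sup>2, ?e / (2 * real I * (- ln c))}"
  have lc: "0 < - ln c" using c by simp
  have dpos: "0 < ?e / (2 * real I * (- ln c))"
    using e lc I by (intro divide_pos_pos mult_pos_pos) auto
  have "0 < p\<^sub>0" unfolding p\<^sub>0_def
    by (subst Min_gr_iff) (use s0 \<delta> dpos in \<open>auto simp only: insert_iff ball_simps empty_iff finite_insert finite.emptyI, auto\<close>)
  moreover have "p\<^sub>0 \<le> 1 / 2" unfolding p\<^sub>0_def by simp
  moreover have "span_prob p L \<ge> exp (- (pi\<^sup>2 / 9 + \<delta>) / p)"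
    if p: "0 < p" "p \<le> p\<^sub>0" and L: "2 * s\<^sub>0 * real I / p \<le> real L" for p L
  proof -
    have p1: "p \<le> s\<^sub>0" "p \<le> 1/2" "p \<le> (?e / 2)\<^sup>2" "p \<le> ?e / (2 * real I * (- ln c))"
      using p(2) unfolding p\<^sub>0_def by auto
    have cmp: "exp (- y / p) \<le> exp (- (2 / p) * x)" if "2 * x \<le> y" for x y
    proof -
      have "2 * x / p \<le> y / p" using p that by (intro divide_right_mono) auto
      thus ?thesis by simp
    qed
    define h where "h = nat \<lceil>s\<^sub>0 / p\<rceil>"
    define s where "s = p * real h"
    have "0 < s\<^sub>0 / p" using s0 p by simp
    hence h: "real h \<ge> s\<^sub>0 / p" "real h \<le> s\<^sub>0 / p + 1" "h \<ge> 1" unfolding h_def by linarith+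
    have s: "s\<^sub>0 \<le> s" "s \<le> 2 * s\<^sub>0"
    proof -
      have "p * (s\<^sub>0 / p) \<le> s" unfolding s_def using h p by (intro mult_left_mono) auto
      thus "s\<^sub>0 \<le> s" using p by simp
      have "s \<le> p * (s\<^sub>0 / p + 1)" unfolding s_def using h p by (intro mult_left_mono) auto
      thus "s \<le> 2 * s\<^sub>0" using p p1 by (simp add: algebra_simps)
    qed
    have ZI: "Z \<le> s * (real I - 1)"
    proof -
      have "s\<^sub>0 * (real I - 1) \<le> s * (real I - 1)" using s I by (intro mult_right_mono) auto
      thus ?thesis using I by linarith
    qed
    have LI: "I * h \<le> L"
    proof -
      have "real (I * h) = real I * s / p" using p by (simp add: s_def)
      also have "\<dots> \<le> real I * (2 * s\<^sub>0) / p" using s p by (intro divide_right_mono mult_left_mono) auto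
      also have "\<dots> \<le> real L" using L by (simp add: mult_ac)
      finally show ?thesis by linarith
    qed
    have tail: "exp (- ?e / p) \<le> exp (- (2 / p) * (dilog_exp (p * (real (I * h) - 1)) - dilog_exp (p * (real L - 1))))"
    proof -
      have "s * (real I - 1) \<le> p * (real (I * h) - 1)"
        using p h by (simp add: s_def algebra_simps)
      hence "dilog_exp (p * (real (I * h) - 1)) \<le> dilog_exp Z"
        using ZI Z0 by (intro dilog_exp_antimono) auto
      moreover have "0 \<le> dilog_exp (p * (real L - 1))"
        using LI h I p by (intro dilog_exp_nonneg mult_nonneg_nonneg) (auto simp: Suc_le_eq intro: order.strict_trans2[of 0 "I*h"])
      ultimately have "2 * (dilog_exp (p * (real (I * h) - 1)) - dilog_exp (p * (real L - 1))) \<le> ?e"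
        using Z(2) by (intro dbl[of _ "dilog_exp Z"]) auto
      thus ?thesis by (rule cmp)
    qed
    have mid: "exp (- (pi\<^sup>2 / 9 + ?e) / p) \<le> exp (- (2 / p) * (cost_primitive (s * (real I - 1)) - cost_primitive s))"
    proof -
      have "growth_cost (s * (real I - 1)) \<le> growth_cost Z" using ZI Z0 by (intro growth_cost_antimono)
      hence "(growth_cost (s * (real I - 1)))\<^sup>2 \<le> (growth_cost Z)\<^sup>2"
        using ZI Z0 by (intro power_mono growth_cost_nonneg) auto
      moreover have "cost_primitive (s * (real I - 1)) \<le> pi\<^sup>2 / 18 + (growth_cost (s * (real I - 1)))\<^sup>2 / 2"
        using ZI Z by (intro cost_primitive_le) auto
      moreover have "0 \<le> cost_primitive s" using s s0 by (intro cost_primitive_nonneg) auto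
      ultimately have "2 * (cost_primitive (s * (real I - 1)) - cost_primitive s) \<le> pi\<^sup>2 / 9 + ?e"
        using gZ by (intro dbl[of _ "pi\<^sup>2 / 18 + (growth_cost (s * (real I - 1)))\<^sup>2 / 2"]) (auto simp: field_simps)
      thus ?thesis by (rule cmp)
    qed
    have const: "exp (- ?e / p) \<le> (1 - exp (- s)) ^ (2 * (I - 2))"
    proof -
      have X: "0 < 2 * real I * (- ln c)" using lc I by (intro mult_pos_pos) auto
      have "p * (2 * real I * (- ln c)) \<le> ?e" by (rule pos_le_divide_eq[OF X, THEN iffD1, OF p1(4)])
      hence "2 * real I * (- ln c) \<le> ?e / p" by (simp only: pos_le_divide_eq[OF p(1)] mult.commute)
      hence "- (?e / p) \<le> - (2 * real I * (- ln c))" by (rule le_imp_neg_le)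
      also have "\<dots> = real (2 * I) * ln c" by simp
      finally have "exp (- ?e / p) \<le> exp (real (2 * I) * ln c)" by simp
      also have "\<dots> = c ^ (2 * I)" using c by (subst exp_of_nat_mult) simp
      also have "\<dots> \<le> c ^ (2 * (I - 2))" using c by (intro power_decreasing) auto
      also have "\<dots> \<le> (1 - exp (- s)) ^ (2 * (I - 2))" using c s by (intro power_mono) (auto simp: c_def)
      finally show ?thesis .
    qed
    have start: "exp (- ?e / p) * exp (- ?e / p) \<le> span_prob p (2 * h)"
    proof -
      have "- (p * ln p) \<le> 2 * sqrt p" using p p1 by (intro neg_mult_ln_le) auto
      also have "\<dots> \<le> ?e" using real_sqrt_le_mono[OF p1(3)] e by (simp add: real_sqrt_abs)
      finally have "- ?e \<le> p * ln p" by simp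
      hence "- ?e / p \<le> ln p" using p by (simp add: field_simps)
      hence "exp (- ?e / p) \<le> exp (ln p)" by simp
      hence a: "exp (- ?e / p) \<le> span_prob p 1" using p p1 span_prob_1[of p] by simp
      have h2: "0 \<le> p * (real (2 * h) - 1)" "p * (real (2 * h) - 1) < r"
      proof -
        show "0 \<le> p * (real (2 * h) - 1)" using p h by (intro mult_nonneg_nonneg) auto
        have "p * (real (2 * h) - 1) \<le> 2 * s" using p by (simp add: s_def algebra_simps)
        thus "p * (real (2 * h) - 1) < r" using s s0 by linarith
      qed
      have "2 * (dilog_exp 0 - dilog_exp (p * (real (2 * h) - 1))) \<le> ?e"
      proof -
        have "2 * (a - b) \<le> x" if "\<bar>b - a\<bar> < x / 2" for a b x :: real
          using that unfolding abs_less_iff by argo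
        from this[OF r(2)[OF h2]] show ?thesis .
      qed
      hence b: "exp (- ?e / p) \<le> exp (- (2 / p) * (dilog_exp 0 - dilog_exp (p * (real (2 * h) - 1))))"
        by (rule cmp)
      have "exp (- ?e / p) * exp (- ?e / p) \<le> 
         span_prob p 1 * exp (- (2 / p) * (dilog_exp 0 - dilog_exp (p * (real (2 * h) - 1))))"
        by (intro mult_mono a b span_prob_nonneg) auto
      also have "\<dots> \<le> span_prob p (2 * h)"
        using span_prob_unit_phase[of p 1 "2 * h"] p p1 h by simp
      finally show ?thesis .
    qed
    have pp: "0 < p" "p < 1" using p p1 by auto
    have "exp (- (pi\<^sup>2 / 9 + \<delta>) / p) = 
       exp (- ?e / p) * exp (- ?e / p) * exp (- ?e / p) * exp (- (pi\<^sup>2 / 9 + ?e) / p) * exp (- ?e / p)"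
    proof -
      have "- (pi\<^sup>2 / 9 + \<delta>) / p = - ?e / p + - ?e / p + - ?e / p + - (pi\<^sup>2 / 9 + ?e) / p + - ?e / p"
        using p by (simp add: field_simps)
      thus ?thesis by (simp only: exp_add)
    qed
    also have "\<dots> \<le> span_prob p (2 * h) * (1 - exp (- s)) ^ (2 * (I - 2)) *
       exp (- (2 / p) * (cost_primitive (s * (real I - 1)) - cost_primitive s)) *
       exp (- (2 / p) * (dilog_exp (p * (real (I * h) - 1)) - dilog_exp (p * (real L - 1))))"
      using s0 s by (intro mult_mono start const mid tail mult_nonneg_nonneg span_prob_nonneg) auto
    also have "\<dots> \<le> span_prob p (I * h) *
       exp (- (2 / p) * (dilog_exp (p * (real (I * h) - 1)) - dilog_exp (p * (real L - 1))))"
      using span_prob_block_phase[OF pp h(3), of I] I unfolding s_def by (intro mult_right_mono) auto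
    also have "\<dots> \<le> span_prob p L"
      using h I LI by (intro span_prob_unit_phase[OF pp]) (auto simp: Suc_le_eq)
    finally show ?thesis .
  qed
  ultimately show ?thesis by (rule that)
qed

section \<open>Uninfected arms\<close>

definition patch :: "nat \<Rightarrow> (nat \<times> nat) set" where
  "patch N = {0..N} \<times> {0..N}"

lemma finite_patch [simp]: "finite (patch N)"
  by (simp add: patch_def)

lemma swap_patch [simp]: "prod.swap ` patch N = patch N"
  by (simp add: patch_def product_swap)

definition strip :: "nat \<Rightarrow> nat \<Rightarrow> nat \<Rightarrow> (nat \<times> nat) set" where
  "strip L b c = {c, c + 1} \<times> {b * L<..b * L + L}"

text \<open>Tile \<open>a\<close> of band \<open>b\<close> is a row of \<open>m\<close> adjacent
  squares. Only these disjoint positions are searched for a seed, which makes the searches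
  independent.\<close>

definition seedless :: "nat \<Rightarrow> nat \<Rightarrow> nat \<Rightarrow> nat \<Rightarrow> (nat \<times> nat) set \<Rightarrow> bool" where
  "seedless L m a b A \<longleftrightarrow>
     (\<forall>i<m. \<not> spanned L {c \<in> sq L. (a * (m * L) + i * L + fst c, b * L + snd c) \<in> A})"

text \<open>A label names the reason why a tile of the band \<open>b\<close> does not fill up quickly: a vacant pair
  of columns (with the position of the pair) or the absence of a seed (with the index of the tile).\<close>

definition bad_band :: "nat \<Rightarrow> nat \<Rightarrow> nat \<Rightarrow> nat \<Rightarrow> bool \<times> nat \<Rightarrow> (nat \<times> nat) set \<Rightarrow> bool" where
  "bad_band L m N b lab A \<longleftrightarrow>
     (if fst lab then A \<inter> strip L b (snd lab) = {}
      else snd lab * (m * L) + m * L \<le> N \<and> seedless L m (snd lab) b A)"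

definition fill_time :: "nat \<Rightarrow> nat \<Rightarrow> nat" where
  "fill_time L m = 2 * L\<^sup>2 + m * L * L"

text \<open>Contrapositive of \<open>seeded_tile_full\<close> for the tile containing column
  \<open>i\<close>; only the first row of the band is examined. The tile may extend beyond the range
  of the path by \<open>m * L\<close>, hence the margin in \<open>N\<close>.\<close>

lemma uninfected_bad_band:
  assumes A: "A \<subseteq> patch N" and L: "L \<ge> 1" and m: "m \<ge> 1" and N: "N \<ge> r + m * L + L + 2"
    and i: "1 \<le> i" "i \<le> r + 1" and b: "b * L \<le> r"
    and un: "(i, b * L + 1) \<notin> spread (patch N) A (fill_time L m)"
  shows "\<exists>lab. snd lab < N \<and> bad_band L m N b lab A"
proof (rule ccontr)
  assume none: "\<not> ?thesis"
  let ?D = "m * L"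
  define a where "a = (i - 1) div ?D"
  have D: "?D \<ge> 1" using L m by simp
  have aD: "a * ?D \<le> i - 1" unfolding a_def by (rule div_times_less_eq_dividend)
  have "i - 1 < a * ?D + ?D" unfolding a_def using D dividend_less_div_times[of ?D "i - 1"] by (simp add: add.commute)
  hence ia: "i \<in> {a * ?D<..a * ?D + ?D}" using aD i by auto
  have aN: "a * ?D + ?D + 1 \<le> N" using aD i N L by linarith
  have "a * 1 \<le> a * ?D" using D by (intro mult_left_mono) auto
  hence "a < N" using aN D by linarith
  hence "\<not> bad_band L m N b (False, a) A" using none by auto
  then obtain k where k: "k < m" "spanned L {c \<in> sq L. (a * ?D + k * L + fst c, b * L + snd c) \<in> A}"
    using aN by (auto simp: bad_band_def seedless_def)
  have kL: "k * L + L \<le> ?D" using k(1) mult_le_mono1[of "Suc k" m L] by simp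
  have "{a * ?D<..a * ?D + ?D} \<times> {b * L<..b * L + L} \<subseteq> spread (patch N) A (2 * L\<^sup>2 + ?D * L)"
  proof (rule seeded_tile_full[OF A _ L _ _ k(2)])
    show "{a * ?D..a * ?D + ?D + 1} \<times> {b * L<..b * L + L} \<subseteq> patch N"
      using aN b N by (auto simp: patch_def)
    show "\<exists>y\<in>{b * L<..b * L + L}. (c, y) \<in> A \<or> (c + 1, y) \<in> A" if "c \<in> {a * ?D..a * ?D + ?D}" for c
    proof -
      have "c < N" using that aN by auto
      hence "\<not> bad_band L m N b (True, c) A" using none by auto
      thus ?thesis by (auto simp: bad_band_def strip_def)
    qed
  qed (use kL in auto)
  moreover have "(i, b * L + 1) \<in> {a * ?D<..a * ?D + ?D} \<times> {b * L<..b * L + L}" using ia L by auto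
  ultimately show False using un unfolding fill_time_def by blast
qed

text \<open>The end of the path determines which bands it enters in each direction, and every
  entered band is bad. Since \<open>X + Y = r + 2\<close>, the coordinate \<open>X\<close> alone has
  to be recorded. Bands of columns are treated by exchanging the coordinates.\<close>

lemma arm_bad_bands:
  assumes A: "A \<subseteq> patch N" and L: "L \<ge> 1" and m: "m \<ge> 1" and N: "N \<ge> r + m * L + L + 2"
    and un: "(1, 1) \<notin> spread (patch N) A (fill_time L m + r)"
  shows "\<exists>X\<in>{1..r+1}. (\<forall>a\<le>(X - 1) div L. \<exists>lab. snd lab < N \<and> bad_band L m N a lab (prod.swap ` A)) \<and>
     (\<forall>b\<le>(r + 1 - X) div L. \<exists>lab. snd lab < N \<and> bad_band L m N b lab A)"
proof -
  let ?T = "fill_time L m"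
  obtain X Y where XY: "X + Y = 1 + 1 + r" "1 \<le> X" "1 \<le> Y"
    and c: "\<And>i. i \<in> {1..X} \<Longrightarrow> \<exists>j\<in>{1..Y}. (i, j) \<notin> spread (patch N) A ?T"
    and d: "\<And>j. j \<in> {1..Y} \<Longrightarrow> \<exists>i\<in>{1..X}. (i, j) \<notin> spread (patch N) A ?T"
    using backward_path[of N "patch N" 1 1 A ?T r] un N by (auto simp: patch_def)
  show ?thesis
  proof (intro bexI[of _ X] conjI allI impI)
    show "X \<in> {1..r+1}" using XY by auto
    fix a assume "a \<le> (X - 1) div L"
    hence aL: "a * L \<le> X - 1" using L by (simp add: less_eq_div_iff_mult_less_eq)
    have "a * L + 1 \<in> {1..X}" using aL XY(2) by auto
    from c[OF this] obtain j where j: "j \<in> {1..Y}" "(a * L + 1, j) \<notin> spread (patch N) A ?T" by blast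
    have "(j, a * L + 1) \<notin> spread (patch N) (prod.swap ` A) ?T"
      using j(2) spread_swap[OF A, of ?T] by (simp add: swap_mem)
    moreover have "prod.swap ` A \<subseteq> patch N" using image_mono[OF A, of prod.swap] by simp
    ultimately show "\<exists>lab. snd lab < N \<and> bad_band L m N a lab (prod.swap ` A)"
      using aL j XY by (intro uninfected_bad_band[OF _ L m N, where i=j]) auto
  next
    fix b assume "b \<le> (r + 1 - X) div L"
    hence bL: "b * L \<le> r + 1 - X" using L by (simp add: less_eq_div_iff_mult_less_eq)
    have "b * L + 1 \<in> {1..Y}" using bL XY by auto
    from d[OF this] obtain i where i: "i \<in> {1..X}" "(i, b * L + 1) \<notin> spread (patch N) A ?T" by blast
    show "\<exists>lab. snd lab < N \<and> bad_band L m N b lab A"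
      using bL i XY by (intro uninfected_bad_band[OF A L m N, where i=i]) auto
  qed
qed

lemma pr_swap: "pr (patch N) p (\<lambda>A. P (prod.swap ` A)) = pr (patch N) p P"
proof -
  have "pr (patch N) p (\<lambda>A. P (prod.swap ` A)) = pr (patch N) p (\<lambda>A. P {c \<in> patch N. prod.swap c \<in> A})"
  proof (rule pr_cong)
    fix A :: "(nat \<times> nat) set" assume "A \<subseteq> patch N"
    hence "prod.swap ` A = {c \<in> patch N. prod.swap c \<in> A}" by (force simp: patch_def)
    thus "P (prod.swap ` A) \<longleftrightarrow> P {c \<in> patch N. prod.swap c \<in> A}" by simp
  qed simp
  also have "\<dots> = pr (patch N) p P" by (rule pr_transfer) auto
  finally show ?thesis .
qed

lemma band_index:
  fixes y k L :: nat
  assumes "y \<in> {k * L<..k * L + L}"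
  shows "(y - 1) div L = k"
  by (rule div_nat_eqI) (use assms in \<open>auto simp: mult.commute\<close>)

lemma pr_seedless:
  assumes p: "0 \<le> p" "p \<le> 1" and J: "finite J" 
    and a: "\<And>b. b \<in> J \<Longrightarrow> a b * (m * L) + m * L \<le> N" and b: "\<And>b. b \<in> J \<Longrightarrow> b * L + L \<le> N"
  shows "pr (patch N) p (\<lambda>A. \<forall>b\<in>J. seedless L m (a b) b A) \<le> ((1 - span_prob p L) ^ m) ^ card J"
proof -
  let ?e = "\<lambda>(b, i) c. (a b * (m * L) + i * L + fst c, b * L + snd c)"
  let ?E = "\<lambda>j A. \<not> spanned L {c \<in> sq L. ?e j c \<in> A}"
  let ?I = "J \<times> {..<m}"
  have sub: "?e j ` sq L \<subseteq> patch N" if jI: "j \<in> ?I" for j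
  proof -
    obtain b i where j: "j = (b, i)" "b \<in> J" "i < m" using jI by auto
    have "i * L + L \<le> m * L" using j(3) mult_le_mono1[of "Suc i" m L] by simp
    thus ?thesis using a[OF j(2)] b[OF j(2)] by (auto simp: j(1) patch_def sq_def)
  qed
  have disj: "?e j ` sq L \<inter> ?e j' ` sq L = {}" if jj: "j \<in> ?I" "j' \<in> ?I" "j \<noteq> j'" for j j'
  proof (rule ccontr)
    assume "?e j ` sq L \<inter> ?e j' ` sq L \<noteq> {}"
    then obtain c c' where cc: "c \<in> sq L" "c' \<in> sq L" "?e j c = ?e j' c'" by blast
    obtain b i b' i' where j: "j = (b, i)" "j' = (b', i')" by (cases j, cases j')
    have "b = b'" using band_index[of "b * L + snd c" b L] band_index[of "b' * L + snd c'" b' L] cc by (auto simp: sq_def j)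
    moreover from this have "i * L + fst c = i' * L + fst c'" using cc by (simp add: j)
    hence "i = i'" using band_index[of "i * L + fst c" i L] band_index[of "i' * L + fst c'" i' L] cc by (auto simp: sq_def)
    ultimately show False using jj j by simp
  qed
  have "pr (patch N) p (\<lambda>A. \<forall>b\<in>J. seedless L m (a b) b A) = pr (patch N) p (\<lambda>A. \<forall>j\<in>?I. ?E j A)"
    unfolding seedless_def by (rule pr_cong) auto
  also have "\<dots> = (\<Prod>j\<in>?I. pr (patch N) p (?E j))"
  proof (rule pr_indep_family[where S="\<lambda>j. ?e j ` sq L"])
    fix j A
    have "{c \<in> sq L. ?e j c \<in> A} = {c \<in> sq L. ?e j c \<in> A \<inter> ?e j ` sq L}" by blast
    thus "?E j A \<longleftrightarrow> ?E j (A \<inter> ?e j ` sq L)" by simp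
  qed (use J sub disj in auto)
  also have "\<dots> = (\<Prod>j\<in>?I. 1 - span_prob p L)"
  proof (intro prod.cong refl)
    fix j assume j: "j \<in> ?I"
    have inj: "inj_on (?e j) (sq L)" by (cases j) (auto simp: inj_on_def)
    have "pr (patch N) p (?E j) = 1 - pr (patch N) p (\<lambda>A. spanned L {c \<in> sq L. ?e j c \<in> A})" by (rule pr_not)
    also have "pr (patch N) p (\<lambda>A. spanned L {c \<in> sq L. ?e j c \<in> A}) = span_prob p L"
      unfolding span_prob_def by (rule pr_transfer[OF finite_patch inj sub[OF j]])
    finally show "pr (patch N) p (?E j) = 1 - span_prob p L" .
  qed
  also have "\<dots> = ((1 - span_prob p L) ^ m) ^ card J"
    by (simp add: power_mult[symmetric] mult.commute card_cartesian_product)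
  finally show ?thesis by simp
qed

text \<open>If a tile leaves the patch, its event is empty. Otherwise the tiles lie in different
  bands and are disjoint wherever they are placed.\<close>

lemma pr_seedless_bands:
  assumes p: "0 \<le> p" "p \<le> 1" and J: "finite J"
    and f: "\<And>b. b \<in> J \<Longrightarrow> \<not> fst (f b)" and b: "\<And>b. b \<in> J \<Longrightarrow> b * L + L \<le> N"
  shows "pr (patch N) p (\<lambda>A. \<forall>b\<in>J. bad_band L m N b (f b) A) \<le> ((1 - span_prob p L) ^ m) ^ card J"
proof (cases "\<forall>b\<in>J. snd (f b) * (m * L) + m * L \<le> N")
  case True
  have "pr (patch N) p (\<lambda>A. \<forall>b\<in>J. bad_band L m N b (f b) A)
      \<le> pr (patch N) p (\<lambda>A. \<forall>b\<in>J. seedless L m (snd (f b)) b A)"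
    by (rule pr_mono) (auto simp: bad_band_def f)
  also have "\<dots> \<le> ((1 - span_prob p L) ^ m) ^ card J" using True b by (intro pr_seedless p J) auto
  finally show ?thesis .
next
  case False
  hence "pr (patch N) p (\<lambda>A. \<forall>b\<in>J. bad_band L m N b (f b) A) \<le> pr (patch N) p (\<lambda>A. A \<noteq> A)"
    by (intro pr_mono) (auto simp: bad_band_def f)
  also have "\<dots> = 0" by (simp add: pr_def)
  also have "0 \<le> ((1 - span_prob p L) ^ m) ^ card J" using span_prob_le_1[of p L] by simp
  finally show ?thesis .
qed

text \<open>Each row of a swapped strip belongs to a single band and so meets at most one strip of
  the other orientation, in at most two cells. With two rows, at most 4 cells per swapped strip are
  counted twice.\<close>

lemma card_strips:
  assumes fin: "finite J" "finite K" and L: "L \<ge> 2"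
  shows "card ((\<Union>b\<in>J. strip L b (c b)) \<union> prod.swap ` (\<Union>a\<in>K. strip L a (d a)))
     \<ge> (2 * L - 4) * (card J + card K)"
proof -
  let ?Z1 = "\<Union>b\<in>J. strip L b (c b)" and ?Z2 = "\<Union>a\<in>K. strip L a (d a)"
  have fs: "finite (strip L b x)" for b x by (simp add: strip_def)
  have cs: "card (strip L b x) = 2 * L" for b x by (simp add: strip_def card_cartesian_product)
  have cU: "card (\<Union>b\<in>J. strip L b (c b)) = card J * (2 * L)" if "finite J" for J and c :: "nat \<Rightarrow> nat"
  proof -
    have "strip L b (c b) \<inter> strip L b' (c b') = {}" if "b \<noteq> b'" for b b'
    proof (rule ccontr)
      assume "strip L b (c b) \<inter> strip L b' (c b') \<noteq> {}"
      then obtain x y where "(x, y) \<in> strip L b (c b)" "(x, y) \<in> strip L b' (c b')" by auto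
      hence "b = (y - 1) div L" "b' = (y - 1) div L" using band_index by (auto simp: strip_def)
      thus False using \<open>b \<noteq> b'\<close> by simp
    qed
    thus ?thesis using that by (subst card_UN_disjoint) (auto simp: fs cs)
  qed
  have f1: "finite ?Z1" "finite ?Z2" using fin fs by auto
  have "card (prod.swap ` ?Z2) = card ?Z2" by (rule card_image) simp
  hence Z2: "card (prod.swap ` ?Z2) = card K * (2 * L)" using cU[OF fin(2)] by simp
  have "?Z1 \<inter> prod.swap ` ?Z2 \<subseteq> (\<Union>a\<in>K. \<Union>y\<in>{d a, d a + 1}. {c ((y - 1) div L), c ((y - 1) div L) + 1} \<times> {y})"
  proof
    fix z assume z: "z \<in> ?Z1 \<inter> prod.swap ` ?Z2"
    then obtain b a where ba: "b \<in> J" "z \<in> strip L b (c b)" "a \<in> K" "prod.swap z \<in> strip L a (d a)" by auto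
    have "(snd z - 1) div L = b" using ba(2) by (intro band_index) (auto simp: strip_def)
    hence w: "z \<in> {c ((snd z - 1) div L), c ((snd z - 1) div L) + 1} \<times> {snd z}"
      using ba(2) by (auto simp: strip_def)
    have y: "snd z \<in> {d a, d a + 1}" using ba(4) by (cases z) (auto simp: strip_def)
    show "z \<in> (\<Union>a\<in>K. \<Union>y\<in>{d a, d a + 1}. {c ((y - 1) div L), c ((y - 1) div L) + 1} \<times> {y})"
      by (rule UN_I[OF ba(3)], rule UN_I[OF y], rule w)
  qed
  hence "card (?Z1 \<inter> prod.swap ` ?Z2) \<le> card (\<Union>a\<in>K. \<Union>y\<in>{d a, d a + 1}. {c ((y - 1) div L), c ((y - 1) div L) + 1} \<times> {y})"
    using fin by (intro card_mono) auto
  also have "\<dots> \<le> (\<Sum>a\<in>K. card (\<Union>y\<in>{d a, d a + 1}. {c ((y - 1) div L), c ((y - 1) div L) + 1} \<times> {y}))"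
    by (rule card_UN_le[OF fin(2)])
  also have "\<dots> \<le> (\<Sum>a\<in>K. 4)"
  proof (rule sum_mono)
    fix a
    have "card (\<Union>y\<in>{d a, d a + 1}. {c ((y - 1) div L), c ((y - 1) div L) + 1} \<times> {y})
      \<le> (\<Sum>y\<in>{d a, d a + 1}. card ({c ((y - 1) div L), c ((y - 1) div L) + 1} \<times> {y}))"
      by (rule card_UN_le) simp
    also have "\<dots> = 4" by (simp add: card_cartesian_product)
    finally show "card (\<Union>y\<in>{d a, d a + 1}. {c ((y - 1) div L), c ((y - 1) div L) + 1} \<times> {y}) \<le> 4" .
  qed
  finally have int: "card (?Z1 \<inter> prod.swap ` ?Z2) \<le> 4 * card K" by (simp add: mult.commute)
  have "card ?Z1 + card (prod.swap ` ?Z2) = card (?Z1 \<union> prod.swap ` ?Z2) + card (?Z1 \<inter> prod.swap ` ?Z2)"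
    using f1 by (intro card_Un_Int) auto
  hence "card J * (2 * L) + card K * (2 * L) \<le> card (?Z1 \<union> prod.swap ` ?Z2) + 4 * card K"
    using cU[OF fin(1), of c] Z2 int by linarith
  moreover have "(2 * L - 4) * (card J + card K) + 4 * (card J + card K) = (2 * L) * (card J + card K)"
    using L by (subst add_mult_distrib[symmetric]) simp
  moreover have "(2 * L) * (card J + card K) = card J * (2 * L) + card K * (2 * L)" by (simp add: algebra_simps)
  moreover have "x \<le> z" if "a + b \<le> z + 4 * k" "x + 4 * (j + k) = y" "y = a + b" for x z a b j k y :: nat
    using that by presburger
  ultimately show ?thesis by blast
qed

text \<open>If at least a fraction \<open>1 / (M + 1)\<close> of the labels are seedless, half of
  those share an orientation and are independent; the factor \<open>4 * L * M\<close> pays for both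
  losses. Otherwise a fraction \<open>M / (M + 1)\<close> of the bands contain vacant
  strips.\<close>

lemma pr_labelled:
  fixes f g :: "nat \<Rightarrow> bool \<times> nat"
  assumes p: "0 < p" "p < 1" and L: "L \<ge> 2" 
    and s: "(1 - span_prob p L) ^ m \<le> (1 - p) ^ (4 * L * M)"
    and B: "B * L \<le> N" and C: "C * L \<le> N"
    and f: "\<And>b. b < B \<Longrightarrow> snd (f b) < N" and g: "\<And>a. a < C \<Longrightarrow> snd (g a) < N"
  shows "pr (patch N) p (\<lambda>A. (\<forall>b<B. bad_band L m N b (f b) A) \<and> (\<forall>a<C. bad_band L m N a (g a) (prod.swap ` A)))
     \<le> (1 - p) powr (real M / (real M + 1) * (2 * real L - 4) * real (B + C))"
proof -
  let ?q = "1 - p" and ?x = "real M / (real M + 1) * (2 * real L - 4) * real (B + C)"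
  let ?P = "pr (patch N) p (\<lambda>A. (\<forall>b<B. bad_band L m N b (f b) A) \<and> (\<forall>a<C. bad_band L m N a (g a) (prod.swap ` A)))"
  have q: "0 < ?q" "?q < 1" using p by auto
  have powr: "?q ^ n \<le> ?q powr ?x" if "?x \<le> real n" for n
    using that q by (simp add: powr_realpow[symmetric] powr_mono')
  define S1 S2 where "S1 = {b. b < B \<and> \<not> fst (f b)}" and "S2 = {a. a < C \<and> \<not> fst (g a)}"
  define T1 T2 where "T1 = {b. b < B \<and> fst (f b)}" and "T2 = {a. a < C \<and> fst (g a)}"
  have fin: "finite S1" "finite S2" "finite T1" "finite T2" by (auto simp: S1_def S2_def T1_def T2_def)
  have "card (S1 \<union> T1) = card S1 + card T1" using fin by (intro card_Un_disjoint) (auto simp: S1_def T1_def)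
  moreover have "S1 \<union> T1 = {..<B}" by (auto simp: S1_def T1_def)
  ultimately have cB: "card S1 + card T1 = B" by simp
  have "card (S2 \<union> T2) = card S2 + card T2" using fin by (intro card_Un_disjoint) (auto simp: S2_def T2_def)
  moreover have "S2 \<union> T2 = {..<C}" by (auto simp: S2_def T2_def)
  ultimately have cC: "card S2 + card T2 = C" by simp
  define k where "k = card S1 + card S2"
  have rowN: "b * L + L \<le> N" if "b < B" for b using that B mult_le_mono1[of "Suc b" B L] by simp
  have colN: "a * L + L \<le> N" if "a < C" for a using that C mult_le_mono1[of "Suc a" C L] by simp
  have sl: "((1 - span_prob p L) ^ m) ^ n \<le> ?q powr ?x" if n: "k \<le> 2 * n" and k: "B + C \<le> k * (M + 1)" for n
  proof -
    have "((1 - span_prob p L) ^ m) ^ n \<le> (?q ^ (4 * L * M)) ^ n"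
      using s span_prob_le_1[of p L] by (intro power_mono) auto
    also have "\<dots> = ?q ^ (4 * L * M * n)" by (simp add: power_mult)
    also have "\<dots> \<le> ?q powr ?x"
    proof (rule powr)
      have "real (B + C) \<le> real k * (real M + 1)" using k by (metis of_nat_1 of_nat_add of_nat_le_iff of_nat_mult)
      hence "real (B + C) / (real M + 1) \<le> real k" by (subst pos_divide_le_eq) auto
      hence "real M * (2 * real L - 4) * (real (B + C) / (real M + 1)) \<le> real M * (2 * real L - 4) * real k"
        using L by (intro mult_left_mono) auto
      also have "\<dots> \<le> real M * (2 * real L) * (2 * real n)" using n L by (intro mult_mono) auto
      also have "\<dots> = real (4 * L * M * n)" by simp
      finally show "?x \<le> real (4 * L * M * n)" by simp
    qed
    finally show ?thesis .
  qed
  \<comment> \<open>Seedless tiles of different orientations may overlap, so only the more frequent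
    orientation is used.\<close>
  consider (rows) "B + C \<le> k * (M + 1)" "k \<le> 2 * card S1" | (columns) "B + C \<le> k * (M + 1)" "k \<le> 2 * card S2"
    | (strips) "k * (M + 1) < B + C" unfolding k_def by linarith
  thus ?thesis
  proof cases
    case rows
    have "?P \<le> pr (patch N) p (\<lambda>A. \<forall>b\<in>S1. bad_band L m N b (f b) A)"
      by (rule pr_mono) (auto simp: S1_def)
    also have "\<dots> \<le> ((1 - span_prob p L) ^ m) ^ card S1"
      using p rowN fin by (intro pr_seedless_bands) (auto simp: S1_def)
    also have "\<dots> \<le> ?q powr ?x" using rows by (intro sl)
    finally show ?thesis .
  next
    case columns
    have "?P \<le> pr (patch N) p (\<lambda>A. \<forall>a\<in>S2. bad_band L m N a (g a) (prod.swap ` A))"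
      by (rule pr_mono) (auto simp: S2_def)
    also have "\<dots> = pr (patch N) p (\<lambda>A. \<forall>a\<in>S2. bad_band L m N a (g a) A)"
      by (rule pr_swap)
    also have "\<dots> \<le> ((1 - span_prob p L) ^ m) ^ card S2"
      using p colN fin by (intro pr_seedless_bands) (auto simp: S2_def)
    also have "\<dots> \<le> ?q powr ?x" using columns by (intro sl)
    finally show ?thesis .
  next
    case strips
    let ?Z1 = "\<Union>b\<in>T1. strip L b (snd (f b))" and ?Z2 = "\<Union>a\<in>T2. strip L a (snd (g a))"
    let ?Z = "?Z1 \<union> prod.swap ` ?Z2"
    have "?Z1 \<subseteq> patch N" using rowN f by (fastforce simp: patch_def strip_def T1_def)
    moreover have "?Z2 \<subseteq> patch N" using colN g by (fastforce simp: patch_def strip_def T2_def)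
    hence "prod.swap ` ?Z2 \<subseteq> patch N" using image_mono[of ?Z2 "patch N" prod.swap] by simp
    ultimately have Z: "?Z \<subseteq> patch N" by simp
    have "?P \<le> pr (patch N) p (\<lambda>A. A \<inter> ?Z = {})"
    proof (rule pr_mono)
      fix A assume h: "(\<forall>b<B. bad_band L m N b (f b) A) \<and> (\<forall>a<C. bad_band L m N a (g a) (prod.swap ` A))"
      have "A \<inter> strip L b (snd (f b)) = {}" if "b \<in> T1" for b
        using h that by (auto simp only: bad_band_def T1_def mem_Collect_eq if_True)
      hence "A \<inter> ?Z1 = {}" by blast
      moreover have "prod.swap ` A \<inter> strip L a (snd (g a)) = {}" if "a \<in> T2" for a
        using h that by (auto simp only: bad_band_def T2_def mem_Collect_eq if_True)
      hence "prod.swap ` A \<inter> ?Z2 = {}" by blast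
      hence "A \<inter> prod.swap ` ?Z2 = {}" by force
      ultimately show "A \<inter> ?Z = {}" by blast
    qed simp
    also have "\<dots> = ?q ^ card ?Z" using p Z by (intro pr_empty) auto
    also have "\<dots> \<le> ?q powr ?x"
    proof (rule powr)
      have t: "card T1 + card T2 + k = B + C" using cB cC by (simp add: k_def)
      have "real k * (real M + 1) \<le> real (B + C)" using strips by (metis less_imp_le of_nat_1 of_nat_add of_nat_le_iff of_nat_mult)
      hence "real k \<le> real (B + C) / (real M + 1)" by (subst pos_le_divide_eq) auto
      hence "real (B + C) - real (B + C) / (real M + 1) \<le> real (card T1 + card T2)" using t by linarith
      moreover have "real (B + C) - real (B + C) / (real M + 1) = real M / (real M + 1) * real (B + C)"
        by (simp add: field_simps)
      ultimately have "real M / (real M + 1) * real (B + C) \<le> real (card T1 + card T2)" by simp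
      hence "(2 * real L - 4) * (real M / (real M + 1) * real (B + C)) \<le> (2 * real L - 4) * real (card T1 + card T2)"
        using L by (intro mult_left_mono) auto
      also have "\<dots> = real ((2 * L - 4) * (card T1 + card T2))" using L by (simp add: of_nat_diff)
      also have "\<dots> \<le> real (card ?Z)" using card_strips[OF fin(3,4) L] by (simp only: of_nat_le_iff)
      finally show "?x \<le> real (card ?Z)" by (simp add: mult_ac)
    qed
    finally show ?thesis .
  qed
qed

text \<open>Union bound over the end of the path and the labellings. The number of bands is at least
  \<open>r / L\<close>, which gives the exponent, and at most \<open>r div L + 2\<close>, which
  bounds the number of labellings.\<close>

theorem arm_probability:
  assumes p: "0 < p" "p < 1" and L: "L \<ge> 2" and m: "m \<ge> 1" and N: "N \<ge> r + m * L + L + 2"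
    and s: "(1 - span_prob p L) ^ m \<le> (1 - p) ^ (4 * L * M)"
  shows "pr (patch N) p (\<lambda>A. (1, 1) \<notin> spread (patch N) A (fill_time L m + r))
     \<le> real (r + 1) * (2 * real N) ^ (r div L + 2) *
        (1 - p) powr (real M / (real M + 1) * (2 * real L - 4) * (real r / real L))"
proof -
  let ?q = "1 - p"
  let ?Q = "?q powr (real M / (real M + 1) * (2 * real L - 4) * (real r / real L))"
  let ?b = "\<lambda>X. (r + 1 - X) div L + 1" and ?a = "\<lambda>X. (X - 1) div L + 1"
  define lab where "lab n = PiE {..<n} (\<lambda>_. (UNIV :: bool set) \<times> {..<N})" for n :: nat
  define E where "E X h A \<longleftrightarrow> (\<forall>b<?b X. bad_band L m N b (fst h b) A) \<and> (\<forall>a<?a X. bad_band L m N a (snd h a) (prod.swap ` A))"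
    for X and h :: "(nat \<Rightarrow> bool \<times> nat) \<times> (nat \<Rightarrow> bool \<times> nat)" and A
  have finlab: "finite (lab n)" for n unfolding lab_def by (intro finite_PiE) auto
  have cardlab: "card (lab n) = (2 * N) ^ n" for n by (simp add: lab_def card_PiE card_cartesian_product)
  have "pr (patch N) p (\<lambda>A. (1, 1) \<notin> spread (patch N) A (fill_time L m + r))
     \<le> (\<Sum>X\<in>{1..r+1}. pr (patch N) p (\<lambda>A. \<exists>h\<in>lab (?b X) \<times> lab (?a X). E X h A))"
  proof (rule pr_union)
    fix A assume A: "A \<subseteq> patch N" and un: "(1, 1) \<notin> spread (patch N) A (fill_time L m + r)"
    obtain X where X: "X \<in> {1..r+1}" 
      "\<And>a. a < ?a X \<Longrightarrow> \<exists>l. snd l < N \<and> bad_band L m N a l (prod.swap ` A)"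
      "\<And>b. b < ?b X \<Longrightarrow> \<exists>l. snd l < N \<and> bad_band L m N b l A"
      using arm_bad_bands[OF A _ m N un] L by (auto simp: less_Suc_eq_le)
    obtain g where g: "\<And>a. a < ?a X \<Longrightarrow> snd (g a) < N \<and> bad_band L m N a (g a) (prod.swap ` A)"
      using X(2) by metis
    obtain f where f: "\<And>b. b < ?b X \<Longrightarrow> snd (f b) < N \<and> bad_band L m N b (f b) A"
      using X(3) by metis
    have m: "(restrict f {..<?b X}, restrict g {..<?a X}) \<in> lab (?b X) \<times> lab (?a X)"
      using f g by (auto simp: mem_Times_iff lab_def)
    have e: "E X (restrict f {..<?b X}, restrict g {..<?a X}) A" using f g by (auto simp: E_def)
    have "\<exists>h\<in>lab (?b X) \<times> lab (?a X). E X h A" by (rule bexI[of "\<lambda>h. E X h A", OF e m])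
    from bexI[of "\<lambda>X. \<exists>h\<in>lab (?b X) \<times> lab (?a X). E X h A", OF this X(1)]
    show "\<exists>X\<in>{1..r+1}. \<exists>h\<in>lab (?b X) \<times> lab (?a X). E X h A" .
  qed auto
  also have "\<dots> \<le> (\<Sum>X\<in>{1..r+1}. (2 * real N) ^ (r div L + 2) * ?Q)"
  proof (rule sum_mono)
    fix X assume X: "X \<in> {1..r+1}"
    let ?K = "?b X + ?a X"
    have K1: "?K \<le> r div L + 2"
    proof -
      have "(r + 1 - X) div L + (X - 1) div L \<le> (r + 1 - X + (X - 1)) div L"
        unfolding div_add1_eq[of "r + 1 - X" "X - 1" L] by simp
      also have "r + 1 - X + (X - 1) = r" using X by auto
      finally show ?thesis by simp
    qed
    have b1: "?b X * L \<le> r + 1 - X + L" "r + 1 - X < ?b X * L"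
      using div_times_less_eq_dividend[of "r+1-X" L] dividend_less_div_times[of L "r+1-X"] L by (auto simp: algebra_simps)
    have a1: "?a X * L \<le> X - 1 + L" "X - 1 < ?a X * L"
      using div_times_less_eq_dividend[of "X-1" L] dividend_less_div_times[of L "X-1"] L by (auto simp: algebra_simps)
    have "r + 1 - X \<le> r" "X - 1 \<le> r" using X by auto
    hence bN: "?b X * L \<le> N" and aN: "?a X * L \<le> N" using b1(1) a1(1) N by linarith+
    have "r \<le> ?K * L" using b1(2) a1(2) X by (simp add: algebra_simps)
    hence "real r \<le> real (?K * L)" by (simp only: of_nat_le_iff)
    hence "real r \<le> real ?K * real L" by (simp only: of_nat_mult)
    hence K2: "real r / real L \<le> real ?K" using L by (subst pos_divide_le_eq) (simp, assumption)
    have "pr (patch N) p (\<lambda>A. \<exists>h\<in>lab (?b X) \<times> lab (?a X). E X h A)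
       \<le> (\<Sum>h\<in>lab (?b X) \<times> lab (?a X). pr (patch N) p (E X h))"
      by (rule pr_union) (auto simp: finlab)
    also have "\<dots> \<le> (\<Sum>h\<in>lab (?b X) \<times> lab (?a X). ?Q)"
    proof (rule sum_mono)
      fix h assume h: "h \<in> lab (?b X) \<times> lab (?a X)"
      have "snd (fst h b) < N" if "b < ?b X" for b
        using h that PiE_mem[of "fst h" "{..<?b X}" "\<lambda>_. UNIV \<times> {..<N}" b] by (auto simp: mem_Times_iff lab_def)
      moreover have "snd (snd h a) < N" if "a < ?a X" for a
        using h that PiE_mem[of "snd h" "{..<?a X}" "\<lambda>_. UNIV \<times> {..<N}" a] by (auto simp: mem_Times_iff lab_def)
      ultimately have "pr (patch N) p (E X h) \<le> ?q powr (real M / (real M + 1) * (2 * real L - 4) * real ?K)"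
        unfolding E_def by (intro pr_labelled[OF p L s bN aN])
      also have "\<dots> \<le> ?Q"
        using p L K2 by (intro powr_mono' mult_left_mono) auto
      finally show "pr (patch N) p (E X h) \<le> ?Q" .
    qed
    also have "\<dots> = (2 * real N) ^ ?K * ?Q"
      by (simp add: card_cartesian_product cardlab power_add)
    also have "\<dots> \<le> (2 * real N) ^ (r div L + 2) * ?Q"
      using K1 N by (intro mult_right_mono power_increasing) auto
    finally show "pr (patch N) p (\<lambda>A. \<exists>h\<in>lab (?b X) \<times> lab (?a X). E X h A) \<le> (2 * real N) ^ (r div L + 2) * ?Q" .
  qed
  also have "\<dots> = real (r + 1) * (2 * real N) ^ (r div L + 2) * ?Q" by (simp add: mult.assoc)
  finally show ?thesis .
qed

section \<open>Union bound over the cells of the grid\<close>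

declare spread.simps(2) [simp del]

text \<open>Places an arm at the cell \<open>(x, y)\<close>, the image of \<open>(1, 1)\<close>; the
  flags select the quadrant, and index 0 is one line behind the cell. This line is why
  \<open>fits\<close> leaves a margin on the side away from the arm.\<close>

definition orient :: "bool \<Rightarrow> bool \<Rightarrow> nat \<Rightarrow> nat \<Rightarrow> nat \<times> nat \<Rightarrow> nat \<times> nat" where
  "orient s t x y c = (if s then x + fst c - 1 else x + 1 - fst c, if t then y + snd c - 1 else y + 1 - snd c)"

definition fits :: "nat \<Rightarrow> nat \<Rightarrow> bool \<Rightarrow> nat \<Rightarrow> bool" where
  "fits n N s x \<longleftrightarrow> (if s then 2 \<le> x \<and> x + N \<le> n + 1 else N \<le> x \<and> x + 1 \<le> n)"

lemma finite_grid [simp]: "finite (grid n)"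
  by (simp add: grid_def)

lemma orient_1 [simp]: "orient s t x y (1, 1) = (x, y)" "orient s t x y (Suc 0, Suc 0) = (x, y)"
  by (auto simp: orient_def)

lemma orient_inj: "fits n N s x \<Longrightarrow> fits n N t y \<Longrightarrow> inj_on (orient s t x y) (patch N)"
  by (auto simp: orient_def fits_def inj_on_def patch_def split: if_splits)

lemma fits_bounds:
  assumes "1 \<le> N" "fits n N s x" "i \<le> N"
  shows "1 \<le> (if s then x + i - 1 else x + 1 - i)" "(if s then x + i - 1 else x + 1 - i) \<le> n"
  using assms by (cases s; simp add: fits_def; linarith)+

lemma orient_grid:
  assumes "1 \<le> N" "fits n N s x" "fits n N t y"
  shows "orient s t x y ` patch N \<subseteq> grid n"
proof
  fix z assume "z \<in> orient s t x y ` patch N"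
  then obtain c where c: "fst c \<le> N" "snd c \<le> N" "z = orient s t x y c" by (auto simp: patch_def)
  show "z \<in> grid n"
    using fits_bounds[OF assms(1,2) c(1)] fits_bounds[OF assms(1,3) c(2)]
    unfolding c(3) orient_def grid_def mem_Times_iff fst_conv snd_conv atLeastAtMost_iff by blast
qed

lemma orient_adj:
  assumes "fits n N s x" "fits n N t y" "a \<in> patch N" "b \<in> patch N" "grid_adj a b"
  shows "grid_adj (orient s t x y a) (orient s t x y b)"
proof -
  have 1: "\<bar>int (if s then x + i - 1 else x + 1 - i) - int (if s then x + j - 1 else x + 1 - j)\<bar> = \<bar>int i - int j\<bar>"
    if "fits n N s x" "i \<le> N" "j \<le> N" for s x i j
    using that by (auto simp: fits_def of_nat_diff)
  show ?thesis
    using assms 1[OF assms(1), of "fst a" "fst b"] 1[OF assms(2), of "snd a" "snd b"]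
    unfolding grid_adj_def orient_def by (auto simp: patch_def)
qed

definition arm_event :: "nat \<Rightarrow> nat \<Rightarrow> (nat \<times> nat \<Rightarrow> nat \<times> nat) \<Rightarrow> (nat \<times> nat) set \<Rightarrow> bool" where
  "arm_event N t e A \<longleftrightarrow> (1, 1) \<notin> spread (patch N) {c \<in> patch N. e c \<in> A} t"

text \<open>Within the patch alone the infection is no larger, so the event can be weakened to one
  that depends on the patch only.\<close>

lemma uninfected_arm_event:
  assumes "1 \<le> N" "fits n N s x" "fits n N u y" "(x, y) \<notin> spread (grid n) A t"
  shows "arm_event N t (orient s u x y) A"
proof (rule ccontr)
  assume "\<not> ?thesis"
  hence "orient s u x y (1, 1) \<in> orient s u x y ` spread (patch N) {c \<in> patch N. orient s u x y c \<in> A} t"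
    unfolding arm_event_def by blast
  also have "\<dots> \<subseteq> spread (grid n) A t"
    using orient_inj[OF assms(2,3)] orient_grid[OF assms(1-3)] orient_adj[OF assms(2,3)]
    by (intro spread_embed) auto
  finally show False using assms(4) by simp
qed

lemma arm_event_local: "arm_event N t e A \<longleftrightarrow> arm_event N t e (A \<inter> e ` patch N)"
proof -
  have "{c \<in> patch N. e c \<in> A} = {c \<in> patch N. e c \<in> A \<inter> e ` patch N}" by blast
  thus ?thesis by (simp add: arm_event_def)
qed

lemma pr_arm_event:
  assumes "1 \<le> N" "fits n N s x" "fits n N u y"
  shows "pr (grid n) p (arm_event N t (orient s u x y)) = pr (patch N) p (\<lambda>A. (1, 1) \<notin> spread (patch N) A t)"
  unfolding arm_event_def
  by (rule pr_transfer[where P="\<lambda>A. (1, 1) \<notin> spread (patch N) A t"])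
     (use orient_inj[OF assms(2,3)] orient_grid[OF assms] in auto)

section \<open>Symmetries of the grid, and walks of uninfected cells\<close>

lemma grid_sym:
  assumes "inj_on \<sigma> (grid n)" "\<sigma> ` grid n \<subseteq> grid n" "v \<in> grid n"
    "\<And>a b. a \<in> grid n \<Longrightarrow> b \<in> grid n \<Longrightarrow> grid_adj a b \<Longrightarrow> grid_adj (\<sigma> a) (\<sigma> b)"
  shows "pr (grid n) p (\<lambda>A. \<sigma> v \<notin> spread (grid n) A t) \<le> pr (grid n) p (\<lambda>A. v \<notin> spread (grid n) A t)"
proof -
  have "pr (grid n) p (\<lambda>A. \<sigma> v \<notin> spread (grid n) A t)
     \<le> pr (grid n) p (\<lambda>A. v \<notin> spread (grid n) {c \<in> grid n. \<sigma> c \<in> A} t)"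
  proof (rule pr_mono)
    fix A assume A: "A \<subseteq> grid n" "\<sigma> v \<notin> spread (grid n) A t"
    have "\<sigma> ` spread (grid n) {c \<in> grid n. \<sigma> c \<in> A} t \<subseteq> spread (grid n) A t"
      using assms by (intro spread_embed) auto
    thus "v \<notin> spread (grid n) {c \<in> grid n. \<sigma> c \<in> A} t" using A by blast
  qed simp
  also have "\<dots> = pr (grid n) p (\<lambda>A. v \<notin> spread (grid n) A t)"
    by (rule pr_transfer[where P="\<lambda>A. v \<notin> spread (grid n) A t"]) (use assms in auto)
  finally show ?thesis .
qed

lemma grid_sym_swap: 
  assumes "(x, y) \<in> grid n"
  shows "pr (grid n) p (\<lambda>A. (y, x) \<notin> spread (grid n) A t) \<le> pr (grid n) p (\<lambda>A. (x, y) \<notin> spread (grid n) A t)"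
proof -
  have "pr (grid n) p (\<lambda>A. prod.swap (x, y) \<notin> spread (grid n) A t) \<le> pr (grid n) p (\<lambda>A. (x, y) \<notin> spread (grid n) A t)"
    by (rule grid_sym[OF _ _ assms]) (auto simp: grid_def grid_adj_swap)
  thus ?thesis by simp
qed

lemma grid_sym_reflect: 
  assumes "(x, y) \<in> grid n"
  shows "pr (grid n) p (\<lambda>A. (n + 1 - x, y) \<notin> spread (grid n) A t) \<le> pr (grid n) p (\<lambda>A. (x, y) \<notin> spread (grid n) A t)"
proof -
  let ?s = "\<lambda>c::nat \<times> nat. (n + 1 - fst c, snd c)"
  have "pr (grid n) p (\<lambda>A. ?s (x, y) \<notin> spread (grid n) A t) \<le> pr (grid n) p (\<lambda>A. (x, y) \<notin> spread (grid n) A t)"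
  proof (rule grid_sym[OF _ _ assms])
    fix a b assume ab: "a \<in> grid n" "b \<in> grid n" "grid_adj a b"
    hence "\<bar>int (n + 1 - fst a) - int (n + 1 - fst b)\<bar> = \<bar>int (fst a) - int (fst b)\<bar>"
      by (auto simp: grid_def of_nat_diff)
    thus "grid_adj (?s a) (?s b)" using ab(3) by (auto simp: grid_adj_def)
  qed (auto simp: inj_on_def grid_def)
  thus ?thesis by simp
qed

text \<open>Moving away from the first arm gives the second arm a starting cell at distance
  \<open>k\<close>, with only \<open>k + 1\<close> possible positions.\<close>

lemma uninfected_walk:
  assumes "(x, y) \<notin> spread (grid n) A (t + k)" "(x, y) \<in> grid n" "k < x" "k < y"
  shows "\<exists>a\<le>k. (x - a, y - (k - a)) \<notin> spread (grid n) A t"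
  using assms
proof (induction k arbitrary: x y)
  case 0
  thus ?case by simp
next
  case (Suc k)
  have "(x - 1, y) \<notin> spread (grid n) A (t + k) \<or> (x, y - 1) \<notin> spread (grid n) A (t + k)"
    by (rule spread_uninfected_step[where v="(x,y)"])
       (use Suc.prems in \<open>auto simp: grid_adj_def grid_def of_nat_diff\<close>)
  thus ?case
  proof
    assume "(x - 1, y) \<notin> spread (grid n) A (t + k)"
    moreover have "(x - 1, y) \<in> grid n" "k < x - 1" "k < y" using Suc.prems by (auto simp: grid_def)
    ultimately obtain a where a: "a \<le> k" "(x - 1 - a, y - (k - a)) \<notin> spread (grid n) A t"
      using Suc.IH by blast
    thus ?thesis by (intro exI[of _ "Suc a"]) auto
  next
    assume "(x, y - 1) \<notin> spread (grid n) A (t + k)"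
    moreover have "(x, y - 1) \<in> grid n" "k < x" "k < y - 1" using Suc.prems by (auto simp: grid_def)
    ultimately obtain a where a: "a \<le> k" "(x - a, y - 1 - (k - a)) \<notin> spread (grid n) A t"
      using Suc.IH by blast
    moreover have "y - 1 - (k - a) = y - (Suc k - a)" using a(1) by simp
    ultimately show ?thesis by (intro exI[of _ a]) auto
  qed
qed

text \<open>If a cell of the bottom row is uninfected, so was its right or its upper neighbour one
  step earlier. The walk stays in the row, through cells outside \<open>A\<close>, until it moves up
  at \<open>x + k\<close>; there an arm starting in row 2 takes over with the remaining
  time.\<close>

lemma boundary_right_walk:
  assumes x: "1 \<le> x" "x + h \<le> n" "2 \<le> n" and AS: "A \<subseteq> grid n"
    and un: "(x, 1) \<notin> spread (grid n) A (t + h)"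
  shows "m \<le> h \<Longrightarrow> (A \<inter> {x..x + m} \<times> {1} = {} \<and> (x + m, 1) \<notin> spread (grid n) A (t + (h - m))) \<or>
    (\<exists>k<m. A \<inter> {x..x + k} \<times> {1} = {} \<and> (x + k, 2) \<notin> spread (grid n) A (t + (h - k - 1)))"
proof (induction m)
  case 0
  have "A \<subseteq> spread (grid n) A (t + h)" using spread_mono_time[of 0 "t + h" "grid n" A] by simp
  thus ?case using un by auto
next
  case (Suc m)
  show ?case
  proof (cases "A \<inter> {x..x + m} \<times> {1} = {} \<and> (x + m, 1) \<notin> spread (grid n) A (t + (h - m))")
    case False
    thus ?thesis using Suc by (metis Suc_leD less_SucI)
  next
    case True
    have e: "t + (h - m) = Suc (t + (h - m - 1))" using Suc.prems by simp
    have "(x + m, 1) \<notin> spread (grid n) A (Suc (t + (h - m - 1)))" using True unfolding e by simp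
    hence "(x + Suc m, 1) \<notin> spread (grid n) A (t + (h - m - 1)) \<or> (x + m, 2) \<notin> spread (grid n) A (t + (h - m - 1))"
      by (rule spread_uninfected_step) (use Suc.prems x in \<open>auto simp: grid_adj_def grid_def\<close>)
    thus ?thesis
    proof
      assume u: "(x + Suc m, 1) \<notin> spread (grid n) A (t + (h - m - 1))"
      have "A \<subseteq> spread (grid n) A (t + (h - m - 1))" using spread_mono_time[of 0 "t + (h - m - 1)" "grid n" A] by simp
      hence "(x + Suc m, 1) \<notin> A" using u by blast
      moreover have "{x..x + Suc m} = insert (x + Suc m) {x..x + m}" by auto
      ultimately have "A \<inter> {x..x + Suc m} \<times> {1} = {}" using True by auto
      thus ?thesis using u by simp
    next
      assume "(x + m, 2) \<notin> spread (grid n) A (t + (h - m - 1))"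
      thus ?thesis using True by blast
    qed
  qed
qed

text \<open>The walks to both sides are followed simultaneously until the first one leaves the row;
  up to then the vacant interval gains two cells per step.\<close>

lemma boundary_two_walks:
  assumes x: "h < x" "x + h \<le> n" "2 \<le> n" and AS: "A \<subseteq> grid n"
    and un: "(x, 1) \<notin> spread (grid n) A (t + h)"
  shows "m \<le> h \<Longrightarrow> (A \<inter> {x - m..x + m} \<times> {1} = {} \<and> (x + m, 1) \<notin> spread (grid n) A (t + (h - m))
       \<and> (x - m, 1) \<notin> spread (grid n) A (t + (h - m))) \<or>
    (\<exists>k<m. A \<inter> {x - k..x + k} \<times> {1} = {} \<and> 
       ((x + k, 2) \<notin> spread (grid n) A (t + (h - k - 1)) \<or> (x - k, 2) \<notin> spread (grid n) A (t + (h - k - 1))))"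
proof (induction m)
  case 0
  have "A \<subseteq> spread (grid n) A (t + h)" using spread_mono_time[of 0 "t + h" "grid n" A] by simp
  thus ?case using un by auto
next
  case (Suc m)
  show ?case
  proof (cases "A \<inter> {x - m..x + m} \<times> {1} = {} \<and> (x + m, 1) \<notin> spread (grid n) A (t + (h - m)) \<and> (x - m, 1) \<notin> spread (grid n) A (t + (h - m))")
    case False
    thus ?thesis using Suc by (metis Suc_leD less_SucI)
  next
    case True
    let ?I = "spread (grid n) A (t + (h - m - 1))"
    have e: "t + (h - m) = Suc (t + (h - m - 1))" using Suc.prems by simp
    have "(x + m, 1) \<notin> spread (grid n) A (Suc (t + (h - m - 1)))" using True unfolding e by simp
    hence 1: "(x + Suc m, 1) \<notin> ?I \<or> (x + m, 2) \<notin> ?I"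
      by (rule spread_uninfected_step) (use Suc.prems x in \<open>auto simp: grid_adj_def grid_def\<close>)
    have "(x - m, 1) \<notin> spread (grid n) A (Suc (t + (h - m - 1)))" using True unfolding e by simp
    hence 2: "(x - Suc m, 1) \<notin> ?I \<or> (x - m, 2) \<notin> ?I"
      by (rule spread_uninfected_step) (use Suc.prems x in \<open>auto simp: grid_adj_def grid_def\<close>)
    show ?thesis
    proof (cases "(x + Suc m, 1) \<notin> ?I \<and> (x - Suc m, 1) \<notin> ?I")
      case u: True
      have "A \<subseteq> ?I" using spread_mono_time[of 0 "t + (h - m - 1)" "grid n" A] by simp
      hence "(x + Suc m, 1) \<notin> A" "(x - Suc m, 1) \<notin> A" using u by auto
      moreover have "{x - Suc m..x + Suc m} \<subseteq> insert (x - Suc m) (insert (x + Suc m) {x - m..x + m})" by auto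
      ultimately have "A \<inter> {x - Suc m..x + Suc m} \<times> {1} = {}" using True by blast
      thus ?thesis using u by simp
    next
      case False
      hence "(x + m, 2) \<notin> ?I \<or> (x - m, 2) \<notin> ?I" using 1 2 by blast
      thus ?thesis using True by blast
    qed
  qed
qed

section \<open>Failure probability of a cell according to its position\<close>

context
  fixes n N r T :: nat and p H c :: real
  assumes p: "0 < p" "p < 1" and N: "1 \<le> N" and n: "2 * N + 2 * r + 20 \<le> n"
    and H: "1 \<le> H" and c: "1 \<le> c" "c \<le> 2"
    and arm: "\<And>k. k \<le> r \<Longrightarrow> pr (patch N) p (\<lambda>A. (1, 1) \<notin> spread (patch N) A (T + k)) \<le> H * (1 - p) powr (c * real k)"
begin

abbreviation "uninf v t \<equiv> pr (grid n) p (\<lambda>A. v \<notin> spread (grid n) A t)"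

lemma uninf_antimono: "t \<le> t' \<Longrightarrow> uninf v t' \<le> uninf v t"
  by (rule pr_mono) (use spread_mono_time[of t t' "grid n"] in auto)

lemma arm_and_local:
  assumes fit: "fits n N s x" "fits n N u y" and k: "k \<le> r"
    and Z: "Z \<subseteq> grid n" "Z \<inter> orient s u x y ` patch N = {}" and F: "\<And>A. F A \<longleftrightarrow> F (A \<inter> Z)"
  shows "pr (grid n) p (\<lambda>A. (x, y) \<notin> spread (grid n) A (T + k) \<and> F A) \<le> H * (1 - p) powr (c * real k) * pr (grid n) p F"
proof -
  let ?e = "orient s u x y"
  have "pr (grid n) p (\<lambda>A. (x, y) \<notin> spread (grid n) A (T + k) \<and> F A) \<le> pr (grid n) p (\<lambda>A. arm_event N (T + k) ?e A \<and> F A)"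
    by (rule pr_mono) (use uninfected_arm_event[OF N fit] in auto)
  also have "\<dots> = pr (grid n) p (arm_event N (T + k) ?e) * pr (grid n) p F"
  proof (rule pr_indep[where S="?e ` patch N" and T=Z])
    show "?e ` patch N \<subseteq> grid n" by (rule orient_grid[OF N fit])
    show "arm_event N (T + k) ?e A \<longleftrightarrow> arm_event N (T + k) ?e (A \<inter> ?e ` patch N)" for A by (rule arm_event_local)
    show "F A \<longleftrightarrow> F (A \<inter> Z)" for A by (rule F)
  qed (use Z in auto)
  also have "\<dots> \<le> H * (1 - p) powr (c * real k) * pr (grid n) p F"
    unfolding pr_arm_event[OF N fit] by (intro mult_right_mono arm k pr_nonneg)
  finally show ?thesis .
qed

text \<open>The patch of an arm starting in row 2 also covers part of row 1. Only the part
  \<open>Z\<close> of the vacant interval that avoids the patch is independent of the arm.\<close>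

lemma uninf_and_vacant:
  assumes fit: "fits n N s x" and k: "k \<le> r" and Z: "Z \<subseteq> grid n" "Z \<subseteq> Z'"
    and disj: "Z \<inter> orient s True x 2 ` patch N = {}"
  shows "pr (grid n) p (\<lambda>A. A \<inter> Z' = {} \<and> (x, 2) \<notin> spread (grid n) A (T + k))
    \<le> H * (1 - p) powr (c * real k) * (1 - p) ^ card Z"
proof -
  have fit2: "fits n N True 2" using n by (auto simp: fits_def)
  have "pr (grid n) p (\<lambda>A. A \<inter> Z' = {} \<and> (x, 2) \<notin> spread (grid n) A (T + k))
     \<le> pr (grid n) p (\<lambda>A. (x, 2) \<notin> spread (grid n) A (T + k) \<and> A \<inter> Z = {})"
    by (rule pr_mono) (use Z in auto)
  also have "\<dots> \<le> H * (1 - p) powr (c * real k) * pr (grid n) p (\<lambda>A. A \<inter> Z = {})"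
    by (rule arm_and_local[OF fit fit2 k Z(1) disj]) (auto simp: Int_assoc)
  also have "pr (grid n) p (\<lambda>A. A \<inter> Z = {}) = (1 - p) ^ card Z"
    using p Z by (intro pr_empty) auto
  finally show ?thesis .
qed

lemma uninf_interior:
  assumes "2 \<le> x" "x + 1 \<le> n" "2 \<le> y" "y + 1 \<le> n"
  shows "uninf (x, y) (T + r) \<le> H * (1 - p) powr (c * real r)"
proof -
  have fit: "\<exists>s. fits n N s z" if "2 \<le> z" "z + 1 \<le> n" for z
  proof (cases "z + N \<le> n + 1")
    case True
    thus ?thesis using that by (intro exI[of _ True]) (auto simp: fits_def)
  next
    case False
    thus ?thesis using that n by (intro exI[of _ False]) (auto simp: fits_def)
  qed
  obtain s u where "fits n N s x" "fits n N u y" using fit assms by blast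
  from arm_and_local[OF this, of r "{}" "\<lambda>_. True"] show ?thesis by (simp add: pr_True)
qed

text \<open>Two arms into opposite quadrants. Each patch reaches one line behind its cell, so the
  patches are disjoint once one coordinate differs by at least 3; of \<open>a\<close> and
  \<open>5 - a\<close> one always is that large. The factor 6 counts the values of
  \<open>a\<close>.\<close>

lemma uninf_deep:
  assumes x: "N + 5 \<le> x" "x + N + 5 \<le> n" and y: "N + 5 \<le> y" "y + N + 5 \<le> n"
  shows "uninf (x, y) (T + r + 5) \<le> 6 * (H * (1 - p) powr (c * real r))\<^sup>2"
proof -
  let ?\<alpha> = "H * (1 - p) powr (c * real r)"
  let ?w = "\<lambda>a. (x - a, y - (5 - a))"
  have "uninf (x, y) (T + r + 5) \<le> (\<Sum>a\<in>{..5}. pr (grid n) p (\<lambda>A. (x, y) \<notin> spread (grid n) A (T + r) \<and> ?w a \<notin> spread (grid n) A (T + r)))"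
  proof (rule pr_union)
    fix A assume "A \<subseteq> grid n" and un: "(x, y) \<notin> spread (grid n) A (T + r + 5)"
    have 1: "(x, y) \<notin> spread (grid n) A (T + r)" using un spread_mono_time[of "T + r" "T + r + 5" "grid n" A] by auto
    obtain a where "a \<le> 5" "?w a \<notin> spread (grid n) A (T + r)"
      using uninfected_walk[OF un] x y N by (auto simp: grid_def)
    thus "\<exists>a\<in>{..5}. (x, y) \<notin> spread (grid n) A (T + r) \<and> ?w a \<notin> spread (grid n) A (T + r)" using 1 by blast
  qed auto
  also have "\<dots> \<le> (\<Sum>a\<in>{..5::nat}. ?\<alpha>\<^sup>2)"
  proof (rule sum_mono)
    fix a :: nat assume a: "a \<in> {..5}"
    let ?e = "orient False False (x - a) (y - (5 - a))"
    have f1: "fits n N True x" "fits n N True y" using x y N by (auto simp: fits_def)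
    have f2: "fits n N False (x - a)" "fits n N False (y - (5 - a))" using x y N a by (auto simp: fits_def)
    have "pr (grid n) p (\<lambda>A. (x, y) \<notin> spread (grid n) A (T + r) \<and> ?w a \<notin> spread (grid n) A (T + r))
       \<le> pr (grid n) p (\<lambda>A. (x, y) \<notin> spread (grid n) A (T + r) \<and> arm_event N (T + r) ?e A)"
      by (rule pr_mono) (use uninfected_arm_event[OF N f2] in auto)
    also have "\<dots> \<le> ?\<alpha> * pr (grid n) p (arm_event N (T + r) ?e)"
    proof (rule arm_and_local[OF f1])
      show "?e ` patch N \<inter> orient True True x y ` patch N = {}"
        using a x y by (auto simp: orient_def)
      show "arm_event N (T + r) ?e A \<longleftrightarrow> arm_event N (T + r) ?e (A \<inter> ?e ` patch N)" for A by (rule arm_event_local)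
    qed (use orient_grid[OF N f2] in auto)
    also have "pr (grid n) p (arm_event N (T + r) ?e) \<le> ?\<alpha>"
      unfolding pr_arm_event[OF N f2] by (rule arm) simp
    finally show "pr (grid n) p (\<lambda>A. (x, y) \<notin> spread (grid n) A (T + r) \<and> ?w a \<notin> spread (grid n) A (T + r)) \<le> ?\<alpha>\<^sup>2"
      using H by (simp add: power2_eq_square mult_left_mono)
  qed
  finally show ?thesis by simp
qed

text \<open>For a cell of the bottom row, the walks to the left and to the right inside this row are followed
  until the first of them leaves it: up to then each step costs one vacant cell on either side, and the
  arm above the row costs two vacant cells per step from then on.\<close>

lemma uninf_side:
  assumes x: "N + r + 5 \<le> x" "x + N + r + 5 \<le> n"
  shows "uninf (x, 1) (T + r + 1) \<le> (2 * real r + 3) * (H / (1 - p) * (1 - p) powr (c * real r))"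
proof -
  let ?q = "1 - p"
  let ?b = "H / ?q * ?q powr (c * real r)"
  have q: "0 < ?q" "?q < 1" using p by auto
  let ?E = "\<lambda>k A. A \<inter> {x - k..x + k} \<times> {1} = {} \<and> (x + k, 2) \<notin> spread (grid n) A (T + (r - k))"
  let ?F = "\<lambda>k A. A \<inter> {x - k..x + k} \<times> {1} = {} \<and> (x - k, 2) \<notin> spread (grid n) A (T + (r - k))"
  \<comment> \<open>As \<open>c \<le> 2\<close>, two vacant cells per step cost at least as much as
    a step of the arm. The one missing cell produces the factor \<open>1 / (1 - p)\<close>.\<close>
  have bound: "H * ?q powr (c * real (r - k)) * ?q ^ (2 * k - 1) \<le> ?b" if "k \<le> r" for k
  proof -
    have "?q ^ (2 * k - 1) \<le> ?q powr (2 * real k - 1)"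
    proof (cases "k = 0")
      case True
      thus ?thesis using q by (simp add: powr_minus_divide)
    next
      case False
      hence "real (2 * k - 1) = 2 * real k - 1" by (simp add: of_nat_diff)
      thus ?thesis using q by (simp add: powr_realpow[symmetric])
    qed
    hence "H * ?q powr (c * real (r - k)) * ?q ^ (2 * k - 1) \<le> H * ?q powr (c * real (r - k)) * ?q powr (2 * real k - 1)"
      using H by (intro mult_left_mono) auto
    also have "\<dots> = H * ?q powr (c * real (r - k) + (2 * real k - 1))" by (simp add: powr_add mult.assoc)
    also have "\<dots> \<le> H * ?q powr (c * real r - 1)"
    proof -
      have "c * real k \<le> 2 * real k" using c by (intro mult_right_mono) auto
      hence "c * real r - 1 \<le> c * real (r - k) + (2 * real k - 1)" using that by (simp add: of_nat_diff algebra_simps)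
      thus ?thesis using q H by (intro mult_left_mono powr_mono') auto
    qed
    also have "\<dots> = ?b" using q by (simp add: powr_diff)
    finally show ?thesis .
  qed
  have 1: "pr (grid n) p (?E k) \<le> ?b" if k: "k \<le> r" for k
  proof -
    \<comment> \<open>Columns \<open>x + k - 1\<close> and \<open>x + k\<close> are omitted because
      the patch of the arm covers them.\<close>
    let ?Z = "{x - k..<x + k - 1} \<times> {1::nat}"
    have "pr (grid n) p (?E k) \<le> H * ?q powr (c * real (r - k)) * ?q ^ card ?Z"
    proof (rule uninf_and_vacant[where s=True])
      show "?Z \<inter> orient True True (x + k) 2 ` patch N = {}" by (auto simp: orient_def)
      show "?Z \<subseteq> grid n" using x k by (auto simp: grid_def)
    qed (use x k in \<open>auto simp: fits_def\<close>)
    also have "card ?Z = 2 * k - 1" using x k by (simp add: card_cartesian_product)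
    also have "H * ?q powr (c * real (r - k)) * ?q ^ (2 * k - 1) \<le> ?b" by (rule bound[OF k])
    finally show ?thesis .
  qed
  have 2: "pr (grid n) p (?F k) \<le> ?b" if k: "k \<le> r" for k
  proof -
    let ?Z = "{x - k + 1<..x + k} \<times> {1::nat}"
    have "pr (grid n) p (?F k) \<le> H * ?q powr (c * real (r - k)) * ?q ^ card ?Z"
    proof (rule uninf_and_vacant[where s=False])
      show "?Z \<inter> orient False True (x - k) 2 ` patch N = {}" by (auto simp: orient_def)
      show "?Z \<subseteq> grid n" using x k by (auto simp: grid_def)
    qed (use x k in \<open>auto simp: fits_def\<close>)
    also have "card ?Z = 2 * k - 1" using x k by (simp add: card_cartesian_product)
    also have "H * ?q powr (c * real (r - k)) * ?q ^ (2 * k - 1) \<le> ?b" by (rule bound[OF k])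
    finally show ?thesis .
  qed
  let ?G = "\<lambda>A. A \<inter> {x - (r + 1)..x + (r + 1)} \<times> {1} = {}"
  have 3: "pr (grid n) p ?G \<le> ?b"
  proof -
    have Z: "{x - (r + 1)..x + (r + 1)} \<times> {1} \<subseteq> grid n" using x by (auto simp: grid_def)
    have "pr (grid n) p ?G = ?q ^ (2 * r + 3)"
      using pr_empty[OF finite_grid Z, of p] p x by (simp add: card_cartesian_product)
    also have "\<dots> \<le> ?q powr (c * real r - 1)"
    proof -
      have "c * real r \<le> 2 * real r" using c by (intro mult_right_mono) auto
      thus ?thesis using q by (subst powr_realpow[symmetric]) (auto intro!: powr_mono')
    qed
    also have "\<dots> \<le> H * ?q powr (c * real r - 1)"
      using mult_right_mono[OF H, of "?q powr (c * real r - 1)"] by simp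
    also have "\<dots> = ?b" using q by (simp add: powr_diff)
    finally show ?thesis .
  qed
  have "uninf (x, 1) (T + r + 1) \<le> pr (grid n) p (\<lambda>A. ?G A \<or> (\<exists>k\<in>{..r}. ?E k A \<or> ?F k A))"
  proof (rule pr_mono)
    fix A assume A: "A \<subseteq> grid n" and un: "(x, 1) \<notin> spread (grid n) A (T + r + 1)"
    have "(x, 1) \<notin> spread (grid n) A (T + (r + 1))" using un by (simp add: add.assoc)
    from boundary_two_walks[OF _ _ _ A this, of "r + 1"] x n
    show "?G A \<or> (\<exists>k\<in>{..r}. ?E k A \<or> ?F k A)" by (auto simp: less_Suc_eq_le)
  qed simp
  also have "\<dots> \<le> pr (grid n) p ?G + pr (grid n) p (\<lambda>A. \<exists>k\<in>{..r}. ?E k A \<or> ?F k A)" by (rule pr_or)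
  also have "pr (grid n) p (\<lambda>A. \<exists>k\<in>{..r}. ?E k A \<or> ?F k A) \<le> (\<Sum>k\<in>{..r}. pr (grid n) p (\<lambda>A. ?E k A \<or> ?F k A))"
    by (rule pr_union) auto
  also have "\<dots> \<le> (\<Sum>k\<in>{..r}. 2 * ?b)"
  proof (rule sum_mono)
    fix k assume k: "k \<in> {..r}"
    have "pr (grid n) p (\<lambda>A. ?E k A \<or> ?F k A) \<le> pr (grid n) p (?E k) + pr (grid n) p (?F k)" by (rule pr_or)
    thus "pr (grid n) p (\<lambda>A. ?E k A \<or> ?F k A) \<le> 2 * ?b" using 1[of k] 2[of k] k by simp
  qed
  also have "\<dots> = (real r + 1) * (2 * ?b)" by simp
  also have "pr (grid n) p ?G + (real r + 1) * (2 * ?b) \<le> ?b + (real r + 1) * (2 * ?b)" using 3 by (rule add_right_mono)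
  also have "\<dots> = (2 * real r + 3) * ?b"
  proof -
    have "b + (a + 1) * (2 * b) = (2 * a + 3) * b" for a b :: real by (simp add: algebra_simps)
    thus ?thesis .
  qed
  finally show ?thesis by simp
qed

text \<open>There may be room for one walk only, hence one vacant cell per step and merely the
  exponent \<open>r\<close>. Few cells are concerned, so this suffices.\<close>

lemma uninf_near_corner:
  assumes x: "2 \<le> x" "x + N + r + 5 \<le> n"
  shows "uninf (x, 1) (T + r + 1) \<le> (real r + 2) * (H / (1 - p) * (1 - p) powr real r)"
proof -
  let ?q = "1 - p"
  let ?b = "H / ?q * ?q powr real r"
  have q: "0 < ?q" "?q < 1" using p by auto
  let ?E = "\<lambda>k A. A \<inter> {x..x + k} \<times> {1} = {} \<and> (x + k, 2) \<notin> spread (grid n) A (T + (r - k))"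
  have 1: "pr (grid n) p (?E k) \<le> ?b" if k: "k \<le> r" for k
  proof -
    let ?Z = "{x..<x + k - 1} \<times> {1::nat}"
    have "pr (grid n) p (?E k) \<le> H * ?q powr (c * real (r - k)) * ?q ^ card ?Z"
    proof (rule uninf_and_vacant[where s=True])
      show "?Z \<inter> orient True True (x + k) 2 ` patch N = {}" by (auto simp: orient_def)
      show "?Z \<subseteq> grid n" using x k by (auto simp: grid_def)
    qed (use x k in \<open>auto simp: fits_def\<close>)
    also have "card ?Z = k - 1" using x k by (simp add: card_cartesian_product)
    also have "?q ^ (k - 1) \<le> ?q powr (real k - 1)"
    proof (cases "k = 0")
      case True
      thus ?thesis using q by (simp add: powr_minus_divide)
    next
      case False
      hence "real (k - 1) = real k - 1" by (simp add: of_nat_diff)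
      thus ?thesis using q by (simp add: powr_realpow[symmetric])
    qed
    finally have "pr (grid n) p (?E k) \<le> H * ?q powr (c * real (r - k)) * ?q powr (real k - 1)"
      using H by (simp add: mult_left_mono)
    also have "\<dots> = H * ?q powr (c * real (r - k) + (real k - 1))" by (simp add: powr_add mult.assoc)
    also have "\<dots> \<le> H * ?q powr (real r - 1)"
    proof -
      have "1 * real (r - k) \<le> c * real (r - k)" using c by (intro mult_right_mono) auto
      hence "real r - 1 \<le> c * real (r - k) + (real k - 1)" using k by (simp add: of_nat_diff)
      thus ?thesis using q H by (intro mult_left_mono powr_mono') auto
    qed
    also have "\<dots> = ?b" using q by (simp add: powr_diff)
    finally show ?thesis .
  qed
  let ?G = "\<lambda>A. A \<inter> {x..x + (r + 1)} \<times> {1} = {}"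
  have 3: "pr (grid n) p ?G \<le> ?b"
  proof -
    have Z: "{x..x + (r + 1)} \<times> {1} \<subseteq> grid n" using x n by (auto simp: grid_def)
    have "pr (grid n) p ?G = ?q ^ (r + 2)"
      using pr_empty[OF finite_grid Z, of p] p x by (simp add: card_cartesian_product)
    also have "\<dots> \<le> ?q powr (real r - 1)"
      using q by (subst powr_realpow[symmetric]) (auto intro!: powr_mono')
    also have "\<dots> \<le> H * ?q powr (real r - 1)"
      using mult_right_mono[OF H, of "?q powr (real r - 1)"] by simp
    also have "\<dots> = ?b" using q by (simp add: powr_diff)
    finally show ?thesis .
  qed
  have "uninf (x, 1) (T + r + 1) \<le> pr (grid n) p (\<lambda>A. ?G A \<or> (\<exists>k\<in>{..r}. ?E k A))"
  proof (rule pr_mono)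
    fix A assume A: "A \<subseteq> grid n" and un: "(x, 1) \<notin> spread (grid n) A (T + r + 1)"
    have "(x, 1) \<notin> spread (grid n) A (T + (r + 1))" using un by (simp add: add.assoc)
    from boundary_right_walk[OF _ _ _ A this, of "r + 1"] x n
    show "?G A \<or> (\<exists>k\<in>{..r}. ?E k A)" by (auto simp: less_Suc_eq_le)
  qed simp
  also have "\<dots> \<le> pr (grid n) p ?G + pr (grid n) p (\<lambda>A. \<exists>k\<in>{..r}. ?E k A)" by (rule pr_or)
  also have "pr (grid n) p (\<lambda>A. \<exists>k\<in>{..r}. ?E k A) \<le> (\<Sum>k\<in>{..r}. pr (grid n) p (?E k))"
    by (rule pr_union) auto
  also have "\<dots> \<le> (\<Sum>k\<in>{..r}. ?b)" using 1 by (intro sum_mono) auto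
  also have "\<dots> = (real r + 1) * ?b" by simp
  also have "pr (grid n) p ?G + (real r + 1) * ?b \<le> ?b + (real r + 1) * ?b" using 3 by (rule add_right_mono)
  also have "\<dots> = (real r + 2) * ?b"
  proof -
    have "b + (a + 1) * b = (a + 2) * b" for a b :: real by (simp add: algebra_simps)
    thus ?thesis .
  qed
  finally show ?thesis by simp
qed

lemma uninf_corner:
  "uninf (1, 1) (T + r + 2) \<le> 2 * ((real r + 2) * (H / (1 - p) * (1 - p) powr real r))"
proof -
  have "uninf (1, 1) (T + r + 2) \<le> pr (grid n) p (\<lambda>A. (2, 1) \<notin> spread (grid n) A (T + r + 1) \<or> (1, 2) \<notin> spread (grid n) A (T + r + 1))"
  proof (rule pr_mono)
    fix A assume "(1, 1) \<notin> spread (grid n) A (T + r + 2)"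
    hence "(1, 1) \<notin> spread (grid n) A (Suc (T + r + 1))" by simp
    thus "(2, 1) \<notin> spread (grid n) A (T + r + 1) \<or> (1, 2) \<notin> spread (grid n) A (T + r + 1)"
      by (rule spread_uninfected_step) (use n in \<open>auto simp: grid_def grid_adj_def\<close>)
  qed simp
  also have "\<dots> \<le> uninf (2, 1) (T + r + 1) + uninf (1, 2) (T + r + 1)" by (rule pr_or)
  also have "uninf (1, 2) (T + r + 1) \<le> uninf (2, 1) (T + r + 1)"
    by (rule grid_sym_swap) (use n in \<open>auto simp: grid_def\<close>)
  finally show ?thesis using uninf_near_corner[of 2] n by simp
qed

lemma uninf_boundary:
  assumes x: "1 \<le> x" "x \<le> n"
  shows "uninf (x, 1) (T + r + 5) \<le> 
    (if N + r + 5 \<le> x \<and> x + N + r + 5 \<le> n then (2 * real r + 3) * (H / (1 - p) * (1 - p) powr (c * real r))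
     else 2 * ((real r + 2) * (H / (1 - p) * (1 - p) powr real r)))"
proof -
  let ?b = "(real r + 2) * (H / (1 - p) * (1 - p) powr real r)"
  have b0: "0 \<le> ?b" using p H by (intro mult_nonneg_nonneg divide_nonneg_nonneg) auto
  have near: "uninf (x, 1) (T + r + 5) \<le> 2 * ?b" if "1 \<le> x" "x + N + r + 5 \<le> n" for x
  proof (cases "x = 1")
    case True
    have "uninf (x, 1) (T + r + 5) \<le> uninf (1, 1) (T + r + 2)"
      unfolding True by (rule uninf_antimono) simp
    thus ?thesis using uninf_corner by (rule order_trans)
  next
    case False
    have "uninf (x, 1) (T + r + 5) \<le> uninf (x, 1) (T + r + 1)" by (rule uninf_antimono) simp
    also have "\<dots> \<le> ?b" using that False by (intro uninf_near_corner) auto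
    also have "?b \<le> 2 * ?b"
    proof -
      have "z \<le> 2 * z" if "0 \<le> z" for z :: real using that by simp
      from this[OF b0] show ?thesis .
    qed
    finally show ?thesis .
  qed
  show ?thesis
  proof (cases "N + r + 5 \<le> x \<and> x + N + r + 5 \<le> n")
    case True
    have "uninf (x, 1) (T + r + 5) \<le> uninf (x, 1) (T + r + 1)" by (rule uninf_antimono) simp
    also have "\<dots> \<le> (2 * real r + 3) * (H / (1 - p) * (1 - p) powr (c * real r))" using True by (intro uninf_side) auto
    finally show ?thesis unfolding if_P[OF True] .
  next
    case out: False
    show ?thesis
    proof (cases "x + N + r + 5 \<le> n")
      case True
      show ?thesis using near[OF x(1) True] unfolding if_not_P[OF out] .
    next
      case False
      define x' where "x' = n + 1 - x"
      have x': "1 \<le> x'" "x' + N + r + 5 \<le> n" "x = n + 1 - x'" using False x n by (auto simp: x'_def)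
      have "uninf (n + 1 - x', 1) (T + r + 5) \<le> uninf (x', 1) (T + r + 5)"
        by (rule grid_sym_reflect) (use x' n in \<open>auto simp: grid_def\<close>)
      also have "\<dots> \<le> 2 * ?b" by (rule near[OF x'(1,2)])
      finally show ?thesis unfolding x'(3)[symmetric] if_not_P[OF out] .
    qed
  qed
qed

definition "is_mid z \<longleftrightarrow> N + r + 5 \<le> z \<and> z + N + r + 5 \<le> n"
definition "is_inner z \<longleftrightarrow> N + 5 \<le> z \<and> z + N + 5 \<le> n"
definition "is_outer z \<longleftrightarrow> z = 1 \<or> z = n"

text \<open>One of the four bounds always applies. Writing them as a sum with indicators reduces the
  sum over the grid to counting cells.\<close>

lemma uninf_cell:
  assumes v: "(x, y) \<in> grid n"
  shows "uninf (x, y) (T + r + 5) \<le> 6 * (H * (1 - p) powr (c * real r))\<^sup>2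
    + of_bool (\<not> is_inner x \<or> \<not> is_inner y) * (H * (1 - p) powr (c * real r))
    + of_bool (is_outer x \<or> is_outer y) * ((2 * real r + 3) * (H / (1 - p) * (1 - p) powr (c * real r)))
    + of_bool (\<not> is_mid x \<and> \<not> is_mid y) * (2 * ((real r + 2) * (H / (1 - p) * (1 - p) powr real r)))"
  (is "_ \<le> ?a + _ * ?b + _ * ?c + _ * ?d")
proof -
  have nn: "0 \<le> ?a" "0 \<le> ?b" "0 \<le> ?c" "0 \<le> ?d"
    using p H by (auto intro!: mult_nonneg_nonneg divide_nonneg_nonneg)
  have fin: "u \<le> a + of_bool P * b + of_bool Q * c + of_bool R * d"
    if "0 \<le> a" "0 \<le> b" "0 \<le> c" "0 \<le> d" "u \<le> a \<or> P \<and> u \<le> b \<or> Q \<and> u \<le> c \<or> R \<and> u \<le> d"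
    for a b c d u :: real and P Q R
    using that by (cases P; cases Q; cases R; auto)
  have xy: "1 \<le> x" "x \<le> n" "1 \<le> y" "y \<le> n" using v by (auto simp: grid_def)
  show ?thesis
  proof (cases "is_outer x \<or> is_outer y")
    case True
    have reflect: "uninf (x, y) t \<le> uninf (n + 1 - x, y) t" if "1 \<le> x" "x \<le> n" "1 \<le> y" "y \<le> n" for x y t
    proof -
      have e: "n + 1 - (n + 1 - x) = x" using that by simp
      have "(n + 1 - x, y) \<in> grid n" using that by (auto simp: grid_def)
      from grid_sym_reflect[OF this, of p t] show ?thesis unfolding e .
    qed
    have swap: "uninf (x, y) t \<le> uninf (y, x) t" if "1 \<le> x" "x \<le> n" "1 \<le> y" "y \<le> n" for x y t
      by (rule grid_sym_swap) (use that in \<open>auto simp: grid_def\<close>)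
    have one: "uninf (z, w) t \<le> uninf (z, 1) t" if "is_outer w" "1 \<le> z" "z \<le> n" for z w t
    proof (cases "w = 1")
      case False
      hence w: "w = n" using that by (simp add: is_outer_def)
      have "uninf (z, n) t \<le> uninf (n, z) t" using that n by (intro swap) auto
      also have "\<dots> \<le> uninf (n + 1 - n, z) t" using that n by (intro reflect) auto
      also have "\<dots> \<le> uninf (z, n + 1 - n) t" using that n by (intro swap) auto
      finally show ?thesis using w by simp
    qed simp
    have "uninf (x, y) (T + r + 5) \<le> (if is_mid x then ?c else ?d)" if "is_outer y"
      using one[OF that xy(1,2), of "T + r + 5"] uninf_boundary[OF xy(1,2)] unfolding is_mid_def by linarith
    moreover have "uninf (x, y) (T + r + 5) \<le> (if is_mid y then ?c else ?d)" if "is_outer x"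
      using swap[OF xy, of "T + r + 5"] one[OF that xy(3,4), of "T + r + 5"] uninf_boundary[OF xy(3,4)] 
      unfolding is_mid_def by linarith
    moreover have "\<not> is_mid z" if "is_outer z" for z using that n by (auto simp: is_outer_def is_mid_def)
    ultimately have "uninf (x, y) (T + r + 5) \<le> ?c \<or> (\<not> is_mid x \<and> \<not> is_mid y) \<and> uninf (x, y) (T + r + 5) \<le> ?d"
      using True by (auto split: if_splits)
    thus ?thesis using True by (intro fin[OF nn]) blast
  next
    case False
    hence int: "2 \<le> x" "x + 1 \<le> n" "2 \<le> y" "y + 1 \<le> n" using xy by (auto simp: is_outer_def)
    show ?thesis
    proof (cases "is_inner x \<and> is_inner y")
      case True
      hence "uninf (x, y) (T + r + 5) \<le> ?a" by (intro uninf_deep) (auto simp: is_inner_def)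
      thus ?thesis by (intro fin[OF nn]) blast
    next
      case out: False
      have "uninf (x, y) (T + r + 5) \<le> uninf (x, y) (T + r)" by (rule uninf_antimono) simp
      also have "\<dots> \<le> ?b" by (rule uninf_interior[OF int])
      finally have "uninf (x, y) (T + r + 5) \<le> ?b" .
      thus ?thesis using out by (intro fin[OF nn]) blast
    qed
  qed
qed

text \<open>The exponent is \<open>2 * c * r\<close> for up to \<open>n\<^sup>2\<close> cells,
  \<open>c * r\<close> for the cells near a side, and \<open>r\<close> for the corner regions, whose
  size does not depend on \<open>n\<close>.\<close>

lemma not_all_infected:
  "pr (grid n) p (\<lambda>A. spread (grid n) A (T + r + 5) \<noteq> grid n) \<le>
     (real n)\<^sup>2 * (6 * (H * (1 - p) powr (c * real r))\<^sup>2)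
   + real (4 * n * (N + 5)) * (H * (1 - p) powr (c * real r))
   + real (4 * n) * ((2 * real r + 3) * (H / (1 - p) * (1 - p) powr (c * real r)))
   + real ((2 * (N + r + 5))\<^sup>2) * (2 * ((real r + 2) * (H / (1 - p) * (1 - p) powr real r)))"
  (is "_ \<le> _ * ?a + _ * ?b + _ * ?c + _ * ?d")
proof -
  have nn: "0 \<le> ?a" "0 \<le> ?b" "0 \<le> ?c" "0 \<le> ?d"
    using p H by (auto intro!: mult_nonneg_nonneg divide_nonneg_nonneg)
  have "pr (grid n) p (\<lambda>A. spread (grid n) A (T + r + 5) \<noteq> grid n) \<le> (\<Sum>v\<in>grid n. uninf v (T + r + 5))"
  proof (rule pr_union)
    fix A assume "A \<subseteq> grid n" "spread (grid n) A (T + r + 5) \<noteq> grid n"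
    thus "\<exists>v\<in>grid n. v \<notin> spread (grid n) A (T + r + 5)" using spread_subset[of A "grid n"] by blast
  qed auto
  also have "\<dots> \<le> (\<Sum>v\<in>grid n. ?a + of_bool (\<not> is_inner (fst v) \<or> \<not> is_inner (snd v)) * ?b
      + of_bool (is_outer (fst v) \<or> is_outer (snd v)) * ?c + of_bool (\<not> is_mid (fst v) \<and> \<not> is_mid (snd v)) * ?d)"
  proof (rule sum_mono)
    fix v assume "v \<in> grid n"
    thus "uninf v (T + r + 5) \<le> ?a + of_bool (\<not> is_inner (fst v) \<or> \<not> is_inner (snd v)) * ?b
      + of_bool (is_outer (fst v) \<or> is_outer (snd v)) * ?c + of_bool (\<not> is_mid (fst v) \<and> \<not> is_mid (snd v)) * ?d"
      using uninf_cell[of "fst v" "snd v"] by simp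
  qed
  also have "\<dots> = real (card (grid n)) * ?a
      + real (card {v \<in> grid n. \<not> is_inner (fst v) \<or> \<not> is_inner (snd v)}) * ?b
      + real (card {v \<in> grid n. is_outer (fst v) \<or> is_outer (snd v)}) * ?c
      + real (card {v \<in> grid n. \<not> is_mid (fst v) \<and> \<not> is_mid (snd v)}) * ?d"
  proof -
    have "(\<Sum>v\<in>S. a + of_bool (P v) * b + of_bool (Q v) * c + of_bool (R v) * d)
       = real (card S) * a + real (card {v \<in> S. P v}) * b + real (card {v \<in> S. Q v}) * c + real (card {v \<in> S. R v}) * d"
      if "finite S" for S :: "(nat \<times> nat) set" and P Q R and a b c d :: real
    proof -
      have "{v \<in> S. P v} = S \<inter> {v. P v}" for P by auto
      thus ?thesis using that
        by (simp add: sum.distrib sum_distrib_right[symmetric] sum_of_bool_eq)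
    qed
    from this[OF finite_grid] show ?thesis .
  qed
  also have "\<dots> \<le> (real n)\<^sup>2 * ?a + real (4 * n * (N + 5)) * ?b + real (4 * n) * ?c + real ((2 * (N + r + 5))\<^sup>2) * ?d"
  proof -
    have g: "card (grid n) = n\<^sup>2" by (simp add: grid_def power2_eq_square)
    have out: "card {z \<in> {1..n}. \<not> (K + 5 \<le> z \<and> z + K + 5 \<le> n)} \<le> 2 * (K + 5)" for K
    proof -
      have "{z \<in> {1..n}. \<not> (K + 5 \<le> z \<and> z + K + 5 \<le> n)} \<subseteq> {1..<K + 5} \<union> {n - (K + 4)..n}" by auto
      hence "card {z \<in> {1..n}. \<not> (K + 5 \<le> z \<and> z + K + 5 \<le> n)} \<le> card ({1..<K + 5} \<union> {n - (K + 4)..n})"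
        by (intro card_mono) auto
      also have "\<dots> \<le> card {1..<K + 5} + card {n - (K + 4)..n}" by (rule card_Un_le)
      also have "\<dots> \<le> 2 * (K + 5)" by simp
      finally show ?thesis .
    qed
    have two: "card {v \<in> grid n. P (fst v) \<or> P (snd v)} \<le> 2 * n * card {z \<in> {1..n}. P z}" for P
    proof -
      have "{v \<in> grid n. P (fst v) \<or> P (snd v)} \<subseteq> {z \<in> {1..n}. P z} \<times> {1..n} \<union> {1..n} \<times> {z \<in> {1..n}. P z}"
        by (auto simp: grid_def)
      hence "card {v \<in> grid n. P (fst v) \<or> P (snd v)} \<le> card ({z \<in> {1..n}. P z} \<times> {1..n} \<union> {1..n} \<times> {z \<in> {1..n}. P z})"
        by (intro card_mono) auto
      also have "\<dots> \<le> card ({z \<in> {1..n}. P z} \<times> {1..n}) + card ({1..n} \<times> {z \<in> {1..n}. P z})" by (rule card_Un_le)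
      also have "\<dots> = 2 * n * card {z \<in> {1..n}. P z}" by (simp add: card_cartesian_product)
      finally show ?thesis .
    qed
    have "card {v \<in> grid n. \<not> is_inner (fst v) \<or> \<not> is_inner (snd v)} \<le> 2 * n * (2 * (N + 5))"
      using two[of "\<lambda>z. \<not> is_inner z"] out[of N] unfolding is_inner_def by (meson le_trans mult_le_mono2)
    also have "\<dots> = 4 * n * (N + 5)" by (simp add: algebra_simps)
    finally have i: "card {v \<in> grid n. \<not> is_inner (fst v) \<or> \<not> is_inner (snd v)} \<le> 4 * n * (N + 5)" .
    have "card {z \<in> {1..n}. is_outer z} \<le> card {1, n}" by (intro card_mono) (auto simp: is_outer_def)
    also have "\<dots> \<le> 2" by (simp add: card_insert_if)
    finally have "card {v \<in> grid n. is_outer (fst v) \<or> is_outer (snd v)} \<le> 2 * n * 2"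
      using two[of is_outer] by (meson le_trans mult_le_mono2)
    hence o: "card {v \<in> grid n. is_outer (fst v) \<or> is_outer (snd v)} \<le> 4 * n" by simp
    have "{v \<in> grid n. \<not> is_mid (fst v) \<and> \<not> is_mid (snd v)} = {z \<in> {1..n}. \<not> is_mid z} \<times> {z \<in> {1..n}. \<not> is_mid z}"
      by (auto simp: grid_def)
    hence "card {v \<in> grid n. \<not> is_mid (fst v) \<and> \<not> is_mid (snd v)} = (card {z \<in> {1..n}. \<not> is_mid z})\<^sup>2"
      by (simp add: card_cartesian_product power2_eq_square)
    also have "card {z \<in> {1..n}. \<not> is_mid z} \<le> 2 * (N + r + 5)" using out[of "N + r"] by (simp add: is_mid_def add.assoc)
    hence "(card {z \<in> {1..n}. \<not> is_mid z})\<^sup>2 \<le> (2 * (N + r + 5))\<^sup>2" by (intro power_mono) auto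
    finally have m: "card {v \<in> grid n. \<not> is_mid (fst v) \<and> \<not> is_mid (snd v)} \<le> (2 * (N + r + 5))\<^sup>2" .
    show ?thesis
      unfolding g of_nat_power[symmetric] using nn i o m
      by (intro add_mono mult_right_mono) (auto simp only: of_nat_le_iff order_refl)
  qed
  finally show ?thesis .
qed

end

section \<open>Lower bound on the percolation time\<close>

lemma gap_not_infected:
  assumes "A \<inter> {a<..a + (2 * t + 1)} \<times> {1} = {}"
  shows "(a + t + 1, 1) \<notin> spread (grid n) A t"
proof -
  have "\<forall>i. a + s < i \<and> i \<le> a + (2 * t + 1) - s \<longrightarrow> (i, 1) \<notin> spread (grid n) A s" if "s \<le> t" for s
    using that
  proof (induction s)
    case 0
    show ?case using assms by auto
  next
    case (Suc s)
    have IH: "\<And>i. a + s < i \<Longrightarrow> i \<le> a + (2 * t + 1) - s \<Longrightarrow> (i, 1) \<notin> spread (grid n) A s"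
      using Suc by auto
    show ?case
    proof (intro allI impI)
      fix i assume i: "a + Suc s < i \<and> i \<le> a + (2 * t + 1) - Suc s"
      \<comment> \<open>There is no row 0, and both neighbours in the row are still uninfected; at
        most one infected neighbour remains.\<close>
      have "{w \<in> grid n. grid_adj (i, 1) w} \<inter> spread (grid n) A s \<subseteq> {(i, 2)}"
      proof
        fix w assume w: "w \<in> {w \<in> grid n. grid_adj (i, 1) w} \<inter> spread (grid n) A s"
        hence "w = (i - 1, 1) \<or> w = (i + 1, 1) \<or> w = (i, 2)"
          by (cases w) (auto simp: grid_adj_def grid_def)
        moreover have "(i - 1, 1) \<notin> spread (grid n) A s" using i by (intro IH) auto
        moreover have "(i + 1, 1) \<notin> spread (grid n) A s" using i by (intro IH) auto
        ultimately show "w \<in> {(i, 2)}" using w by auto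
      qed
      hence "card ({w \<in> grid n. grid_adj (i, 1) w} \<inter> spread (grid n) A s) \<le> card {(i, 2 :: nat)}"
        by (intro card_mono) auto
      hence "\<not> 2 \<le> card ({w \<in> grid n. grid_adj (i, 1) w} \<inter> spread (grid n) A s)" by simp
      moreover have "(i, 1) \<notin> spread (grid n) A s" using i by (intro IH) auto
      ultimately show "(i, 1) \<notin> spread (grid n) A (Suc s)" unfolding spread.simps(2) by blast
    qed
  qed
  from this[of t] show ?thesis by simp
qed

lemma pr_all_infected_le:
  assumes p: "0 \<le> p" "p \<le> 1"
  shows "pr (grid n) p (\<lambda>A. spread (grid n) A t = grid n) \<le> (1 - (1 - p) ^ (2 * t + 1)) ^ (n div (2 * t + 1))"
proof -
  let ?k = "2 * t + 1"
  let ?Z = "\<lambda>i. {i * ?k<..i * ?k + ?k} \<times> {1 :: nat}"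
  let ?I = "{..<n div ?k}"
  have le: "i * ?k + ?k \<le> n" if "i \<in> ?I" for i
  proof -
    have "Suc i * ?k \<le> n div ?k * ?k" using that by (intro mult_le_mono1) auto
    also have "\<dots> \<le> n" by (rule div_times_less_eq_dividend)
    finally show ?thesis by simp
  qed
  have Z: "?Z i \<subseteq> grid n" if "i \<in> ?I" for i
    using le[OF that] by (auto simp: grid_def)
  have "pr (grid n) p (\<lambda>A. spread (grid n) A t = grid n) \<le> pr (grid n) p (\<lambda>A. \<forall>i\<in>?I. A \<inter> ?Z i \<noteq> {})"
  proof (rule pr_mono)
    fix A assume "spread (grid n) A t = grid n"
    moreover have "(i * ?k + t + 1, 1) \<in> grid n" if "i \<in> ?I" for i using le[OF that] by (auto simp: grid_def)
    ultimately show "\<forall>i\<in>?I. A \<inter> ?Z i \<noteq> {}" using gap_not_infected by blast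
  qed simp
  also have "\<dots> = (\<Prod>i\<in>?I. pr (grid n) p (\<lambda>A. A \<inter> ?Z i \<noteq> {}))"
  proof (rule pr_indep_family[where S="?Z"])
    fix i j :: nat assume ij: "i \<noteq> j"
    have "?Z i \<inter> ?Z j = {}" if "i < j" for i j :: nat
    proof -
      have "Suc i * ?k \<le> j * ?k" using that by (intro mult_le_mono1) auto
      thus ?thesis by auto
    qed
    thus "?Z i \<inter> ?Z j = {}" using ij by (metis Int_commute linorder_neqE_nat)
  qed (use Z in auto)
  also have "\<dots> = (\<Prod>i\<in>?I. 1 - (1 - p) ^ ?k)"
  proof (intro prod.cong refl)
    fix i assume i: "i \<in> ?I"
    have "pr (grid n) p (\<lambda>A. A \<inter> ?Z i \<noteq> {}) = 1 - pr (grid n) p (\<lambda>A. A \<inter> ?Z i = {})" by (rule pr_not)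
    also have "pr (grid n) p (\<lambda>A. A \<inter> ?Z i = {}) = (1 - p) ^ ?k"
      using pr_empty[OF finite_grid Z[OF i] p] by (simp add: card_cartesian_product)
    finally show "pr (grid n) p (\<lambda>A. A \<inter> ?Z i \<noteq> {}) = 1 - (1 - p) ^ ?k" .
  qed
  finally show ?thesis by simp
qed

section \<open>From infected sets to the percolation time\<close>

lemma percolation_time_le:
  assumes "infected n A t = grid n"
  shows "percolation_time n A \<le> enat t"
  unfolding percolation_time_def using assms by (intro INF_lower) auto

lemma percolation_time_ge:
  assumes "A \<subseteq> grid n" "infected n A t \<noteq> grid n"
  shows "enat (Suc t) \<le> percolation_time n A"
  unfolding percolation_time_def
proof (rule INF_greatest)
  fix s assume "s \<in> {s. infected n A s = grid n}"
  hence s: "spread (grid n) A s = grid n" by (simp add: infected_eq_spread)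
  have "t < s"
  proof (rule ccontr)
    assume "\<not> t < s"
    hence "grid n \<subseteq> spread (grid n) A t" using spread_mono_time[of s t "grid n" A] s by simp
    thus False using assms spread_subset[OF assms(1)] by (auto simp: infected_eq_spread)
  qed
  thus "enat (Suc t) \<le> enat s" by simp
qed

lemma percolation_time_prob:
  assumes tlow: "l \<le> real (Suc s)" and thigh: "real t \<le> u"
  shows "measure_pmf.prob (random_subset n p)
     {A. ereal l \<le> ereal_of_enat (percolation_time n A) \<and> ereal_of_enat (percolation_time n A) \<le> ereal u}
    \<ge> 1 - pr (grid n) p (\<lambda>A. spread (grid n) A s = grid n) - pr (grid n) p (\<lambda>A. spread (grid n) A t \<noteq> grid n)"
proof -
  let ?G = "\<lambda>A. ereal l \<le> ereal_of_enat (percolation_time n A) \<and> ereal_of_enat (percolation_time n A) \<le> ereal u"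
  have "1 - pr (grid n) p ?G = pr (grid n) p (\<lambda>A. \<not> ?G A)" by (rule pr_not[symmetric])
  also have "\<dots> \<le> pr (grid n) p (\<lambda>A. spread (grid n) A s = grid n \<or> spread (grid n) A t \<noteq> grid n)"
  proof (rule pr_mono)
    fix A assume A: "A \<subseteq> grid n" "\<not> ?G A"
    show "spread (grid n) A s = grid n \<or> spread (grid n) A t \<noteq> grid n"
    proof (rule ccontr)
      assume n: "\<not> ?thesis"
      have "percolation_time n A \<le> enat t" using n by (intro percolation_time_le) (simp add: infected_eq_spread)
      hence "ereal_of_enat (percolation_time n A) \<le> ereal_of_enat (enat t)" by (simp only: ereal_of_enat_le_iff)
      also have "\<dots> \<le> ereal u" using thigh by simp
      finally have 1: "ereal_of_enat (percolation_time n A) \<le> ereal u" .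
      have "enat (Suc s) \<le> percolation_time n A" using n A by (intro percolation_time_ge) (auto simp: infected_eq_spread)
      hence "ereal_of_enat (enat (Suc s)) \<le> ereal_of_enat (percolation_time n A)" by (simp only: ereal_of_enat_le_iff)
      moreover have "ereal l \<le> ereal_of_enat (enat (Suc s))" using tlow by simp
      ultimately have "ereal l \<le> ereal_of_enat (percolation_time n A)" by (rule order_trans[rotated])
      thus False using 1 A by blast
    qed
  qed simp
  also have "\<dots> \<le> pr (grid n) p (\<lambda>A. spread (grid n) A s = grid n) + pr (grid n) p (\<lambda>A. spread (grid n) A t \<noteq> grid n)"
    by (rule pr_or)
  finally show ?thesis unfolding random_subset_eq pr_def[symmetric] by simp
qed

section \<open>Choice of the scales\<close>

text \<open>Here \<open>x\<close> is \<ell>, while \<open>L\<close> is about \<open>x powr a\<close>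
  and \<open>m\<close> about \<open>x powr (1 - 4 * a)\<close>. The clauses are, in this order:
  basic sizes, total time, \<open>N \<le> 4 * x\<close>, polynomial factors, number of labellings,
  four requirements on seeds, and the lower bound on \<beta> when \<beta> is large.\<close>

lemma eventually_scales:
  fixes a \<epsilon> \<eta> c C c\<^sub>1 M :: real
  assumes "0 < a" "a < 1 / 8" "0 < \<epsilon>" "\<epsilon> \<le> 1 / 2" "0 < \<eta>" "0 < c" "0 < c\<^sub>1" "0 < M"
  shows "eventually (\<lambda>x. 1 \<le> 2 * \<eta> * x \<and> 2 \<le> x \<and> 8 / \<eta> \<le> x powr a \<and> 2 \<le> x powr a) at_top"
    and "eventually (\<lambda>x. 8 * x powr (2 * a) + 8 * x powr (1 - 2 * a) + (1 + \<epsilon> / 4) * x + 6 \<le> (1 + \<epsilon>) * x) at_top"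
    and "eventually (\<lambda>x. (1 + \<epsilon> / 4) * x + 4 * x powr (1 - 3 * a) + 2 * x powr a + 3 \<le> 4 * x) at_top"
    and "eventually (\<lambda>x. 2 * (6 * x + 10) \<le> exp (2 * \<eta> * c * x / ln (2 * x))) at_top"
    and "eventually (\<lambda>x. ln (3 * x) + (2 * x powr (1 - a) + 2) * ln (8 * x) \<le> \<eta> * c * x / ln (2 * x)) at_top"
    and "eventually (\<lambda>x. C * ln (2 * x) / c \<le> x powr a) at_top"
    and "eventually (\<lambda>x. 8 * M * x powr a \<le> (2 * x) powr (- (1 - 8 * a)) * x powr (1 - 4 * a)) at_top"
    and "eventually (\<lambda>x. 32 * M * x powr a * ln (2 * x powr a) \<le> c\<^sub>1 * x powr (1 - 4 * a)) at_top"
    and "eventually (\<lambda>x. 16 * M * x powr a \<le> x powr (1 - 4 * a)) at_top"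
    and "eventually (\<lambda>x. c \<le> ln (2 * x)) at_top"
  subgoal using assms by (intro eventually_conj; real_asymp)
  subgoal using assms by real_asymp
  subgoal using assms by real_asymp
  subgoal using assms by real_asymp
  subgoal using assms by real_asymp
  subgoal using assms by real_asymp
  subgoal using assms by real_asymp
  subgoal using assms by real_asymp
  subgoal using assms by real_asymp
  subgoal using assms by real_asymp
  done

text \<open>Seeds of probability \<open>(2 x) powr (8 a - 1)\<close> suffice for small \<open>p\<close>, a constant
  probability for intermediate \<open>p\<close>, and the event that a square is initially full for \<open>p\<close> near 1.\<close>

lemma seed_condition:
  fixes p x a lnn c\<^sub>0 p\<^sub>0 C \<delta> :: real and L m M :: nat
  defines "\<beta> \<equiv> ln (1 / (1 - p))"
  assumes p: "0 < p" "p < 1" and x: "2 \<le> x" and lnn: "lnn = 2 * \<beta> * x" "1 < lnn"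
    and plarge: "c\<^sub>0 \<le> p * ln lnn" and c0: "0 < c\<^sub>0" and a: "0 < a" "a < 1 / 8"
    and exponent: "pi\<^sup>2 / 9 + \<delta> = (1 - 8 * a) * c\<^sub>0"
    and p0: "0 < p\<^sub>0" "p\<^sub>0 \<le> 1 / 2"
    and span: "\<And>p L. 0 < p \<Longrightarrow> p \<le> p\<^sub>0 \<Longrightarrow> C / p \<le> real L \<Longrightarrow> span_prob p L \<ge> exp (- (pi\<^sup>2 / 9 + \<delta>) / p)"
    and L: "1 \<le> L" "x powr a \<le> real L" "real L \<le> 2 * x powr a" and m: "x powr (1 - 4 * a) \<le> real m"
    and e1: "\<bar>C\<bar> * ln (2 * x) / c\<^sub>0 \<le> x powr a"
    and e2: "8 * real M * x powr a \<le> (2 * x) powr (- (1 - 8 * a)) * x powr (1 - 4 * a)"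
    and e3: "32 * real M * x powr a * ln (2 * x powr a) \<le> p\<^sub>0 * exp (- (pi\<^sup>2 / (3 * p\<^sub>0))) * x powr (1 - 4 * a)"
    and e4: "16 * real M * x powr a \<le> x powr (1 - 4 * a)"
  shows "(1 - span_prob p L) ^ m \<le> (1 - p) ^ (4 * L * M)"
proof -
  let ?g = "span_prob p L"
  have \<beta>0: "0 < \<beta>" unfolding \<beta>_def using p by simp
  have q: "1 - p = exp (- \<beta>)" unfolding \<beta>_def using p by (simp add: ln_div)
  have rhs: "(1 - p) ^ (4 * L * M) = exp (- (\<beta> * (4 * real L * real M)))"
    unfolding q by (simp add: exp_of_nat_mult[symmetric] mult_ac)
  have gm: "(1 - ?g) ^ m \<le> exp (- (?g * real m))"
  proof -
    have "(1 - ?g) ^ m \<le> exp (- ?g) ^ m"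
      using exp_ge_add_one_self[of "- ?g"] span_prob_le_1[of p L] by (intro power_mono) auto
    also have "\<dots> = exp (- (?g * real m))" by (simp add: exp_of_nat_mult[symmetric] mult.commute)
    finally show ?thesis .
  qed
  have LM: "real M * real L \<le> real M * (2 * x powr a)" using L by (intro mult_left_mono) auto
  have concl: "(1 - ?g) ^ m \<le> (1 - p) ^ (4 * L * M)" if "\<beta> * (4 * real L * real M) \<le> ?g * real m"
  proof -
    have "exp (- (?g * real m)) \<le> exp (- (\<beta> * (4 * real L * real M)))" using that by simp
    thus ?thesis using gm rhs by linarith
  qed
  consider "p \<le> p\<^sub>0" | "p\<^sub>0 < p" "\<beta> \<le> 4 * ln (real L)" | "4 * ln (real L) < \<beta>" by linarith
  thus ?thesis
  proof cases
    case 1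
    \<comment> \<open>For \<open>p \<le> 1 / 2\<close> this bounds \<beta> by 1, so that
      \<open>lnn \<le> 2 * x\<close>.\<close>
    have "- p - 2 * p\<^sup>2 \<le> ln (1 - p)" using 1 p p0 by (intro ln_one_minus_pos_lower_bound) auto
    hence "\<beta> \<le> p + 2 * p\<^sup>2" unfolding \<beta>_def using p by (simp add: ln_div)
    also have "\<dots> \<le> p + 2 * (p * (1 / 2))" using 1 p p0 unfolding power2_eq_square by (intro add_left_mono mult_left_mono) auto
    finally have \<beta>1: "\<beta> \<le> 1" using 1 p0 by simp
    have "lnn \<le> 2 * 1 * x" unfolding lnn(1) using \<beta>1 x by (intro mult_right_mono mult_left_mono) auto
    hence l2: "lnn \<le> 2 * x" by simp
    hence ll: "ln lnn \<le> ln (2 * x)" using lnn by (subst ln_le_cancel_iff) auto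
    have llpos: "0 < ln lnn" using lnn by simp
    have cp: "c\<^sub>0 / p \<le> ln lnn" using plarge p by (simp add: pos_divide_le_eq mult.commute)
    have "\<bar>C\<bar> / p = \<bar>C\<bar> / c\<^sub>0 * (c\<^sub>0 / p)" using c0 by simp
    also have "\<dots> \<le> \<bar>C\<bar> / c\<^sub>0 * ln (2 * x)" using cp ll c0 by (intro mult_left_mono) auto
    also have "\<dots> = \<bar>C\<bar> * ln (2 * x) / c\<^sub>0" by simp
    also have "\<dots> \<le> real L" using e1 L by linarith
    finally have "\<bar>C\<bar> / p \<le> real L" .
    moreover have "C / p \<le> \<bar>C\<bar> / p" using p by (intro divide_right_mono) auto
    ultimately have "C / p \<le> real L" by linarith
    hence "exp (- (pi\<^sup>2 / 9 + \<delta>) / p) \<le> ?g" using 1 p by (intro span) auto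
    \<comment> \<open>The threshold enters here:
      \<open>c\<^sub>0 / p \<le> ln lnn \<le> ln (2 * x)\<close>. The margin \<open>8 * a\<close> in
      the exponent outweighs the loss \<open>4 * a\<close> in \<open>m\<close> and the power
      \<open>a\<close> in \<open>L\<close>.\<close>
    moreover have "(2 * x) powr (- (1 - 8 * a)) \<le> exp (- (pi\<^sup>2 / 9 + \<delta>) / p)"
    proof -
      have "(2 * x) powr (- (1 - 8 * a)) = exp (- ((1 - 8 * a) * ln (2 * x)))" 
        using x by (simp add: powr_def algebra_simps)
      also have "\<dots> \<le> exp (- ((1 - 8 * a) * (c\<^sub>0 / p)))"
      proof -
        have "(1 - 8 * a) * (c\<^sub>0 / p) \<le> (1 - 8 * a) * ln (2 * x)" using cp ll a by (intro mult_left_mono) auto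
        thus ?thesis by (simp only: exp_le_cancel_iff neg_le_iff_le)
      qed
      also have "- ((1 - 8 * a) * (c\<^sub>0 / p)) = - (pi\<^sup>2 / 9 + \<delta>) / p" unfolding exponent by simp
      finally show ?thesis .
    qed
    ultimately have "(2 * x) powr (- (1 - 8 * a)) \<le> ?g" by linarith
    hence "(2 * x) powr (- (1 - 8 * a)) * x powr (1 - 4 * a) \<le> ?g * real m"
      using m by (intro mult_mono span_prob_nonneg) auto
    moreover have "\<beta> * (4 * real L * real M) \<le> 1 * (4 * real L * real M)" using \<beta>1 by (intro mult_right_mono) auto
    ultimately show ?thesis using LM e2 by (intro concl) (simp add: mult_ac)
  next
    case 2
    have "p\<^sub>0 * exp (- (pi\<^sup>2 / (3 * p\<^sub>0))) \<le> p * exp (- (pi\<^sup>2 / (3 * p)))"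
    proof (intro mult_mono)
      have "pi\<^sup>2 / (3 * p) \<le> pi\<^sup>2 / (3 * p\<^sub>0)" using 2 p0 by (intro divide_left_mono) auto
      thus "exp (- (pi\<^sup>2 / (3 * p\<^sub>0))) \<le> exp (- (pi\<^sup>2 / (3 * p)))" by simp
    qed (use 2 p in auto)
    also have "\<dots> \<le> ?g" using p L by (intro span_prob_ge_const) auto
    finally have "p\<^sub>0 * exp (- (pi\<^sup>2 / (3 * p\<^sub>0))) * x powr (1 - 4 * a) \<le> ?g * real m"
      using m by (intro mult_mono span_prob_nonneg) auto
    moreover have "\<beta> * (4 * real L * real M) \<le> 32 * real M * x powr a * ln (2 * x powr a)"
    proof -
      have "ln (real L) \<le> ln (2 * x powr a)" using L by (subst ln_le_cancel_iff) auto
      hence "\<beta> \<le> 4 * ln (2 * x powr a)" using 2 by linarith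
      hence "\<beta> * (4 * real L * real M) \<le> 4 * ln (2 * x powr a) * (4 * (2 * x powr a) * real M)"
        using L \<beta>0 by (intro mult_mono) auto
      thus ?thesis by (simp add: mult_ac)
    qed
    ultimately show ?thesis using e3 by (intro concl) linarith
  next
    case 3
    \<comment> \<open>In this regime \<open>L\<^sup>2\<close> is at most
      \<open>exp (\<beta> / 2)\<close>, so each square fails to be a seed with probability at most
      the square root of \<open>1 - p\<close>.\<close>
    have "1 - ?g \<le> real (L\<^sup>2) * (1 - p)" using p by (intro span_prob_compl_le) auto
    also have "real (L\<^sup>2) = exp (2 * ln (real L))" using L by (simp add: exp_double)
    also have "\<dots> * (1 - p) = exp (2 * ln (real L) - \<beta>)" unfolding q by (simp add: exp_add[symmetric])
    also have "\<dots> \<le> exp (- (\<beta> / 2))" using 3 by simp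
    finally have "(1 - ?g) ^ m \<le> exp (- (\<beta> / 2)) ^ m"
      using span_prob_le_1[of p L] by (intro power_mono) auto
    also have "\<dots> = exp (- (\<beta> / 2 * real m))" by (simp add: exp_of_nat_mult[symmetric] mult.commute)
    also have "\<dots> \<le> exp (- (\<beta> * (4 * real L * real M)))"
    proof -
      have "8 * (real M * real L) \<le> real m" using LM e4 m by linarith
      hence "\<beta> / 2 * (8 * (real M * real L)) \<le> \<beta> / 2 * real m" using \<beta>0 by (intro mult_left_mono) auto
      thus ?thesis by (simp add: mult_ac)
    qed
    finally show ?thesis using rhs by simp
  qed
qed

text \<open>Makes the arm estimate uniform in \<open>k \<le> r\<close>. The correction 4 in
  \<open>2 * L - 4\<close> becomes the factor \<open>(1 - p) powr (- (4 * r / L))\<close>; together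
  with the number of labellings it forms the constant \<open>H\<close> of the union bound.\<close>

lemma arm_bound:
  fixes p :: real and L m M r N :: nat
  assumes p: "0 < p" "p < 1" and L: "2 \<le> L" and m: "1 \<le> m" and N: "N = r + m * L + L + 2"
    and s: "(1 - span_prob p L) ^ m \<le> (1 - p) ^ (4 * L * M)" and k: "k \<le> r"
  shows "pr (patch N) p (\<lambda>A. (1, 1) \<notin> spread (patch N) A (fill_time L m + k)) \<le>
     real (r + 1) * (2 * real N) ^ (r div L + 2) * (1 - p) powr (- (4 * real r / real L)) *
       (1 - p) powr (2 * (real M / (real M + 1)) * real k)"
proof -
  let ?q = "1 - p" and ?t = "real M / (real M + 1)"
  have t: "0 \<le> ?t" "?t \<le> 1" by auto
  have "pr (patch N) p (\<lambda>A. (1, 1) \<notin> spread (patch N) A (fill_time L m + k)) \<le>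
     real (k + 1) * (2 * real N) ^ (k div L + 2) * ?q powr (?t * (2 * real L - 4) * (real k / real L))"
    using N k by (intro arm_probability[OF p L m _ s]) auto
  also have "\<dots> \<le> real (r + 1) * (2 * real N) ^ (r div L + 2) * ?q powr (- (4 * real r / real L) + 2 * ?t * real k)"
  proof (intro mult_mono power_increasing)
    show "k div L + 2 \<le> r div L + 2" using k by (simp add: div_le_mono)
    have "?t * (real k / real L) \<le> 1 * (real r / real L)" using t k by (intro mult_mono divide_right_mono) auto
    moreover have "?t * (2 * real L - 4) * (real k / real L) = 2 * ?t * real k - 4 * (?t * (real k / real L))"
    proof -
      have "t * (2 * l - 4) * (j / l) = 2 * t * j - 4 * (t * (j / l))" if "l \<noteq> 0" for t l j :: real
        using that by (simp add: field_simps)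
      from this[of "real L" ?t "real k"] L show ?thesis by linarith
    qed
    ultimately have "- (4 * real r / real L) + 2 * ?t * real k \<le> ?t * (2 * real L - 4) * (real k / real L)"
      by simp
    thus "?q powr (?t * (2 * real L - 4) * (real k / real L)) \<le> ?q powr (- (4 * real r / real L) + 2 * ?t * real k)"
      using p by (intro powr_mono') auto
  qed (use k N in auto)
  also have "\<dots> = real (r + 1) * (2 * real N) ^ (r div L + 2) * ?q powr (- (4 * real r / real L)) * ?q powr (2 * ?t * real k)"
    by (simp only: powr_add mult.assoc)
  finally show ?thesis .
qed


text \<open>\<open>W\<close> is \<open>n powr (\<epsilon> / 100)\<close> and dominates all
  subpolynomial factors. At most five factors \<open>W\<close> occur in a term of the union bound,
  which leaves room for \<open>n powr (- (\<epsilon> / 16))\<close>.\<close>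

lemma percolation_probability:
  fixes p \<epsilon> x :: real and n L m M r N :: nat
  defines "\<beta> \<equiv> ln (1 / (1 - p))" and "W \<equiv> exp (\<epsilon> / 100 * (2 * ln (1 / (1 - p)) * x))"
  assumes p: "0 < p" "p < 1" and \<epsilon>: "0 < \<epsilon>" "\<epsilon> \<le> 1 / 2" and n: "1 \<le> n" and lnn: "ln (real n) = 2 * \<beta> * x"
    and x: "2 \<le> x" and L: "2 \<le> L" and m: "1 \<le> m"
    and M: "1 \<le> M" "1 + \<epsilon> / 8 \<le> real M / (real M + 1) * (1 + \<epsilon> / 4)"
    and r: "r = nat \<lceil>(1 + \<epsilon> / 4) * x\<rceil>" and N: "N = r + m * L + L + 2"
    and s: "(1 - span_prob p L) ^ m \<le> (1 - p) ^ (4 * L * M)"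
    and fill: "real (fill_time L m + r + 5) \<le> (1 + \<epsilon>) * x"
    and W: "2 * (real N + real r + 10) \<le> W" "exp \<beta> \<le> W"
    and H: "real (r + 1) * (2 * real N) ^ (r div L + 2) * exp (4 * real r * \<beta> / real L) \<le> W"
  shows "measure_pmf.prob (random_subset n p)
     {A. ereal ((1 - \<epsilon>) * x) \<le> ereal_of_enat (percolation_time n A) \<and>
         ereal_of_enat (percolation_time n A) \<le> ereal ((1 + \<epsilon>) * x)}
    \<ge> 1 - exp (- (exp (\<epsilon> / 2 * ln (real n)) / 2)) - 16 * exp (- (\<epsilon> / 16 * ln (real n)))"
proof -
  define X where "X = ln (real n)"
  \<comment> \<open>\<open>E y\<close> is \<open>n\<close> to the power \<open>y\<close>.\<close>
  define E where "E y = exp (y * X)" for y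
  let ?q = "1 - p"
  have \<beta>0: "0 < \<beta>" unfolding \<beta>_def using p by simp
  have q: "?q = exp (- \<beta>)" unfolding \<beta>_def using p by (simp add: ln_div)
  have X: "X = 2 * \<beta> * x" "0 < X" using lnn \<beta>0 x by (auto simp: X_def)
  have En: "real n = E 1" using n by (simp add: E_def X_def)
  have WE: "W = E (\<epsilon> / 100)" unfolding W_def E_def X(1) \<beta>_def by simp
  have Eadd: "E y * E z = E (y + z)" for y z by (simp add: E_def exp_add[symmetric] algebra_simps)
  have Emono: "E y \<le> E z" if "y \<le> z" for y z
    unfolding E_def exp_le_cancel_iff using that X by (intro mult_right_mono) auto
  have E0: "0 < E y" for y by (simp add: E_def)
  have W1: "1 \<le> W" "0 < W" using W(1) by auto
  have qpow: "?q powr y = exp (- (\<beta> * y))" for y unfolding q by (simp add: powr_def)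
  have r1: "(1 + \<epsilon> / 4) * x \<le> real r" unfolding r using x \<epsilon> by linarith
  have rx: "x \<le> real r" 
  proof -
    have "1 * x \<le> (1 + \<epsilon> / 4) * x" using x \<epsilon> by (intro mult_right_mono) auto
    thus ?thesis using r1 by simp
  qed
  let ?t = "real M / (real M + 1)"
  define H0 where "H0 = real (r + 1) * (2 * real N) ^ (r div L + 2) * ?q powr (- (4 * real r / real L))"
  have H0W: "H0 \<le> W" using H unfolding H0_def qpow by (simp add: mult_ac)
  have H01: "1 \<le> H0"
  proof -
    have "1 \<le> 2 * real N" using N by simp
    hence "1 \<le> (2 * real N) ^ (r div L + 2)" by (rule one_le_power)
    moreover have "1 \<le> real (r + 1)" by simp
    moreover have "1 \<le> ?q powr (- (4 * real r / real L))" unfolding qpow using \<beta>0 by simp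
    ultimately show ?thesis unfolding H0_def by (intro mult_ge1_I) auto
  qed
  have H00: "0 \<le> H0" using H01 by simp
  have t: "1 / 2 \<le> ?t" "?t \<le> 1" using M by (auto simp: field_simps)
  have t2: "1 \<le> 2 * ?t" "2 * ?t \<le> 2" using t by linarith+
  define Q where "Q = ?q powr (2 * ?t * real r)"
  have QE: "Q \<le> E (- (1 + \<epsilon> / 8))"
  proof -
    have "(1 + \<epsilon> / 8) * x \<le> ?t * (1 + \<epsilon> / 4) * x" using M x by (intro mult_right_mono) auto
    also have "\<dots> \<le> ?t * real r" using r1 by (simp only: mult.assoc) (intro mult_left_mono, auto)
    finally have "2 * \<beta> * ((1 + \<epsilon> / 8) * x) \<le> 2 * \<beta> * (?t * real r)" using \<beta>0 by (intro mult_left_mono) auto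
    thus ?thesis unfolding Q_def qpow E_def X(1)
      by (simp only: exp_le_cancel_iff mult_minus_left neg_le_iff_le mult_ac)
  qed
  have Q0: "0 \<le> Q" by (simp add: Q_def)
  define Q' where "Q' = ?q powr real r"
  \<comment> \<open>The exponent \<open>r\<close> yields only \<open>n powr (- 1 / 2)\<close>, but
    the corner regions have at most \<open>W\<^sup>2\<close> cells.\<close>
  have Q'E: "Q' \<le> E (- (1 / 2))"
  proof -
    have "\<beta> * x \<le> \<beta> * real r" using rx \<beta>0 by (intro mult_left_mono) auto
    thus ?thesis unfolding Q'_def qpow E_def X(1) by simp
  qed
  have Q'0: "0 \<le> Q'" by (simp add: Q'_def)
  have qinv: "H0 / ?q \<le> W * W" "0 \<le> H0 / ?q"
  proof -
    have "H0 / ?q = H0 * exp \<beta>" unfolding q by (simp add: exp_minus field_simps)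
    also have "\<dots> \<le> W * W" using H0W W W1 H01 by (intro mult_mono) auto
    finally show "H0 / ?q \<le> W * W" .
    show "0 \<le> H0 / ?q" using H01 p by simp
  qed
  have nN: "2 * N + 2 * r + 20 \<le> n"
  proof -
    have "real (2 * N + 2 * r + 20) \<le> W" using W(1) by simp
    also have "\<dots> \<le> real n" unfolding WE En using \<epsilon> by (intro Emono) auto
    finally show ?thesis by linarith
  qed
  have N1: "1 \<le> N" using N by simp
  have "pr (grid n) p (\<lambda>A. spread (grid n) A (fill_time L m + r + 5) \<noteq> grid n) \<le>
     (real n)\<^sup>2 * (6 * (H0 * Q)\<^sup>2)
   + real (4 * n * (N + 5)) * (H0 * Q)
   + real (4 * n) * ((2 * real r + 3) * (H0 / ?q * Q))
   + real ((2 * (N + r + 5))\<^sup>2) * (2 * ((real r + 2) * (H0 / ?q * Q')))"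
    unfolding Q_def Q'_def
    by (rule not_all_infected[OF p N1 nN H01 t2 arm_bound[OF p L m N s, folded H0_def]])
  also have "\<dots> \<le> 6 * E (- (\<epsilon> / 16)) + 4 * E (- (\<epsilon> / 16)) + 4 * E (- (\<epsilon> / 16)) + 2 * E (- (\<epsilon> / 16))"
  proof (intro add_mono)
    have HQ: "H0 * Q \<le> E (\<epsilon> / 100 + - (1 + \<epsilon> / 8))" "0 \<le> H0 * Q"
      unfolding Eadd[symmetric] WE[symmetric] using H0W QE H01 Q0 W1 by (auto intro!: mult_mono)
    have "(real n)\<^sup>2 * (6 * (H0 * Q)\<^sup>2) = 6 * (real n * (H0 * Q))\<^sup>2" by (simp add: power_mult_distrib)
    also have "\<dots> \<le> 6 * (E 1 * E (\<epsilon> / 100 + - (1 + \<epsilon> / 8)))\<^sup>2"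
      unfolding En using HQ E0[of 1] H00 Q0 by (intro mult_left_mono power_mono mult_nonneg_nonneg) auto
    also have "\<dots> = 6 * E (2 * (\<epsilon> / 100 - \<epsilon> / 8))" by (simp add: power2_eq_square Eadd algebra_simps)
    also have "\<dots> \<le> 6 * E (- (\<epsilon> / 16))" using \<epsilon> by (intro mult_left_mono Emono) auto
    finally show "(real n)\<^sup>2 * (6 * (H0 * Q)\<^sup>2) \<le> 6 * E (- (\<epsilon> / 16))" .
    have "real (4 * n * (N + 5)) * (H0 * Q) = 4 * (real n * (real N + 5) * (H0 * Q))" by (simp add: algebra_simps)
    also have "\<dots> \<le> 4 * (E 1 * E (\<epsilon> / 100) * E (\<epsilon> / 100 + - (1 + \<epsilon> / 8)))"
      unfolding En WE[symmetric] using HQ E0[of 1] W(1) W1 H00 Q0 by (intro mult_left_mono mult_mono mult_nonneg_nonneg) auto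
    also have "\<dots> = 4 * E (2 * (\<epsilon> / 100) - \<epsilon> / 8)" by (simp add: Eadd algebra_simps)
    also have "\<dots> \<le> 4 * E (- (\<epsilon> / 16))" using \<epsilon> by (intro mult_left_mono Emono) auto
    finally show "real (4 * n * (N + 5)) * (H0 * Q) \<le> 4 * E (- (\<epsilon> / 16))" .
    have "real (4 * n) * ((2 * real r + 3) * (H0 / ?q * Q)) = 4 * (real n * ((2 * real r + 3) * (H0 / ?q * Q)))" by simp
    also have "\<dots> \<le> 4 * (E 1 * (W * (W * W * E (- (1 + \<epsilon> / 8)))))"
      unfolding En using qinv QE Q0 E0 W(1) W1 less_imp_le[OF E0]
      by (intro mult_left_mono mult_mono mult_nonneg_nonneg) auto
    also have "\<dots> = 4 * E (3 * (\<epsilon> / 100) - \<epsilon> / 8)" unfolding WE by (simp add: Eadd algebra_simps)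
    also have "\<dots> \<le> 4 * E (- (\<epsilon> / 16))" using \<epsilon> by (intro mult_left_mono Emono) auto
    finally show "real (4 * n) * ((2 * real r + 3) * (H0 / ?q * Q)) \<le> 4 * E (- (\<epsilon> / 16))" .
    have "real ((2 * (N + r + 5))\<^sup>2) * (2 * ((real r + 2) * (H0 / ?q * Q')))
       = 2 * ((2 * (real N + real r + 5))\<^sup>2 * ((real r + 2) * (H0 / ?q * Q')))" by (simp add: mult_ac)
    also have "\<dots> \<le> 2 * (W\<^sup>2 * (W * (W * W * E (- (1 / 2)))))"
      using qinv Q'E Q'0 W(1) W1 less_imp_le[OF E0]
      by (intro mult_left_mono mult_mono mult_nonneg_nonneg power_mono) auto
    also have "\<dots> = 2 * E (5 * (\<epsilon> / 100) - 1 / 2)" unfolding WE by (simp add: power2_eq_square Eadd algebra_simps)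
    also have "\<dots> \<le> 2 * E (- (\<epsilon> / 16))" using \<epsilon> by (intro mult_left_mono Emono) auto
    finally show "real ((2 * (N + r + 5))\<^sup>2) * (2 * ((real r + 2) * (H0 / ?q * Q'))) \<le> 2 * E (- (\<epsilon> / 16))" .
  qed
  finally have upper: "pr (grid n) p (\<lambda>A. spread (grid n) A (fill_time L m + r + 5) \<noteq> grid n) \<le> 16 * E (- (\<epsilon> / 16))"
    by simp
  \<comment> \<open>\<open>Suc u\<close> is the rounded-up target, so it is enough that the grid is
    not full at time \<open>u\<close>, which is still below the target.\<close>
  define u where "u = nat \<lceil>(1 - \<epsilon>) * x\<rceil> - 1"
  have ex: "1 \<le> (1 - \<epsilon>) * x" 
  proof -
    have "1 / 2 * 2 \<le> (1 - \<epsilon>) * x" using \<epsilon> x by (intro mult_mono) auto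
    thus ?thesis by simp
  qed
  have u: "(1 - \<epsilon>) * x \<le> real (Suc u)" "real u \<le> (1 - \<epsilon>) * x" using ex unfolding u_def by linarith+
  let ?k = "2 * u + 1"
  have lower: "pr (grid n) p (\<lambda>A. spread (grid n) A u = grid n) \<le> exp (- (E (\<epsilon> / 2) / 2))"
  proof -
    \<comment> \<open>The \<open>2 * u\<close> cells cost at most a factor
      \<open>n powr (1 - \<epsilon>)\<close>; the last cell of the interval is paid by
      \<open>exp \<beta> \<le> W\<close>.\<close>
    have qk: "E (- (1 - \<epsilon>)) / W \<le> ?q ^ ?k"
    proof -
      have "E (- (1 - \<epsilon>)) / W \<le> E (- (1 - \<epsilon>)) / exp \<beta>" using W E0 by (intro divide_left_mono) (auto simp: less_imp_le)
      also have "\<dots> = exp (- (\<beta> * (2 * ((1 - \<epsilon>) * x) + 1)))"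
        unfolding E_def X(1) exp_diff[symmetric] by (simp add: algebra_simps)
      also have "\<dots> \<le> exp (- (\<beta> * real ?k))" using u(2) \<beta>0 by simp
      also have "\<dots> = ?q ^ ?k" unfolding q by (subst exp_of_nat_mult[symmetric]) (simp add: mult.commute)
      finally show ?thesis .
    qed
    have kW: "real ?k \<le> W"
    proof -
      have "(1 - \<epsilon>) * x \<le> 1 * x" using \<epsilon> x by (intro mult_right_mono) auto
      hence "real u \<le> real r" using u rx by linarith
      thus ?thesis using W(1) by simp
    qed
    have nk: "E 1 / W / 2 \<le> real (n div ?k)"
    proof -
      have "real n / W \<le> real n / real ?k" using kW by (intro divide_left_mono) auto
      moreover have "real n / real ?k < real (n div ?k) + 1"
        using floor_divide_of_nat_eq[of n ?k, where ?'a=real] floor_correct[of "real n / real ?k"] by linarith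
      moreover have "2 \<le> real n / W"
      proof -
        have "2 \<le> W" using W(1) by simp
        also have "W = E (\<epsilon> / 100)" by (rule WE)
        also have "\<dots> \<le> E (1 + - (\<epsilon> / 100))" using \<epsilon> by (intro Emono) auto
        also have "\<dots> = E 1 / E (\<epsilon> / 100)" unfolding E_def exp_diff[symmetric] by (simp add: algebra_simps)
        also have "\<dots> = real n / W" by (simp only: En WE)
        finally show ?thesis .
      qed
      moreover have "y / 2 \<le> d" if "y \<le> z" "z < d + 1" "2 \<le> y" for y z d :: real using that by argo
      ultimately show ?thesis unfolding En by blast
    qed
    have "pr (grid n) p (\<lambda>A. spread (grid n) A u = grid n) \<le> (1 - ?q ^ ?k) ^ (n div ?k)"
      using p by (intro pr_all_infected_le) auto
    also have "\<dots> \<le> exp (- (?q ^ ?k)) ^ (n div ?k)"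
    proof (rule power_mono)
      show "1 - ?q ^ ?k \<le> exp (- (?q ^ ?k))" using exp_ge_add_one_self[of "- (?q ^ ?k)"] by simp
      have "?q ^ ?k \<le> 1" by (rule power_le_one) (use p in auto)
      thus "0 \<le> 1 - ?q ^ ?k" by (simp only: diff_ge_0_iff_ge)
    qed
    also have "\<dots> = exp (- (?q ^ ?k * real (n div ?k)))" by (simp add: exp_of_nat_mult[symmetric] mult.commute)
    also have "\<dots> \<le> exp (- (E (\<epsilon> / 2) / 2))"
    proof -
      have "E (\<epsilon> / 2) \<le> E (\<epsilon> - 2 * (\<epsilon> / 100))" using \<epsilon> by (intro Emono) auto
      also have "\<dots> = E (- (1 - \<epsilon>)) / W * (E 1 / W)"
        unfolding WE by (simp add: E_def exp_diff[symmetric] exp_add[symmetric] algebra_simps)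
      finally have "E (\<epsilon> / 2) / 2 \<le> E (- (1 - \<epsilon>)) / W * (E 1 / W / 2)" by simp
      also have "\<dots> \<le> ?q ^ ?k * real (n div ?k)"
        using qk nk W1 E0 p by (intro mult_mono) (auto simp: less_imp_le)
      finally show ?thesis by simp
    qed
    finally show ?thesis .
  qed
  have "1 - pr (grid n) p (\<lambda>A. spread (grid n) A u = grid n)
     - pr (grid n) p (\<lambda>A. spread (grid n) A (fill_time L m + r + 5) \<noteq> grid n)
    \<le> measure_pmf.prob (random_subset n p)
     {A. ereal ((1 - \<epsilon>) * x) \<le> ereal_of_enat (percolation_time n A) \<and>
         ereal_of_enat (percolation_time n A) \<le> ereal ((1 + \<epsilon>) * x)}"
    by (rule percolation_time_prob[OF u(1) fill])
  thus ?thesis using upper lower by (simp add: E_def X_def)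
qed

text \<open>By the lower bound on \<beta>, the exponent \<open>\<eta> * (2 * \<beta> * x)\<close> is
  at least of order \<open>x / ln x\<close>. The logarithm of the number of labellings has order
  \<open>x powr (1 - a) * ln x\<close>, and the crossings of strips contribute order
  \<open>\<beta> * x powr (1 - a)\<close>; both are smaller.\<close>

lemma scale_conditions:
  fixes a \<epsilon> \<eta> c x \<beta> :: real and L m r N :: nat
  assumes a: "0 < a" "a < 1 / 8" and \<epsilon>: "0 < \<epsilon>" "\<epsilon> \<le> 1 / 2" and \<eta>: "0 < \<eta>" and c: "0 < c"
    and L: "L = nat \<lceil>x powr a\<rceil>" and m: "m = nat \<lceil>x powr (1 - 4 * a)\<rceil>"
    and r: "r = nat \<lceil>(1 + \<epsilon> / 4) * x\<rceil>" and N: "N = r + m * L + L + 2"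
    and e1: "1 \<le> 2 * \<eta> * x" "2 \<le> x" "8 / \<eta> \<le> x powr a" "2 \<le> x powr a"
    and e2: "8 * x powr (2 * a) + 8 * x powr (1 - 2 * a) + (1 + \<epsilon> / 4) * x + 6 \<le> (1 + \<epsilon>) * x"
    and e3: "(1 + \<epsilon> / 4) * x + 4 * x powr (1 - 3 * a) + 2 * x powr a + 3 \<le> 4 * x"
    and e4: "2 * (6 * x + 10) \<le> exp (2 * \<eta> * c * x / ln (2 * x))"
    and e5: "ln (3 * x) + (2 * x powr (1 - a) + 2) * ln (8 * x) \<le> \<eta> * c * x / ln (2 * x)"
    and \<beta>: "c / ln (2 * x) \<le> \<beta>" "0 < \<beta>"
  shows "x powr a \<le> real L" "real L \<le> 2 * x powr a" "2 \<le> L" "1 \<le> m" "x powr (1 - 4 * a) \<le> real m"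
    and "real (fill_time L m + r + 5) \<le> (1 + \<epsilon>) * x"
    and "2 * (real N + real r + 10) \<le> exp (\<eta> * (2 * \<beta> * x))"
    and "exp \<beta> \<le> exp (\<eta> * (2 * \<beta> * x))"
    and "real (r + 1) * (2 * real N) ^ (r div L + 2) * exp (4 * real r * \<beta> / real L) \<le> exp (\<eta> * (2 * \<beta> * x))"
proof -
  let ?y = "x powr a"
  have ceil: "z \<le> real (nat \<lceil>z\<rceil>)" "real (nat \<lceil>z\<rceil>) \<le> z + 1" if "0 \<le> z" for z :: real
    using that by linarith+
  have pow1: "1 \<le> x powr (1 - 4 * a)" using e1 a by (intro ge_one_powr_ge_zero) auto
  show L1: "?y \<le> real L" unfolding L by (rule ceil) simp
  have "real L \<le> ?y + 1" unfolding L by (rule ceil) simp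
  thus L2: "real L \<le> 2 * ?y" using e1 by linarith
  have "2 \<le> real L" using L1 e1 by linarith
  thus L3: "2 \<le> L" by simp
  show m1: "x powr (1 - 4 * a) \<le> real m" unfolding m by (rule ceil) simp
  hence "1 \<le> real m" using pow1 by linarith
  thus "1 \<le> m" by simp
  have "real m \<le> x powr (1 - 4 * a) + 1" unfolding m by (rule ceil) simp
  hence m2: "real m \<le> 2 * x powr (1 - 4 * a)" using pow1 by linarith
  have x0: "0 < x" using e1 by simp
  have r1: "real r \<le> (1 + \<epsilon> / 4) * x + 1" unfolding r using x0 \<epsilon> by (intro ceil) auto
  have "\<epsilon> / 4 * x \<le> 1 / 8 * x" using \<epsilon> x0 by (intro mult_right_mono) auto
  moreover have "(1 + \<epsilon> / 4) * x = x + \<epsilon> / 4 * x" by (simp add: algebra_simps)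
  ultimately have r2: "real r \<le> 2 * x" using r1 e1 by linarith
  have LL: "real L * real L \<le> 4 * x powr (2 * a)"
  proof -
    have "real L * real L \<le> (2 * ?y) * (2 * ?y)" by (rule mult_mono[OF L2 L2]) auto
    also have "\<dots> = 4 * x powr (2 * a)" by (simp add: powr_add[symmetric])
    finally show ?thesis .
  qed
  have mLL: "real m * (real L * real L) \<le> 8 * x powr (1 - 2 * a)"
  proof -
    have "real m * (real L * real L) \<le> (2 * x powr (1 - 4 * a)) * (4 * x powr (2 * a))" by (rule mult_mono[OF m2 LL]) auto
    also have "\<dots> = 8 * x powr (1 - 2 * a)" by (simp add: powr_add[symmetric])
    finally show ?thesis .
  qed
  have mL: "real m * real L \<le> 4 * x powr (1 - 3 * a)"
  proof -
    have "real m * real L \<le> (2 * x powr (1 - 4 * a)) * (2 * ?y)" by (rule mult_mono[OF m2 L2]) auto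
    also have "\<dots> = 4 * x powr (1 - 3 * a)" by (simp add: powr_add[symmetric])
    finally show ?thesis .
  qed
  have "real (fill_time L m + r + 5) = 2 * (real L * real L) + real m * (real L * real L) + real r + 5"
    by (simp add: fill_time_def power2_eq_square)
  thus "real (fill_time L m + r + 5) \<le> (1 + \<epsilon>) * x" using LL mLL r1 e2 by linarith
  have "real N = real r + real m * real L + real L + 2" by (simp add: N)
  hence N4: "real N \<le> 4 * x" using r1 mL L2 e3 by linarith
  have lnx: "0 < ln (2 * x)" using e1 by simp
  have \<beta>x: "\<eta> * c * x / ln (2 * x) \<le> \<eta> * (\<beta> * x)"
  proof -
    have "\<eta> * ((c / ln (2 * x)) * x) \<le> \<eta> * (\<beta> * x)" using \<beta> \<eta> x0 by (intro mult_left_mono mult_right_mono) auto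
    thus ?thesis by simp
  qed
  have "2 * (real N + real r + 10) \<le> 2 * (6 * x + 10)" using N4 r2 by simp
  also have "\<dots> \<le> exp (2 * \<eta> * c * x / ln (2 * x))" by (rule e4)
  also have "\<dots> \<le> exp (\<eta> * (2 * \<beta> * x))"
  proof -
    have "2 * \<eta> * c * x / ln (2 * x) = 2 * (\<eta> * c * x / ln (2 * x))" "\<eta> * (2 * \<beta> * x) = 2 * (\<eta> * (\<beta> * x))" by simp_all
    thus ?thesis using \<beta>x by simp
  qed
  finally show "2 * (real N + real r + 10) \<le> exp (\<eta> * (2 * \<beta> * x))" .
  have "1 * \<beta> \<le> (2 * \<eta> * x) * \<beta>" using e1 \<beta> by (intro mult_right_mono) auto
  thus "exp \<beta> \<le> exp (\<eta> * (2 * \<beta> * x))" by (simp add: mult_ac)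
  show "real (r + 1) * (2 * real N) ^ (r div L + 2) * exp (4 * real r * \<beta> / real L) \<le> exp (\<eta> * (2 * \<beta> * x))"
  proof -
    have "1 \<le> N" using N by simp
    hence N0: "0 < 2 * real N" by simp
    have ln1: "ln (real (r + 1)) \<le> ln (3 * x)" using r2 e1 by (subst ln_le_cancel_iff) auto
    have K: "real (r div L + 2) \<le> 2 * x powr (1 - a) + 2"
    proof -
      have "real (r div L) \<le> real r / real L" by (rule of_nat_div_le_of_nat)
      also have "\<dots> \<le> (2 * x) / ?y" using r2 L1 e1 x0 by (intro frac_le) auto
      also have "\<dots> = 2 * x powr (1 - a)" using x0 by (simp add: powr_diff)
      finally show ?thesis by simp
    qed
    have ln2: "ln (2 * real N) \<le> ln (8 * x)" using N4 N0 x0 by (subst ln_le_cancel_iff) auto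
    have "real (r div L + 2) * ln (2 * real N) \<le> (2 * x powr (1 - a) + 2) * ln (8 * x)"
      using K ln2 N by (intro mult_mono) auto
    moreover have "4 * real r * \<beta> / real L \<le> \<eta> * (\<beta> * x)"
    proof -
      have "8 \<le> \<eta> * ?y" using e1(3) \<eta> by (simp add: pos_divide_le_eq mult.commute)
      also have "\<dots> \<le> \<eta> * real L" using L1 \<eta> by (intro mult_left_mono) auto
      finally have "8 * (\<beta> * x) \<le> \<eta> * real L * (\<beta> * x)" using \<beta> x0 by (intro mult_right_mono) auto
      moreover have "4 * real r * \<beta> \<le> 4 * (2 * x) * \<beta>" using r2 \<beta> by (intro mult_right_mono mult_left_mono) auto
      ultimately have "4 * real r * \<beta> \<le> \<eta> * (\<beta> * x) * real L" by (simp add: mult_ac)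
      thus ?thesis using L3 by (subst pos_divide_le_eq) auto
    qed
    ultimately have sum: "ln (real (r + 1)) + real (r div L + 2) * ln (2 * real N) + 4 * real r * \<beta> / real L \<le> \<eta> * (2 * \<beta> * x)"
      using ln1 e5 \<beta>x by simp
    have "real (r + 1) * (2 * real N) ^ (r div L + 2) * exp (4 * real r * \<beta> / real L)
      = exp (ln (real (r + 1)) + real (r div L + 2) * ln (2 * real N) + 4 * real r * \<beta> / real L)"
    proof -
      have "(2 * real N) ^ (r div L + 2) = exp (real (r div L + 2) * ln (2 * real N))"
        using N0 by (subst exp_of_nat_mult) simp
      moreover have "real (r + 1) = exp (ln (real (r + 1)))" by simp
      ultimately show ?thesis unfolding exp_add by presburger
    qed
    thus ?thesis using sum by simp
  qed
qed

theorem theorem1: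
  fixes p :: "nat \<Rightarrow> real"
  assumes p_range: "\<And>n. n \<ge> 1 \<Longrightarrow> 0 < p n \<and> p n < 1"
    and p_large: "Liminf sequentially (\<lambda>n. ereal (p n * ln (ln (real n)))) > ereal (2 * (pi\<^sup>2 / 18))"
    and p_small: "much_less (\<lambda>n. ln (1 / (1 - p n))) (\<lambda>n. ln (real n))"
  shows "\<forall>\<epsilon>>0.
    (\<lambda>n. measure_pmf.prob (random_subset n (p n))
       {A. ereal ((1 - \<epsilon>) * (ln (real n) / (2 * ln (1 / (1 - p n)))))
             \<le> ereal_of_enat (percolation_time n A) \<and>
           ereal_of_enat (percolation_time n A)
             \<le> ereal ((1 + \<epsilon>) * (ln (real n) / (2 * ln (1 / (1 - p n)))))})
    \<longlonglongrightarrow> 1"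
proof (intro allI impI)
  fix \<epsilon> :: real
  assume \<epsilon>0: "0 < \<epsilon>"
  \<comment> \<open>The claim for a smaller tolerance is stronger, so tolerances up to
    \<open>1 / 2\<close> suffice.\<close>
  define e where "e = min \<epsilon> (1 / 2)"
  have e: "0 < e" "e \<le> 1 / 2" "e \<le> \<epsilon>" using \<epsilon>0 by (auto simp: e_def)
  define \<beta> x where "\<beta> n = ln (1 / (1 - p n))" and "x n = ln (real n) / (2 * ln (1 / (1 - p n)))" for n
  have \<beta>0: "0 < \<beta> n" if "n \<ge> 1" for n using p_range[OF that] by (simp add: \<beta>_def)
  have x_top: "filterlim x at_top sequentially"
  proof -
    have "filterlim (\<lambda>n. 1 / 2 * (ln (real n) / ln (1 / (1 - p n)))) at_top sequentially"
      using p_small unfolding much_less_def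
      by (intro filterlim_tendsto_pos_mult_at_top[OF tendsto_const]) auto
    thus ?thesis unfolding x_def by simp
  qed
  have "\<exists>c\<^sub>0. ereal (2 * (pi\<^sup>2 / 18)) < ereal c\<^sub>0 \<and> ereal c\<^sub>0 < Liminf sequentially (\<lambda>n. ereal (p n * ln (ln (real n))))"
    using p_large by (rule ereal_dense2)
  then obtain c\<^sub>0 where c0: "pi\<^sup>2 / 9 < c\<^sub>0" "ereal c\<^sub>0 < Liminf sequentially (\<lambda>n. ereal (p n * ln (ln (real n))))"
    by auto
  have ev_p: "\<forall>\<^sub>F n in sequentially. c\<^sub>0 < p n * ln (ln (real n))"
    using less_LiminfD[OF c0(2)] by simp
  have c0pos: "0 < c\<^sub>0" using c0(1) zero_le_power2[of pi] by linarith
  \<comment> \<open>Half of the distance of \<open>c\<^sub>0\<close> from the threshold goes into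
    \<delta>; the rest becomes the margin \<open>8 * a\<close> in the exponent of the seed
    probability.\<close>
  define \<delta> where "\<delta> = (c\<^sub>0 - pi\<^sup>2 / 9) / 2"
  have \<delta>: "0 < \<delta>" using c0 by (simp add: \<delta>_def)
  define a where "a = (1 - (pi\<^sup>2 / 9 + \<delta>) / c\<^sub>0) / 8"
  have "1 - 8 * ((1 - y) / 8) = y" for y :: real by (simp add: field_simps)
  hence a8: "1 - 8 * a = (pi\<^sup>2 / 9 + \<delta>) / c\<^sub>0" unfolding a_def .
  hence exponent: "pi\<^sup>2 / 9 + \<delta> = (1 - 8 * a) * c\<^sub>0" using c0pos by simp
  have "(pi\<^sup>2 / 9 + \<delta>) / c\<^sub>0 < 1" using c0pos c0(1) by (simp add: \<delta>_def pos_divide_less_eq field_simps)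
  moreover have "0 < (pi\<^sup>2 / 9 + \<delta>) / c\<^sub>0" using c0pos \<delta> by (intro divide_pos_pos add_nonneg_pos) auto
  ultimately have a: "0 < a" "a < 1 / 8" unfolding a8[symmetric] by linarith+
  obtain p\<^sub>0 C where p0: "0 < p\<^sub>0" "p\<^sub>0 \<le> 1 / 2"
    and span: "\<And>p L. 0 < p \<Longrightarrow> p \<le> p\<^sub>0 \<Longrightarrow> C / p \<le> real L \<Longrightarrow> span_prob p L \<ge> exp (- (pi\<^sup>2 / 9 + \<delta>) / p)"
    using span_prob_ge[OF \<delta>] by metis
  \<comment> \<open>Large enough for the factor \<open>M / (M + 1)\<close> to leave half of the
    surplus \<open>e / 4\<close> in \<open>r\<close>.\<close>
  define M where "M = nat \<lceil>16 / e\<rceil>"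
  have M: "1 \<le> M" "1 + e / 8 \<le> real M / (real M + 1) * (1 + e / 4)"
  proof -
    have "16 / e \<le> real M" unfolding M_def by linarith
    hence Me: "16 \<le> real M * e" using e by (simp add: pos_divide_le_eq)
    thus "1 \<le> M" using e by (cases M) auto
    have eq: "real M * (1 + e / 4) - (1 + e / 8) * (real M + 1) = (real M * e - e) / 8 - 1"
      by (simp add: field_simps)
    have "8 + e \<le> real M * e" using Me e by linarith
    hence "0 \<le> (real M * e - e) / 8 - 1" by (simp add: field_simps)
    hence "0 \<le> real M * (1 + e / 4) - (1 + e / 8) * (real M + 1)" unfolding eq .
    hence "(1 + e / 8) * (real M + 1) \<le> real M * (1 + e / 4)" by (simp only: diff_ge_0_iff_ge)
    thus "1 + e / 8 \<le> real M / (real M + 1) * (1 + e / 4)" by (simp add: pos_le_divide_eq)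
  qed
  define c\<^sub>1 where "c\<^sub>1 = p\<^sub>0 * exp (- (pi\<^sup>2 / (3 * p\<^sub>0)))"
  have c1: "0 < c\<^sub>1" using p0 by (simp add: c\<^sub>1_def)
  have \<eta>: "0 < e / 100" using e by simp
  have M0: "0 < real M" using M by simp
  note scales = eventually_scales[OF a e(1,2) \<eta> c0pos c1 M0]
  note ev = scales(1-5)[THEN eventually_compose_filterlim, OF x_top]
    scales(6)[of "\<bar>C\<bar>", THEN eventually_compose_filterlim, OF x_top]
    scales(7-10)[THEN eventually_compose_filterlim, OF x_top]
  let ?P = "\<lambda>\<epsilon> n. measure_pmf.prob (random_subset n (p n))
       {A. ereal ((1 - \<epsilon>) * x n) \<le> ereal_of_enat (percolation_time n A) \<and>
           ereal_of_enat (percolation_time n A) \<le> ereal ((1 + \<epsilon>) * x n)}"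
  have lower: "\<forall>\<^sub>F n in sequentially. 1 - exp (- (exp (e / 2 * ln (real n)) / 2)) - 16 * exp (- (e / 16 * ln (real n))) \<le> ?P e n"
    using ev ev_p eventually_ge_at_top[of 4]
  proof eventually_elim
    case (elim n)
    note E = elim(1-10) and pl = elim(11) and n3 = elim(12)
    have n1: "1 \<le> n" using n3 by simp
    have p: "0 < p n" "p n < 1" using p_range[OF n1] by auto
    have lnn: "ln (real n) = 2 * \<beta> n * x n" using \<beta>0[OF n1] by (simp add: x_def \<beta>_def)
    have ln1: "1 < ln (real n)"
    proof -
      have "exp 1 \<le> (3 :: real)" by (rule exp_le)
      hence "exp 1 < real n" using n3 by linarith
      hence "ln (exp 1) < ln (real n)" by (subst ln_less_cancel_iff) (use n1 in auto)
      thus ?thesis by simp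
    qed
    have lnx: "0 < ln (2 * x n)" using E(1) by simp
    \<comment> \<open>For \<open>\<beta> < 1\<close> one has \<open>ln n \<le> 2 * x\<close>, and
      the hypothesis on \<open>p * ln (ln n)\<close> applies together with
      \<open>p \<le> \<beta>\<close>; for larger \<beta> the left side is at most 1.\<close>
    have \<beta>: "c\<^sub>0 / ln (2 * x n) \<le> \<beta> n"
    proof (cases "1 \<le> \<beta> n")
      case True
      have "c\<^sub>0 / ln (2 * x n) \<le> 1" using E(10) lnx by (simp add: pos_divide_le_eq)
      thus ?thesis using True by linarith
    next
      case False
      have "2 * \<beta> n * x n \<le> 2 * 1 * x n" using False E(1) by (intro mult_right_mono mult_left_mono) auto
      hence "ln (real n) \<le> 2 * x n" using lnn by simp
      hence "ln (ln (real n)) \<le> ln (2 * x n)" using ln1 by (subst ln_le_cancel_iff) auto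
      hence "p n * ln (ln (real n)) \<le> p n * ln (2 * x n)" using p by (intro mult_left_mono) auto
      hence "c\<^sub>0 / ln (2 * x n) \<le> p n" using pl lnx by (simp add: pos_divide_le_eq)
      also have "\<dots> \<le> \<beta> n"
        using ln_le_minus_one[of "1 - p n"] p by (simp add: \<beta>_def ln_div)
      finally show ?thesis .
    qed
    define L m r where "L = nat \<lceil>x n powr a\<rceil>" and "m = nat \<lceil>x n powr (1 - 4 * a)\<rceil>" 
      and "r = nat \<lceil>(1 + e / 4) * x n\<rceil>"
    define N where "N = r + m * L + L + 2"
    have E1: "1 \<le> 2 * (e / 100) * x n" "2 \<le> x n" "8 / (e / 100) \<le> x n powr a" "2 \<le> x n powr a" using E(1) by auto
    note sc = scale_conditions[OF a e(1,2) \<eta> c0pos L_def m_def r_def N_def E1 E(2-5) \<beta> \<beta>0[OF n1]]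
    have L1: "1 \<le> L" using sc(3) by simp
    have s: "(1 - span_prob (p n) L) ^ m \<le> (1 - p n) ^ (4 * L * M)"
      by (rule seed_condition[OF p E1(2) lnn[unfolded \<beta>_def] ln1 less_imp_le[OF pl] c0pos a exponent p0 span L1
            sc(1) sc(2) sc(5) E(6) E(7) E(8)[unfolded c\<^sub>1_def] E(9)])
    show ?case
      using percolation_probability[OF p e(1,2) n1 lnn[unfolded \<beta>_def] E1(2) sc(3) sc(4) M r_def N_def s sc(6)
          sc(7)[unfolded \<beta>_def] sc(8)[unfolded \<beta>_def] sc(9)[unfolded \<beta>_def]] .
  qed
  have lim: "(\<lambda>n. 1 - exp (- (exp (e / 2 * ln (real n)) / 2)) - 16 * exp (- (e / 16 * ln (real n)))) \<longlonglongrightarrow> 1"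
    using e(1) by real_asymp
  have mono: "\<forall>\<^sub>F n in sequentially. ?P e n \<le> ?P \<epsilon> n"
    using eventually_ge_at_top[of 1]
  proof eventually_elim
    case (elim n)
    have x0: "0 \<le> x n" using \<beta>0[OF elim] elim by (auto simp: x_def \<beta>_def intro!: divide_nonneg_nonneg)
    have "(1 - \<epsilon>) * x n \<le> (1 - e) * x n" "(1 + e) * x n \<le> (1 + \<epsilon>) * x n"
      using e x0 by (auto intro!: mult_right_mono)
    hence "ereal ((1 - \<epsilon>) * x n) \<le> ereal ((1 - e) * x n)" "ereal ((1 + e) * x n) \<le> ereal ((1 + \<epsilon>) * x n)"
      by simp_all
    thus ?case by (intro measure_pmf.finite_measure_mono Collect_mono conj_mono impI)
       (erule (1) order_trans, erule (1) order_trans, simp)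
  qed
  have "\<forall>\<^sub>F n in sequentially. 1 - exp (- (exp (e / 2 * ln (real n)) / 2)) - 16 * exp (- (e / 16 * ln (real n))) \<le> ?P \<epsilon> n"
    using lower mono by eventually_elim (rule order_trans)
  hence "?P \<epsilon> \<longlonglongrightarrow> 1"
    by (rule tendsto_sandwich[OF _ _ lim tendsto_const]) simp
  thus "(\<lambda>n. measure_pmf.prob (random_subset n (p n))
       {A. ereal ((1 - \<epsilon>) * (ln (real n) / (2 * ln (1 / (1 - p n)))))
             \<le> ereal_of_enat (percolation_time n A) \<and>
           ereal_of_enat (percolation_time n A)
             \<le> ereal ((1 + \<epsilon>) * (ln (real n) / (2 * ln (1 / (1 - p n)))))})
    \<longlonglongrightarrow> 1"
    unfolding x_def .
qed

end
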